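(* Let $\Gamma=\langle v_0,v_1,\ldots,v_g\rangle$ be the semigroup of values of a plane branch, with conductor $c$, and let $\mathcal E\subset\mathbb C^{c-v_1-1}$ be the constructible set parametrizing its equisingularity class, i.e. the set of coefficient vectors $(c_{v_1+1},\ldots,c_{c-1})$ such that the branch $x=t^{v_0},\ y=t^{v_1}+\sum_{i=v_1+1}^{c-1}c_it^i$ has semigroup $\Gamma$. Let $\mathcal E_\ell\subset\mathcal E$ be the (constructible) subset consisting of those points whose corresponding branch has a prescribed set $\Lambda_\ell$ of values of K\"ahler differentials. Then on each irreducible component of $\mathcal E_\ell$ there is a Zariski open dense subset on which the equisingularity class of the general polar of the corresponding curves is constant.
   Context: For a reduced germ $f\in\mathbb C\{x,y\}$ with $f(0,0)=0$, the polar of $f$ in the direction $(a:b)\in\mathbb P^1_{\mathbb C}$ is the germ $af_x+bf_y=0$; except for finitely many directions it is reduced and its equisingularity class (class under germs of homeomorphisms of $(\mathbb C^2,0)$) is independent of $(a:b)$, and this is called the equisingularity class of the general polar of $f$. The set $\Lambda$ of values of K\"ahler differentials of a branch $\mathcal C$ with parametrization $(x(t),y(t))$ is the set of $t$-orders (plus one, i.e. values $\mathrm{ord}_t(\omega(t)/dt)+1$) of the pullbacks $\omega(t)$ of holomorphic $1$-forms $\omega=A\,dx+B\,dy$ to the normalization; it is an analytic invariant and contains $\Gamma\setminus\{0\}$. The sets $\mathcal E_\ell$ (finitely many) partition $\mathcal E$. *)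

theory Defs
  imports "HOL-Analysis.Analysis"
begin

text \<open>A convergent power series in two variables (an element of C{x,y}), represented by
  its sum function near the origin.\<close>
definition conv2 :: "(complex \<times> complex \<Rightarrow> complex) \<Rightarrow> bool" where
  "conv2 F \<longleftrightarrow> (\<exists>(a :: nat \<times> nat \<Rightarrow> complex) r. r > 0 \<and>
     (\<forall>x y. cmod x < r \<and> cmod y < r \<longrightarrow>
        ((\<lambda>(m,n). a (m,n) * x ^ m * y ^ n) has_sum F (x, y)) UNIV))"

definition ord0 :: "(complex \<Rightarrow> complex) \<Rightarrow> nat \<Rightarrow> bool" where
  "ord0 g n \<longleftrightarrow> (\<exists>h. h analytic_on {0} \<and> h 0 \<noteq> 0 \<and>
      eventually (\<lambda>t. g t = t ^ n * h t) (nhds 0))"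

definition value_semigroup :: "(complex \<Rightarrow> complex) \<Rightarrow> (complex \<Rightarrow> complex) \<Rightarrow> nat set" where
  "value_semigroup X Y = {n. \<exists>F. conv2 F \<and> ord0 (\<lambda>t. F (X t, Y t)) n}"

text \<open>Values of Kaehler differentials: ord_t(omega(t)/dt) + 1 for omega = A dx + B dy.\<close>
definition kahler_values :: "(complex \<Rightarrow> complex) \<Rightarrow> (complex \<Rightarrow> complex) \<Rightarrow> nat set" where
  "kahler_values X Y = {Suc n | n. \<exists>A B. conv2 A \<and> conv2 B \<and>
      ord0 (\<lambda>t. A (X t, Y t) * deriv X t + B (X t, Y t) * deriv Y t) n}"

definition is_branch_param :: "(complex \<Rightarrow> complex) \<Rightarrow> (complex \<Rightarrow> complex) \<Rightarrow> bool" where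
  "is_branch_param X Y \<longleftrightarrow> X analytic_on {0} \<and> Y analytic_on {0} \<and> X 0 = 0 \<and> Y 0 = 0"

text \<open>The normal-form branch x = t^v0, y = t^v1 + sum_{j<N} z_j t^(v1+1+j),
  where z_j is the coefficient c_{v1+1+j}.\<close>
definition bx :: "nat \<Rightarrow> complex \<Rightarrow> complex" where
  "bx v0 t = t ^ v0"

definition byp :: "nat \<Rightarrow> nat \<Rightarrow> (nat \<Rightarrow> complex) \<Rightarrow> complex \<Rightarrow> complex" where
  "byp v1 N z t = t ^ v1 + (\<Sum>j<N. z j * t ^ (v1 + 1 + j))"

definition sg_v0 :: "nat set \<Rightarrow> nat" where
  "sg_v0 G = (LEAST n. n \<in> G \<and> n > 0)"

definition sg_v1 :: "nat set \<Rightarrow> nat" where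
  "sg_v1 G = (LEAST n. n \<in> G \<and> \<not> sg_v0 G dvd n)"

definition conductor :: "nat set \<Rightarrow> nat" where
  "conductor G = (LEAST c. \<forall>n\<ge>c. n \<in> G)"

definition sg_dim :: "nat set \<Rightarrow> nat" where
  "sg_dim G = conductor G - sg_v1 G - 1"

definition aff :: "nat \<Rightarrow> (nat \<Rightarrow> complex) set" where
  "aff N = {z. \<forall>i\<ge>N. z i = 0}"

definition poly_fun :: "nat \<Rightarrow> ((nat \<Rightarrow> complex) \<Rightarrow> complex) \<Rightarrow> bool" where
  "poly_fun N p \<longleftrightarrow> (\<exists>(A :: (nat \<Rightarrow> nat) set) coef. finite A \<and>
     (\<forall>\<alpha>\<in>A. \<forall>i\<ge>N. \<alpha> i = 0) \<and>
     p = (\<lambda>z. \<Sum>\<alpha>\<in>A. coef \<alpha> * (\<Prod>i<N. z i ^ \<alpha> i)))"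

definition zclosed :: "nat \<Rightarrow> (nat \<Rightarrow> complex) set \<Rightarrow> bool" where
  "zclosed N S \<longleftrightarrow> (\<exists>P. (\<forall>p\<in>P. poly_fun N p) \<and> S = {z \<in> aff N. \<forall>p\<in>P. p z = 0})"

definition zirreducible :: "nat \<Rightarrow> (nat \<Rightarrow> complex) set \<Rightarrow> bool" where
  "zirreducible N Z \<longleftrightarrow> Z \<noteq> {} \<and> Z \<subseteq> aff N \<and>
     (\<forall>F G. zclosed N F \<and> zclosed N G \<and> Z \<subseteq> F \<union> G \<longrightarrow> Z \<subseteq> F \<or> Z \<subseteq> G)"

definition zirreducible_component :: "nat \<Rightarrow> (nat \<Rightarrow> complex) set \<Rightarrow> (nat \<Rightarrow> complex) set \<Rightarrow> bool" where
  "zirreducible_component N E Z \<longleftrightarrow> Z \<subseteq> E \<and> zirreducible N Z \<and>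
     (\<forall>Z'. Z \<subseteq> Z' \<and> Z' \<subseteq> E \<and> zirreducible N Z' \<longrightarrow> Z' = Z)"

definition zopen_in :: "nat \<Rightarrow> (nat \<Rightarrow> complex) set \<Rightarrow> (nat \<Rightarrow> complex) set \<Rightarrow> bool" where
  "zopen_in N Z U \<longleftrightarrow> (\<exists>F. zclosed N F \<and> U = Z - F)"

definition zdense_in :: "nat \<Rightarrow> (nat \<Rightarrow> complex) set \<Rightarrow> (nat \<Rightarrow> complex) set \<Rightarrow> bool" where
  "zdense_in N Z U \<longleftrightarrow> (\<forall>F. zclosed N F \<and> U \<subseteq> F \<longrightarrow> Z \<subseteq> F)"

definition eq_class_set :: "nat set \<Rightarrow> (nat \<Rightarrow> complex) set" where
  "eq_class_set G = {z \<in> aff (sg_dim G).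
     value_semigroup (bx (sg_v0 G)) (byp (sg_v1 G) (sg_dim G) z) = G}"

definition eq_class_set_kahler :: "nat set \<Rightarrow> nat set \<Rightarrow> (nat \<Rightarrow> complex) set" where
  "eq_class_set_kahler G L = {z \<in> eq_class_set G.
     kahler_values (bx (sg_v0 G)) (byp (sg_v1 G) (sg_dim G) z) = L}"

definition weierstrass_eq :: "nat \<Rightarrow> (complex \<Rightarrow> complex) \<Rightarrow> (complex \<Rightarrow> complex)
    \<Rightarrow> (complex \<times> complex \<Rightarrow> complex) \<Rightarrow> bool" where
  "weierstrass_eq n X Y f \<longleftrightarrow> (\<exists>a :: nat \<Rightarrow> complex \<Rightarrow> complex.
     (\<forall>k<n. a k analytic_on {0} \<and> a k 0 = 0) \<and>
     f = (\<lambda>(x, y). y ^ n + (\<Sum>k<n. a k x * y ^ k)) \<and>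
     eventually (\<lambda>t. f (X t, Y t) = 0) (nhds 0))"

definition polar :: "(complex \<times> complex \<Rightarrow> complex) \<Rightarrow> complex \<Rightarrow> complex
    \<Rightarrow> (complex \<times> complex \<Rightarrow> complex)" where
  "polar f a b = (\<lambda>(x, y). a * deriv (\<lambda>s. f (s, y)) x + b * deriv (\<lambda>s. f (x, s)) y)"

text \<open>Equisingularity (topological equivalence) of the germs at 0 of the zero sets.\<close>
definition top_equiv :: "(complex \<times> complex \<Rightarrow> complex) \<Rightarrow> (complex \<times> complex \<Rightarrow> complex) \<Rightarrow> bool" where
  "top_equiv g h \<longleftrightarrow> (\<exists>U V \<phi> \<psi>. open U \<and> open V \<and> (0,0) \<in> U \<and>
     homeomorphism U V \<phi> \<psi> \<and> \<phi> (0,0) = (0,0) \<and>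
     \<phi> ` (U \<inter> {p. g p = 0}) = V \<inter> {p. h p = 0})"

text \<open>P holds for all directions (a:b) in P^1 outside a finite set.\<close>
definition general_dir :: "(complex \<Rightarrow> complex \<Rightarrow> bool) \<Rightarrow> bool" where
  "general_dir P \<longleftrightarrow> (\<exists>D. finite D \<and> (\<forall>(c,d)\<in>D. (c,d) \<noteq> (0,0)) \<and>
     (\<forall>a b. (a,b) \<noteq> (0,0) \<and> (\<forall>(c,d)\<in>D. a * d - b * c \<noteq> 0) \<longrightarrow> P a b))"

definition same_general_polar_class :: "(complex \<times> complex \<Rightarrow> complex) \<Rightarrow> (complex \<times> complex \<Rightarrow> complex) \<Rightarrow> bool" where
  "same_general_polar_class f g \<longleftrightarrow>
     general_dir (\<lambda>a b. general_dir (\<lambda>a' b'. top_equiv (polar f a b) (polar g a' b')))"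

end

theory Submission
  imports Defs "HOL-Complex_Analysis.Complex_Analysis" "HOL-Computational_Algebra.Fundamental_Theorem_Algebra"
begin

text \<open>For a fixed coefficient vector the polar of slope \<open>l\<close> is, up to a unit, a monic polynomial in \<open>y\<close>
  whose coefficients are power series in \<open>x\<close> depending polynomially on the coefficient vector and on \<open>l\<close>.
  Its Puiseux roots are power series in \<open>x\<^sup>1\<^sup>/\<^sup>L\<close> with \<open>L\<close> depending on the degree only.

  The orders of contact of the roots are encoded by power sums of products of root differences over all
  selections of roots. These sums are polynomials in the power sums of the roots, hence power series in \<open>x\<close>
  with coefficients polynomial in the parameters, and such a series has constant order on a nonempty Zariski
  open subset of an irreducible set. So for generic parameters the contact orders agree up to a bijection
  of the roots.

  A bijection preserving contact orders can be replaced by one that is also equivariant under the monodromy: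
  induct over the tree of contacts and count the children of a node modulo the order of the root of unity
  acting on them.

  Given such an equivariant bijection, the affine combinations of corresponding roots, with a complex
  parameter avoiding finitely many values, form a family with constant contact orders. For nearby
  parameters the displacement of the roots is Lipschitz with a small constant on every fibre, so its
  McShane extension perturbs the identity to an injective continuous map, which is a homeomorphism
  by invariance of domain.\<close>

section \<open>Newton identities\<close>

text \<open>The coefficients of a single Puiseux root are in general not polynomial in the branch
  coefficients, and the roots have no consistent numbering as parameters vary, so contact orders
  cannot be compared root by root. Symmetric sums are polynomial in the parameters but may lose
  their lowest term by cancellation; using the \<open>l\<close>-th powers of the summands for every
  \<open>l\<close> up to their number excludes this, since finitely many complex numbers, not all
  zero, have a nonzero power sum among these. Weights \<open>B ^ k\<close> on the differences, with
  \<open>B\<close> above the total contact, make the whole table of contact orders the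
  base-\<open>B\<close> digits of one order. As \<open>B\<close> depends on the roots, it is read
  off at one generic sample, and genericity is imposed in two rounds. Equivariance of the matching
  is what lets a homeomorphism descend from \<open>t\<close> to \<open>x = t ^ L\<close>. The
  interpolation parameter is complex because the real segment from 0 to 1 may meet a value where
  leading coefficients of root differences cancel, whereas the plane minus a finite set is
  connected.\<close>

definition recip_fps :: "('i \<Rightarrow> 'a::comm_ring_1) \<Rightarrow> 'i set \<Rightarrow> 'a fps" where
  "recip_fps a I = (\<Prod>i\<in>I. 1 - fps_const (a i) * fps_X)"

text \<open>Logarithmic derivative: each factor \<open>1 - a X\<close> contributes minus the
  geometric series with terms \<open>a ^ Suc n\<close>, and the product rule adds these up. Clearing
  denominators keeps the identity valid over any commutative ring.\<close>

lemma fps_deriv_recip_fps: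
  fixes a :: "'i \<Rightarrow> 'a::comm_ring_1"
  assumes "finite I"
  shows "fps_deriv (recip_fps a I) = - recip_fps a I * Abs_fps (\<lambda>n. \<Sum>i\<in>I. a i ^ Suc n)"
  using assms
proof (induction I rule: finite_induct)
  case empty
  then show ?case by (simp add: recip_fps_def fps_eq_iff)
next
  case (insert i I)
  define A where "A = Abs_fps (\<lambda>n. a i ^ Suc n)"
  define B where "B = Abs_fps (\<lambda>n. \<Sum>j\<in>I. a j ^ Suc n)"
  define l where "l = 1 - fps_const (a i) * fps_X"
  have ins: "recip_fps a (insert i I) = l * recip_fps a I" using insert by (simp add: recip_fps_def l_def)
  have lA: "l * A = fps_const (a i)"
  proof (rule fps_ext)
    fix n show "fps_nth (l * A) n = fps_nth (fps_const (a i)) n"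
      by (cases n) (simp_all add: l_def A_def algebra_simps)
  qed
  have AB: "Abs_fps (\<lambda>n. \<Sum>j\<in>insert i I. a j ^ Suc n) = A + B"
    using insert by (simp add: A_def B_def fps_eq_iff)
  have dl: "fps_deriv l = - fps_const (a i)" by (simp add: l_def)
  have "fps_deriv (l * recip_fps a I) = l * fps_deriv (recip_fps a I) + fps_deriv l * recip_fps a I"
    by simp
  also have "\<dots> = - (l * recip_fps a I) * B - (l * A) * recip_fps a I"
    using insert.IH by (simp add: B_def dl lA fps_const_neg[symmetric] del: fps_const_neg)
  also have "\<dots> = - (l * recip_fps a I) * (A + B)" by (simp add: algebra_simps)
  finally show ?case unfolding ins AB .
qed

lemma newton_identity:
  fixes a :: "'i \<Rightarrow> 'a::comm_ring_1"
  assumes "finite I"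
  shows "of_nat (Suc n) * fps_nth (recip_fps a I) (Suc n)
    = - (\<Sum>i=0..n. fps_nth (recip_fps a I) i * (\<Sum>j\<in>I. a j ^ Suc (n - i)))"
proof -
  have "fps_nth (fps_deriv (recip_fps a I)) n
     = fps_nth (- (recip_fps a I * Abs_fps (\<lambda>n. \<Sum>i\<in>I. a i ^ Suc n))) n"
    using fps_deriv_recip_fps[OF assms, of a] by simp
  then show ?thesis unfolding fps_neg_nth fps_mult_nth by simp
qed

lemma recip_fps_nth_0 [simp]: "fps_nth (recip_fps a I) 0 = 1"
  by (induction I rule: infinite_finite_induct) (simp_all add: recip_fps_def)

text \<open>\<open>recip_fps\<close> is the reciprocal polynomial of the monic polynomial with roots
  \<open>a i\<close>, so its coefficients are the signed elementary symmetric functions. Vanishing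
  beyond the degree is included because Newton's recursion runs over all indices.\<close>

lemma coeff_prod_linear:
  fixes a :: "'i \<Rightarrow> 'a::comm_ring_1"
  assumes "finite I"
  shows "(\<forall>j\<le>card I. coeff (\<Prod>i\<in>I. [:- a i, 1:]) (card I - j) = fps_nth (recip_fps a I) j)
    \<and> (\<forall>j>card I. fps_nth (recip_fps a I) j = 0 \<and> coeff (\<Prod>i\<in>I. [:- a i, 1:]) j = 0)"
  using assms
proof (induction I rule: finite_induct)
  case empty
  then show ?case by (simp add: recip_fps_def)
next
  case (insert i I)
  define P where "P = (\<Prod>i\<in>I. [:- a i, 1:])"
  have ins: "recip_fps a (insert i I) = recip_fps a I - fps_const (a i) * (fps_X * recip_fps a I)"
    using insert by (simp add: recip_fps_def algebra_simps)
  have P: "(\<Prod>i\<in>insert i I. [:- a i, 1:]) = [:- a i, 1:] * P" using insert by (simp add: P_def)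
  have c: "card (insert i I) = Suc (card I)" using insert by simp
  have IH1: "coeff P (card I - j) = fps_nth (recip_fps a I) j" if "j \<le> card I" for j
    using insert.IH that by (simp add: P_def)
  have IH2: "fps_nth (recip_fps a I) j = 0" "coeff P j = 0" if "j > card I" for j
    using insert.IH that by (simp_all add: P_def)
  show ?case unfolding P c
  proof (intro conjI allI impI)
    fix j assume j: "j \<le> Suc (card I)"
    show "coeff ([:- a i, 1:] * P) (Suc (card I) - j) = fps_nth (recip_fps a (insert i I)) j"
    proof (cases j)
      case 0
      then show ?thesis using IH1[of 0] IH2(2)[of "Suc (card I)"] by simp
    next
      case (Suc k)
      then have k: "Suc (card I) - j = card I - k" "k \<le> card I" using j by auto
      have "coeff ([:- a i, 1:] * P) (card I - k) = - a i * coeff P (card I - k) + (if k = card I then 0 else coeff P (card I - j))"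
        using k Suc by (cases "card I - k") (auto intro!: arg_cong[of _ _ "coeff P"])
      also have "(if k = card I then 0 else coeff P (card I - j)) = fps_nth (recip_fps a I) j"
        using IH1[of j] IH2(1)[of j] Suc k by auto
      finally show ?thesis unfolding k ins using IH1[OF k(2)] Suc by simp
    qed
  next
    fix j assume j: "j > Suc (card I)"
    then obtain k where k: "j = Suc k" "k > card I" by (cases j) auto
    show "fps_nth (recip_fps a (insert i I)) j = 0" "coeff ([:- a i, 1:] * P) j = 0"
      using IH2[of k] IH2[of j] k by (simp_all add: ins)
  qed
qed

lemma coeff_prod_linear_rev:
  fixes a :: "'i \<Rightarrow> 'a::comm_ring_1"
  assumes "finite I" "j \<le> card I"
  shows "coeff (\<Prod>i\<in>I. [:- a i, 1:]) j = fps_nth (recip_fps a I) (card I - j)"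
  using coeff_prod_linear[OF assms(1), of a] assms(2) by (metis diff_diff_cancel diff_le_self)

lemma degree_prod_linear:
  fixes a :: "'i \<Rightarrow> 'a::comm_ring_1"
  assumes "finite I"
  shows "degree (\<Prod>i\<in>I. [:- a i, 1:]) = card I" "coeff (\<Prod>i\<in>I. [:- a i, 1:]) (card I) = 1"
proof -
  show 1: "coeff (\<Prod>i\<in>I. [:- a i, 1:]) (card I) = 1"
    using coeff_prod_linear_rev[OF assms order_refl, of a] by simp
  have "degree (\<Prod>i\<in>I. [:- a i, 1:]) \<le> card I"
    by (rule degree_le) (use coeff_prod_linear[OF assms, of a] in auto)
  moreover have "card I \<le> degree (\<Prod>i\<in>I. [:- a i, 1:])" using 1 by (intro le_degree) simp
  ultimately show "degree (\<Prod>i\<in>I. [:- a i, 1:]) = card I" by simp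
qed

text \<open>The recursion from elementary symmetric functions to power sums never divides, so it
  works over power series and preserves polynomial dependence on parameters. The argument
  \<open>m\<close> enters only as the zeroth power sum, the number of roots.\<close>

fun newton_psum :: "(nat \<Rightarrow> 'a::comm_ring_1) \<Rightarrow> nat \<Rightarrow> nat \<Rightarrow> 'a" where
  "newton_psum e m 0 = of_nat m"
| "newton_psum e m (Suc k) = - (of_nat (Suc k) * e (Suc k)) - (\<Sum>i\<in>{1..k}. e i * newton_psum e m (Suc k - i))"

lemma power_sum_eq_newton_psum:
  fixes a :: "'i \<Rightarrow> 'a::comm_ring_1"
  assumes "finite I"
  shows "(\<Sum>i\<in>I. a i ^ k) = newton_psum (fps_nth (recip_fps a I)) (card I) k"
proof (induction k rule: less_induct)
  case (less k)
  show ?case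
  proof (cases k)
    case 0
    then show ?thesis by simp
  next
    case (Suc n)
    define e where "e = fps_nth (recip_fps a I)"
    have "{0..n} = insert 0 {1..n}" by auto
    then have "(\<Sum>i=0..n. e i * (\<Sum>j\<in>I. a j ^ Suc (n - i)))
        = (\<Sum>j\<in>I. a j ^ k) + (\<Sum>i\<in>{1..n}. e i * (\<Sum>j\<in>I. a j ^ Suc (n - i)))"
      using Suc by (simp add: e_def)
    moreover have "(\<Sum>i\<in>{1..n}. e i * (\<Sum>j\<in>I. a j ^ Suc (n - i))) = (\<Sum>i\<in>{1..n}. e i * newton_psum e (card I) (Suc n - i))"
    proof (rule sum.cong)
      fix i assume "i \<in> {1..n}"
      then have "Suc n - i < k" "Suc (n - i) = Suc n - i" using Suc by auto
      then show "e i * (\<Sum>j\<in>I. a j ^ Suc (n - i)) = e i * newton_psum e (card I) (Suc n - i)"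
        using less.IH[of "Suc n - i"] by (simp add: e_def)
    qed simp
    ultimately have "of_nat (Suc n) * e (Suc n)
        = - ((\<Sum>j\<in>I. a j ^ k) + (\<Sum>i\<in>{1..n}. e i * newton_psum e (card I) (Suc n - i)))"
      using newton_identity[OF assms, of n a] by (simp add: e_def)
    then have "(\<Sum>j\<in>I. a j ^ k) = - (of_nat (Suc n) * e (Suc n)) - (\<Sum>i\<in>{1..n}. e i * newton_psum e (card I) (Suc n - i))"
      by (metis add.commute add_diff_cancel_left' diff_minus_eq_add minus_minus uminus_add_conv_diff)
    then show ?thesis unfolding Suc newton_psum.simps e_def[symmetric] by simp
  qed
qed

lemma finite_common_conv_radius:
  fixes A :: "complex fps set"
  assumes "finite A" "\<And>x. x \<in> A \<Longrightarrow> fps_conv_radius x > 0"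
  obtains r where "r > 0" "\<And>x. x \<in> A \<Longrightarrow> ereal r < fps_conv_radius x"
proof -
  have "\<exists>r>0. \<forall>x\<in>A. ereal r < fps_conv_radius x"
    using assms
  proof (induction A rule: finite_induct)
    case empty
    then show ?case by (intro exI[of _ 1]) simp
  next
    case (insert x A)
    then obtain r where r: "r > 0" "\<forall>x\<in>A. ereal r < fps_conv_radius x" by auto
    obtain s where s: "0 < ereal s" "ereal s < fps_conv_radius x"
      using ereal_dense2[of 0 "fps_conv_radius x"] insert.prems by auto
    show ?case
    proof (intro exI[of _ "min r s"] conjI ballI)
      fix y assume "y \<in> insert x A"
      then show "ereal (min r s) < fps_conv_radius y"
        using r s by (auto simp: min_def intro: le_less_trans[of _ "ereal s"] le_less_trans[of _ "ereal r"])
    qed (use r s in auto)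
  qed
  then show ?thesis using that by blast
qed

lemma newton_psum_holomorphic:
  assumes "\<And>j. (\<lambda>x. e x j) holomorphic_on A"
  shows "(\<lambda>x. newton_psum (e x) m k :: complex) holomorphic_on A"
proof (induction k rule: less_induct)
  case (less k)
  then show ?case using assms by (cases k) (auto intro!: holomorphic_intros)
qed

text \<open>Newton's identities solved in the other direction, at the price of dividing by
  \<open>Suc n\<close>. The index set may vary with \<open>x\<close>: only the sums have to be
  holomorphic, not an enumeration of the roots.\<close>

lemma recip_fps_holomorphic:
  fixes a :: "complex \<Rightarrow> 'i \<Rightarrow> complex"
  assumes s: "\<And>k. (\<lambda>x. \<Sum>i\<in>I x. a x i ^ k) holomorphic_on A" and fin: "\<And>x. x \<in> A \<Longrightarrow> finite (I x)"
  shows "(\<lambda>x. fps_nth (recip_fps (a x) (I x)) j) holomorphic_on A"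
proof (induction j rule: less_induct)
  case (less j)
  show ?case
  proof (cases j)
    case 0
    then show ?thesis by simp
  next
    case (Suc n)
    have "(\<lambda>x. - (\<Sum>i=0..n. fps_nth (recip_fps (a x) (I x)) i * (\<Sum>j\<in>I x. a x j ^ Suc (n - i))) / of_nat (Suc n)) holomorphic_on A"
      using Suc less.IH s by (intro holomorphic_intros) (auto simp del: power_Suc of_nat_Suc)
    then show ?thesis
    proof (rule holomorphic_transform)
      fix x assume "x \<in> A"
      then have "of_nat (Suc n) * fps_nth (recip_fps (a x) (I x)) (Suc n)
          = - (\<Sum>i=0..n. fps_nth (recip_fps (a x) (I x)) i * (\<Sum>j\<in>I x. a x j ^ Suc (n - i)))"
        by (intro newton_identity fin)
      then show "- (\<Sum>i=0..n. fps_nth (recip_fps (a x) (I x)) i * (\<Sum>j\<in>I x. a x j ^ Suc (n - i))) / of_nat (Suc n)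
          = fps_nth (recip_fps (a x) (I x)) j"
        using Suc by (simp add: field_simps del: of_nat_Suc)
    qed
  qed
qed

section \<open>Contact of finite sets of power series\<close>

definition fps_rot :: "complex \<Rightarrow> complex fps \<Rightarrow> complex fps" where
  "fps_rot w y = Abs_fps (\<lambda>k. w ^ k * fps_nth y k)"

lemma fps_nth_rot [simp]: "fps_nth (fps_rot w y) k = w ^ k * fps_nth y k"
  by (simp add: fps_rot_def)

lemma fps_rot_one [simp]: "fps_rot 1 y = y"
  by (simp add: fps_eq_iff)

lemma fps_rot_rot: "fps_rot w (fps_rot w' y) = fps_rot (w * w') y"
  by (simp add: fps_eq_iff power_mult_distrib mult_ac)

lemma fps_rot_diff: "fps_rot w (x - y) = fps_rot w x - fps_rot w y"
  by (simp add: fps_eq_iff algebra_simps)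

lemma subdegree_fps_rot:
  assumes "w \<noteq> 0"
  shows "subdegree (fps_rot w y) = subdegree y"
proof (cases "y = 0")
  case True
  then have "fps_rot w y = 0" by (simp add: fps_eq_iff)
  then show ?thesis using True by simp
next
  case False
  then show ?thesis using assms by (intro subdegreeI) auto
qed

lemma fps_rot_eq_iff:
  assumes "w \<noteq> 0"
  shows "fps_rot w x = fps_rot w y \<longleftrightarrow> x = y"
  using assms by (auto simp: fps_eq_iff)

text \<open>Since \<open>subdegree 0 = 0\<close>, the order of a difference does not detect
  equality, so bijectivity is a separate clause. For \<open>w = 1\<close> the last clause is trivial
  and only contacts are compared.\<close>

definition contact_iso ::
  "complex \<Rightarrow> complex fps set \<Rightarrow> complex fps set \<Rightarrow> (complex fps \<times> complex fps) set \<Rightarrow> bool" where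
  "contact_iso w Y Y' R \<longleftrightarrow> Domain R = Y \<and> Range R = Y' \<and>
     (\<forall>(x, x') \<in> R. \<forall>(y, y') \<in> R.
        (x = y \<longleftrightarrow> x' = y') \<and> subdegree (x - y) = subdegree (x' - y')) \<and>
     (\<forall>(x, x') \<in> R. (fps_rot w x, fps_rot w x') \<in> R)"

definition contact_equiv :: "complex \<Rightarrow> complex fps set \<Rightarrow> complex fps set \<Rightarrow> bool" where
  "contact_equiv w Y Y' \<longleftrightarrow> (\<exists>R. contact_iso w Y Y' R)"

lemma contact_iso_eq:
  "contact_iso w Y Y' R \<Longrightarrow> (x, x') \<in> R \<Longrightarrow> (y, y') \<in> R \<Longrightarrow> x = y \<longleftrightarrow> x' = y'"
  unfolding contact_iso_def by fast

lemma contact_iso_subdegree: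
  "contact_iso w Y Y' R \<Longrightarrow> (x, x') \<in> R \<Longrightarrow> (y, y') \<in> R \<Longrightarrow> subdegree (x - y) = subdegree (x' - y')"
  unfolding contact_iso_def by fast

lemma contact_iso_rot:
  "contact_iso w Y Y' R \<Longrightarrow> (x, x') \<in> R \<Longrightarrow> (fps_rot w x, fps_rot w x') \<in> R"
  unfolding contact_iso_def by fast

lemma contact_iso_Domain: "contact_iso w Y Y' R \<Longrightarrow> Domain R = Y"
  and contact_iso_Range: "contact_iso w Y Y' R \<Longrightarrow> Range R = Y'"
  unfolding contact_iso_def by auto

lemma contact_isoI:
  assumes "Domain R = Y" "Range R = Y'"
    and "\<And>x x' y y'. (x, x') \<in> R \<Longrightarrow> (y, y') \<in> R \<Longrightarrow> x = y \<longleftrightarrow> x' = y'"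
    and "\<And>x x' y y'. (x, x') \<in> R \<Longrightarrow> (y, y') \<in> R \<Longrightarrow> x \<noteq> y \<Longrightarrow> x' \<noteq> y' \<Longrightarrow> subdegree (x - y) = subdegree (x' - y')"
    and "\<And>x x'. (x, x') \<in> R \<Longrightarrow> (fps_rot w x, fps_rot w x') \<in> R"
  shows "contact_iso w Y Y' R"
  unfolding contact_iso_def
proof (intro conjI ballI)
  fix p assume p: "p \<in> R"
  obtain x x' where [simp]: "p = (x, x')" by (cases p)
  have "\<forall>q\<in>R. case q of (y, y') \<Rightarrow> (x = y) = (x' = y') \<and> subdegree (x - y) = subdegree (x' - y')"
  proof
    fix q assume q: "q \<in> R"
    obtain y y' where [simp]: "q = (y, y')" by (cases q)
    have "(x = y) = (x' = y')" using assms(3) p q by simp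
    moreover have "subdegree (x - y) = subdegree (x' - y')"
    proof (cases "x = y")
      case True then show ?thesis using calculation by simp
    next
      case False then show ?thesis using calculation assms(4) p q by simp
    qed
    ultimately show "case q of (y, y') \<Rightarrow> (x = y) = (x' = y') \<and> subdegree (x - y) = subdegree (x' - y')"
      by simp
  qed
  then show "case p of (x, x') \<Rightarrow> \<forall>(y, y')\<in>R. (x = y) = (x' = y') \<and> subdegree (x - y) = subdegree (x' - y')"
    by simp
qed (use assms in auto)

lemma contact_equiv_sym: "contact_equiv w Y Y' \<Longrightarrow> contact_equiv w Y' Y"
proof -
  assume "contact_equiv w Y Y'"
  then obtain R where R: "contact_iso w Y Y' R" by (auto simp: contact_equiv_def)
  have "contact_iso w Y' Y (R\<inverse>)"
    by (rule contact_isoI)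
       (use contact_iso_Domain[OF R] contact_iso_Range[OF R] contact_iso_eq[OF R]
          contact_iso_subdegree[OF R] contact_iso_rot[OF R] in auto)
  then show ?thesis by (auto simp: contact_equiv_def)
qed

lemma contact_equiv_trans [trans]:
  assumes "contact_equiv w X Y" "contact_equiv w Y Z"
  shows "contact_equiv w X Z"
proof -
  obtain R where R: "contact_iso w X Y R" using assms(1) by (auto simp: contact_equiv_def)
  obtain S where S: "contact_iso w Y Z S" using assms(2) by (auto simp: contact_equiv_def)
  have "contact_iso w X Z (R O S)"
  proof (rule contact_isoI)
    show "Domain (R O S) = X" using contact_iso_Domain[OF R] contact_iso_Range[OF R] contact_iso_Domain[OF S]
      by blast
    show "Range (R O S) = Z" using contact_iso_Range[OF R] contact_iso_Domain[OF S] contact_iso_Range[OF S]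
      by blast
  next
    fix x x' y y' assume "(x, x') \<in> R O S" "(y, y') \<in> R O S"
    then obtain u v where uv: "(x, u) \<in> R" "(u, x') \<in> S" "(y, v) \<in> R" "(v, y') \<in> S" by blast
    show "(x = y) = (x' = y')" using contact_iso_eq[OF R uv(1,3)] contact_iso_eq[OF S uv(2,4)] by simp
    show "subdegree (x - y) = subdegree (x' - y')"
      using contact_iso_subdegree[OF R uv(1,3)] contact_iso_subdegree[OF S uv(2,4)] by simp
  next
    fix x x' assume "(x, x') \<in> R O S"
    then show "(fps_rot w x, fps_rot w x') \<in> R O S"
      using contact_iso_rot[OF R] contact_iso_rot[OF S] by blast
  qed
  then show ?thesis by (auto simp: contact_equiv_def)
qed

text \<open>Constant contact \<open>h\<close> across two blocks makes the union of any two matchings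
  a matching. Blocks that agree below level \<open>h\<close> and differ at it have exactly this
  property.\<close>

lemma contact_equiv_glue:
  assumes e: "contact_equiv w X X'" "contact_equiv w Z Z'"
    and c: "\<And>x z. x \<in> X \<Longrightarrow> z \<in> Z \<Longrightarrow> x \<noteq> z \<and> subdegree (x - z) = h"
    and c': "\<And>x z. x \<in> X' \<Longrightarrow> z \<in> Z' \<Longrightarrow> x \<noteq> z \<and> subdegree (x - z) = h"
  shows "contact_equiv w (X \<union> Z) (X' \<union> Z')"
proof -
  obtain R where R: "contact_iso w X X' R" using e by (auto simp: contact_equiv_def)
  obtain S where S: "contact_iso w Z Z' S" using e by (auto simp: contact_equiv_def)
  have X: "x \<in> X \<and> x' \<in> X'" if "(x, x') \<in> R" for x x'
    using contact_iso_Domain[OF R] contact_iso_Range[OF R] that by auto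
  have Z: "x \<in> Z \<and> x' \<in> Z'" if "(x, x') \<in> S" for x x'
    using contact_iso_Domain[OF S] contact_iso_Range[OF S] that by auto
  have "contact_iso w (X \<union> Z) (X' \<union> Z') (R \<union> S)"
  proof (rule contact_isoI)
    show "Domain (R \<union> S) = X \<union> Z" "Range (R \<union> S) = X' \<union> Z'"
      using contact_iso_Domain[OF R] contact_iso_Range[OF R] contact_iso_Domain[OF S] contact_iso_Range[OF S]
      by auto
  next
    fix x x' y y' assume a: "(x, x') \<in> R \<union> S" "(y, y') \<in> R \<union> S"
    have sw: "subdegree (a - b) = subdegree (b - a)" for a b :: "complex fps"
      by (metis minus_diff_eq subdegree_uminus)
    show "(x = y) = (x' = y')" 
      using a X Z c c' contact_iso_eq[OF R] contact_iso_eq[OF S] by (metis UnE)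
    show "subdegree (x - y) = subdegree (x' - y')"
      using a X Z c c' contact_iso_subdegree[OF R] contact_iso_subdegree[OF S] sw by (metis UnE)
  next
    fix x x' assume "(x, x') \<in> R \<union> S"
    then show "(fps_rot w x, fps_rot w x') \<in> R \<union> S"
      using contact_iso_rot[OF R] contact_iso_rot[OF S] by blast
  qed
  then show ?thesis by (auto simp: contact_equiv_def)
qed

text \<open>A subset need not be stable under rotation, so only the case \<open>w = 1\<close>
  survives restriction.\<close>

lemma contact_equiv_restrict:
  assumes R: "contact_iso w Y Y' R" and "X \<subseteq> Y"
  shows "contact_equiv 1 X (R `` X)"
proof -
  have "contact_iso 1 X (R `` X) {p \<in> R. fst p \<in> X}"
  proof (rule contact_isoI)
    show "Domain {p \<in> R. fst p \<in> X} = X" using contact_iso_Domain[OF R] assms(2) by force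
    show "Range {p \<in> R. fst p \<in> X} = R `` X" by force
  qed (use contact_iso_eq[OF R] contact_iso_subdegree[OF R] in auto)
  then show ?thesis by (auto simp: contact_equiv_def)
qed

lemma contact_equiv_rot_image:
  assumes "w \<noteq> 0"
  shows "contact_equiv 1 X (fps_rot w ` X)"
proof -
  have "contact_iso 1 X (fps_rot w ` X) ((\<lambda>x. (x, fps_rot w x)) ` X)"
    by (rule contact_isoI)
       (use fps_rot_eq_iff[OF assms] subdegree_fps_rot[OF assms] in \<open>auto simp flip: fps_rot_diff\<close>)
  then show ?thesis by (auto simp: contact_equiv_def)
qed

lemma contact_iso_Image_Diff:
  assumes R: "contact_iso w Y Y' R" and "X \<subseteq> Y"
  shows "R `` (Y - X) = Y' - R `` X"
proof -
  have "R `` (Y - X) \<subseteq> Y'" using contact_iso_Range[OF R] by blast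
  moreover have "R `` (Y - X) \<inter> R `` X = {}" using contact_iso_eq[OF R] by blast
  moreover have "Y' \<subseteq> R `` (Y - X) \<union> R `` X"
    using contact_iso_Range[OF R] contact_iso_Domain[OF R] by blast
  ultimately show ?thesis by blast
qed

section \<open>Children of a node in the tree of contacts\<close>

definition agree_below :: "nat \<Rightarrow> complex fps set \<Rightarrow> bool" where
  "agree_below h Y \<longleftrightarrow> (\<forall>x\<in>Y. \<forall>y\<in>Y. \<forall>k<h. fps_nth x k = fps_nth y k)"

definition jet_class :: "nat \<Rightarrow> complex fps set \<Rightarrow> complex \<Rightarrow> complex fps set" where
  "jet_class h Y a = {y \<in> Y. fps_nth y h = a}"

lemma agree_below_subset: "agree_below h Y \<Longrightarrow> X \<subseteq> Y \<Longrightarrow> agree_below h X"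
  unfolding agree_below_def by blast

lemma agree_belowD: "agree_below h Y \<Longrightarrow> x \<in> Y \<Longrightarrow> y \<in> Y \<Longrightarrow> k < h \<Longrightarrow> fps_nth x k = fps_nth y k"
  unfolding agree_below_def by blast

lemma agree_below_subdegree:
  assumes "agree_below h Y" "x \<in> Y" "y \<in> Y" "fps_nth x h \<noteq> fps_nth y h"
  shows "x \<noteq> y \<and> subdegree (x - y) = h"
proof -
  have "subdegree (x - y) = h"
    by (rule subdegreeI) (simp_all add: agree_belowD[OF assms(1-3)] assms(4))
  then show ?thesis using assms by auto
qed

lemma agree_below_same_jet:
  assumes "agree_below h Y" "x \<in> Y" "y \<in> Y"
  shows "fps_nth x h = fps_nth y h \<longleftrightarrow> x = y \<or> subdegree (x - y) > h"
proof
  assume eq: "fps_nth x h = fps_nth y h"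
  show "x = y \<or> subdegree (x - y) > h"
  proof (cases "x = y")
    case False
    then have "fps_nth (x - y) (subdegree (x - y)) \<noteq> 0" by (intro nth_subdegree_nonzero) simp
    moreover have "fps_nth (x - y) k = 0" if "k \<le> h" for k
      using eq that agree_belowD[OF assms, of k] by (cases "k = h") simp_all
    ultimately show ?thesis by (meson not_le)
  qed simp
next
  assume "x = y \<or> subdegree (x - y) > h"
  then show "fps_nth x h = fps_nth y h"
    using nth_less_subdegree_zero[of h "x - y"] by auto
qed

text \<open>Sharing the \<open>h\<close>-th coefficient can be expressed by contact alone, as
  equality or contact above \<open>h\<close>; the coefficient itself is not preserved by a
  matching.\<close>

lemma contact_iso_same_jet:
  assumes R: "contact_iso w Y Y' R" and l: "agree_below h Y" "agree_below h Y'"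
    and "(x, x') \<in> R" "(y, y') \<in> R"
  shows "fps_nth x h = fps_nth y h \<longleftrightarrow> fps_nth x' h = fps_nth y' h"
proof -
  have "x \<in> Y" "y \<in> Y" "x' \<in> Y'" "y' \<in> Y'"
    using contact_iso_Domain[OF R] contact_iso_Range[OF R] assms by auto
  then show ?thesis
    using agree_below_same_jet[OF l(1)] agree_below_same_jet[OF l(2)]
      contact_iso_eq[OF R assms(4,5)] contact_iso_subdegree[OF R assms(4,5)] by simp
qed

lemma contact_iso_jet_class:
  assumes R: "contact_iso w Y Y' R" and l: "agree_below h Y" "agree_below h Y'" and x: "(x, x') \<in> R"
  shows "R `` jet_class h Y (fps_nth x h) = jet_class h Y' (fps_nth x' h)"
proof -
  have "y' \<in> jet_class h Y' (fps_nth x' h) \<longleftrightarrow> y \<in> jet_class h Y (fps_nth x h)" if "(y, y') \<in> R" for y y'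
    using contact_iso_same_jet[OF R l x that] contact_iso_Domain[OF R] contact_iso_Range[OF R] that
    by (auto simp: jet_class_def)
  moreover have "jet_class h Y' (fps_nth x' h) \<subseteq> Range R"
    using contact_iso_Range[OF R] by (auto simp: jet_class_def)
  ultimately show ?thesis by blast
qed

text \<open>Cancellation of isomorphic children. A matching may send the class of \<open>a\<close>
  to that of some \<open>c\<close>, and the class of some \<open>b\<close> to that of
  \<open>a'\<close>. The composite from \<open>b\<close> through \<open>a'\<close> and
  \<open>a\<close> to \<open>c\<close> closes the gap, and all other children keep their
  partners.\<close>

lemma contact_equiv_cancel_class:
  assumes "contact_equiv 1 Y Y'" and l: "agree_below h Y" "agree_below h Y'"
    and e: "contact_equiv 1 (jet_class h Y a) (jet_class h Y' a')"
  shows "contact_equiv 1 (Y - jet_class h Y a) (Y' - jet_class h Y' a')"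
proof (cases "jet_class h Y a = {}")
  case True
  then have "jet_class h Y' a' = {}"
    using e contact_iso_Domain contact_iso_Range unfolding contact_equiv_def
    by (metis Domain_empty_iff Range_empty_iff)
  then show ?thesis using True assms(1) by simp
next
  case False
  obtain R where R: "contact_iso 1 Y Y' R" using assms by (auto simp: contact_equiv_def)
  have sub: "jet_class h Y b \<subseteq> Y" "jet_class h Y' b \<subseteq> Y'" for b by (auto simp: jet_class_def)
  obtain x where "x \<in> jet_class h Y a" using False by auto
  then obtain x' where x: "(x, x') \<in> R" "fps_nth x h = a" "x \<in> Y"
    using contact_iso_Domain[OF R] by (auto simp: jet_class_def)
  have "jet_class h Y' a' \<noteq> {}"
    using e False contact_iso_Domain contact_iso_Range unfolding contact_equiv_def
    by (metis Domain_empty_iff Range_empty_iff)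
  then obtain d d' where d: "(d, d') \<in> R" "fps_nth d' h = a'"
    using contact_iso_Range[OF R] by (auto simp: jet_class_def)
  define b c where "b = fps_nth d h" and "c = fps_nth x' h"
  have Ra: "R `` jet_class h Y a = jet_class h Y' c"
    using contact_iso_jet_class[OF R l x(1)] x c_def by simp
  have Rb: "R `` jet_class h Y b = jet_class h Y' a'"
    using contact_iso_jet_class[OF R l d(1)] d b_def by simp
  have iff: "b = a \<longleftrightarrow> a' = c"
    using contact_iso_same_jet[OF R l d(1) x(1)] d x by (simp add: b_def c_def)
  show ?thesis
  proof (cases "b = a")
    case True
    then have "R `` (Y - jet_class h Y a) = Y' - jet_class h Y' a'"
      using contact_iso_Image_Diff[OF R sub(1)] Ra iff by simp
    then show ?thesis using contact_equiv_restrict[OF R, of "Y - jet_class h Y a"] by auto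
  next
    case False
    define V V' where "V = Y - (jet_class h Y a \<union> jet_class h Y b)"
      and "V' = Y' - (jet_class h Y' c \<union> jet_class h Y' a')"
    have "R `` V = V'"
      using contact_iso_Image_Diff[OF R, of "jet_class h Y a \<union> jet_class h Y b"] Ra Rb sub
      by (simp add: V_def V'_def Image_Un)
    then have VV: "contact_equiv 1 V V'"
      using contact_equiv_restrict[OF R, of V] by (simp add: V_def)
    have "contact_equiv 1 (jet_class h Y b) (jet_class h Y' a')"
      using contact_equiv_restrict[OF R sub(1), of b] Rb by simp
    also have "contact_equiv 1 (jet_class h Y' a') (jet_class h Y a)"
      using e contact_equiv_sym by blast
    also have "contact_equiv 1 (jet_class h Y a) (jet_class h Y' c)"
      using contact_equiv_restrict[OF R sub(1), of a] Ra by simp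
    finally have "contact_equiv 1 (jet_class h Y b) (jet_class h Y' c)" .
    then have "contact_equiv 1 (jet_class h Y b \<union> V) (jet_class h Y' c \<union> V')"
    proof (rule contact_equiv_glue[OF _ VV, where h = h])
      show "x \<noteq> z \<and> subdegree (x - z) = h" if "x \<in> jet_class h Y b" "z \<in> V" for x z
        using that by (intro agree_below_subdegree[OF l(1)]) (auto simp: V_def jet_class_def)
      show "x \<noteq> z \<and> subdegree (x - z) = h" if "x \<in> jet_class h Y' c" "z \<in> V'" for x z
        using that by (intro agree_below_subdegree[OF l(2)]) (auto simp: V'_def jet_class_def)
    qed
    moreover have "jet_class h Y b \<union> V = Y - jet_class h Y a" "jet_class h Y' c \<union> V' = Y' - jet_class h Y' a'"
      using False iff by (auto simp: V_def V'_def jet_class_def)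
    ultimately show ?thesis by simp
  qed
qed

text \<open>Rotation multiplies the \<open>h\<close>-th coefficient by \<open>(w ^ k) ^ h\<close>.
  Surjectivity uses the inverse rotation, which acts on \<open>Y\<close> because for a root of unity
  it is again a power of \<open>w\<close>.\<close>

lemma fps_rot_jet_class:
  assumes inv: "fps_rot w ` Y \<subseteq> Y" and N: "w ^ N = 1" "N > 0"
  shows "fps_rot (w ^ k) ` jet_class h Y a = jet_class h Y ((w ^ h) ^ k * a)"
proof -
  have w: "w \<noteq> 0" using N by (auto simp: power_0_left)
  have inv': "fps_rot (w ^ j) y \<in> Y" if "y \<in> Y" for y j
  proof (induction j)
    case (Suc j)
    then show ?case using inv fps_rot_rot[of w "w ^ j" y] by (auto simp: image_subset_iff)
  qed (use that in simp)
  show ?thesis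
  proof (intro equalityI subsetI)
    fix y assume "y \<in> fps_rot (w ^ k) ` jet_class h Y a"
    then show "y \<in> jet_class h Y ((w ^ h) ^ k * a)"
      using inv' by (auto simp: jet_class_def mult.commute simp flip: power_mult)
  next
    fix y assume y: "y \<in> jet_class h Y ((w ^ h) ^ k * a)"
    define x where "x = fps_rot (w ^ (k * N - k)) y"
    have "w ^ k * w ^ (k * N - k) = 1"
      using N by (simp flip: power_add) (metis N(1) mult.commute power_mult power_one)
    then have *: "w ^ (k * N - k) = inverse (w ^ k)" using w by (simp add: field_simps)
    have "y = fps_rot (w ^ k) x" unfolding x_def using w by (simp add: fps_rot_rot *)
    moreover have "x \<in> jet_class h Y a"
    proof -
      have "fps_nth x h = inverse (w ^ k) ^ h * ((w ^ h) ^ k * a)"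
        using y by (simp add: x_def * jet_class_def)
      also have "\<dots> = a" using w by (simp add: field_simps flip: power_mult)
      finally show ?thesis using inv' y by (simp add: x_def jet_class_def)
    qed
    ultimately show "y \<in> fps_rot (w ^ k) ` jet_class h Y a" by blast
  qed
qed

text \<open>A matching of one child that commutes with its stabiliser \<open>w ^ q\<close> is
  transported to the other children of the orbit by rotating both sides. Equivariance under
  \<open>w ^ q\<close> enters when the index passes from \<open>q - 1\<close> back to 0.\<close>

lemma contact_equiv_orbit:
  assumes e: "contact_equiv (w ^ q) (jet_class h Y a) (jet_class h Y' a')"
    and l: "agree_below h Y" "agree_below h Y'"
    and inv: "fps_rot w ` Y \<subseteq> Y" "fps_rot w ` Y' \<subseteq> Y'" and N: "w ^ N = 1" "N > 0"
    and q: "q > 0" "(w ^ h) ^ q = 1"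
    and dist: "\<And>j k. j < q \<Longrightarrow> k < q \<Longrightarrow> j \<noteq> k \<Longrightarrow> (w ^ h) ^ j * a \<noteq> (w ^ h) ^ k * a"
    and dist': "\<And>j k. j < q \<Longrightarrow> k < q \<Longrightarrow> j \<noteq> k \<Longrightarrow> (w ^ h) ^ j * a' \<noteq> (w ^ h) ^ k * a'"
  shows "contact_equiv w (\<Union>k<q. jet_class h Y ((w ^ h) ^ k * a)) (\<Union>k<q. jet_class h Y' ((w ^ h) ^ k * a'))"
proof -
  obtain R where R: "contact_iso (w ^ q) (jet_class h Y a) (jet_class h Y' a') R"
    using e by (auto simp: contact_equiv_def)
  have w: "w \<noteq> 0" using N by (auto simp: power_0_left)
  define f where "f k = map_prod (fps_rot (w ^ k)) (fps_rot (w ^ k))" for k :: nat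
  define S where "S = (\<Union>k<q. f k ` R)"
  have DR: "fst ` R = jet_class h Y a" "snd ` R = jet_class h Y' a'"
    using contact_iso_Domain[OF R] contact_iso_Range[OF R] by (simp_all add: Domain_fst Range_snd)
  have cls: "fps_rot (w ^ k) x \<in> jet_class h Y ((w ^ h) ^ k * a)"
    "fps_rot (w ^ k) x' \<in> jet_class h Y' ((w ^ h) ^ k * a')" if "(x, x') \<in> R" for x x' k
  proof -
    have "x \<in> jet_class h Y a" "x' \<in> jet_class h Y' a'"
      using that DR by (metis fst_conv image_eqI, metis snd_conv image_eqI)
    then show "fps_rot (w ^ k) x \<in> jet_class h Y ((w ^ h) ^ k * a)"
      "fps_rot (w ^ k) x' \<in> jet_class h Y' ((w ^ h) ^ k * a')"
      using fps_rot_jet_class[OF inv(1) N, of k h a] fps_rot_jet_class[OF inv(2) N, of k h a'] by blast+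
  qed
  have "contact_iso w (\<Union>k<q. jet_class h Y ((w ^ h) ^ k * a)) (\<Union>k<q. jet_class h Y' ((w ^ h) ^ k * a')) S"
  proof (rule contact_isoI)
    have "fst ` f k ` R = fps_rot (w ^ k) ` fst ` R" "snd ` f k ` R = fps_rot (w ^ k) ` snd ` R" for k
      by (auto simp: f_def image_image)
    then show "Domain S = (\<Union>k<q. jet_class h Y ((w ^ h) ^ k * a))"
      and "Range S = (\<Union>k<q. jet_class h Y' ((w ^ h) ^ k * a'))"
      unfolding S_def Domain_fst Range_snd image_UN
      by (simp_all add: DR fps_rot_jet_class[OF inv(1) N] fps_rot_jet_class[OF inv(2) N])
  next
    fix x x' y y' assume "(x, x') \<in> S" "(y, y') \<in> S"
    then obtain j k u u' v v' where jk: "j < q" "k < q" and uv: "(u, u') \<in> R" "(v, v') \<in> R"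
      and x: "x = fps_rot (w ^ j) u" "x' = fps_rot (w ^ j) u'"
      and y: "y = fps_rot (w ^ k) v" "y' = fps_rot (w ^ k) v'"
      by (auto simp: S_def f_def)
    have "(x = y \<longleftrightarrow> x' = y') \<and> subdegree (x - y) = subdegree (x' - y')"
    proof (cases "j = k")
      case True
      then show ?thesis
        using contact_iso_eq[OF R uv] contact_iso_subdegree[OF R uv] w
        by (simp add: x y fps_rot_eq_iff subdegree_fps_rot flip: fps_rot_diff)
    next
      case False
      have "x \<noteq> y \<and> subdegree (x - y) = h"
        using cls(1)[OF uv(1), of j] cls(1)[OF uv(2), of k] dist[OF jk False]
        by (intro agree_below_subdegree[OF l(1)]) (auto simp: x y jet_class_def)
      moreover have "x' \<noteq> y' \<and> subdegree (x' - y') = h"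
        using cls(2)[OF uv(1), of j] cls(2)[OF uv(2), of k] dist'[OF jk False]
        by (intro agree_below_subdegree[OF l(2)]) (auto simp: x y jet_class_def)
      ultimately show ?thesis by simp
    qed
    then show "(x = y) = (x' = y')" "subdegree (x - y) = subdegree (x' - y')" by auto
  next
    fix x x' assume "(x, x') \<in> S"
    then obtain k u u' where k: "k < q" and u: "(u, u') \<in> R"
      and x: "x = fps_rot (w ^ k) u" "x' = fps_rot (w ^ k) u'"
      by (auto simp: S_def f_def)
    have x2: "(fps_rot w x, fps_rot w x') = (fps_rot (w ^ Suc k) u, fps_rot (w ^ Suc k) u')"
      by (simp add: x fps_rot_rot)
    show "(fps_rot w x, fps_rot w x') \<in> S"
    proof (cases "Suc k < q")
      case True
      then show ?thesis unfolding x2 S_def f_def using u by force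
    next
      case False
      then have "Suc k = q" using k by simp
      then have "(fps_rot w x, fps_rot w x') \<in> R" unfolding x2 using contact_iso_rot[OF R u] by simp
      then show ?thesis unfolding S_def f_def using q by force
    qed
  qed
  then show ?thesis by (auto simp: contact_equiv_def)
qed

text \<open>Apart from the class of 0, every child has an orbit of the same exact length
  \<open>q\<close>, the order of \<open>w ^ h\<close>. So one orbit on each side can be matched and
  then cancelled child by child. A child and the remainder are both smaller sets; for the child
  \<open>w ^ q\<close> replaces \<open>w\<close>, which is why \<open>w\<close> varies in the
  induction.\<close>

theorem contact_equiv_equivariant:
  assumes "finite Y" "contact_equiv 1 Y Y'" "fps_rot w ` Y \<subseteq> Y" "fps_rot w ` Y' \<subseteq> Y'"
    and "w ^ N = 1" "N > 0"
  shows "contact_equiv w Y Y'"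
  using assms
proof (induction "card Y" arbitrary: Y Y' w rule: less_induct)
  case less
  note inv = less.prems(3,4) and N = less.prems(5,6)
  obtain R where R: "contact_iso 1 Y Y' R" using less.prems by (auto simp: contact_equiv_def)
  note DR = contact_iso_Domain[OF R] contact_iso_Range[OF R]
  have w: "w \<noteq> 0" using N by (auto simp: power_0_left)
  show ?case
  proof (cases "\<exists>x\<in>Y. \<exists>y\<in>Y. x \<noteq> y")
    case False
    then have f: "fps_rot w x = x" if "x \<in> Y" for x using inv that by blast
    moreover have "fps_rot w x' = x'" if "(x, x') \<in> R" for x x'
    proof -
      have "fps_rot w x' \<in> Y'" using that DR inv by blast
      then obtain y where y: "(y, fps_rot w x') \<in> R" using DR by blast
      then have "y = x" using False that DR by blast
      then show ?thesis using contact_iso_eq[OF R y that] by simp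
    qed
    ultimately have "(fps_rot w x, fps_rot w x') = (x, x')" if "(x, x') \<in> R" for x x'
      using that DR by blast
    then have "contact_iso w Y Y' R"
      using contact_iso_eq[OF R] contact_iso_subdegree[OF R] DR by (intro contact_isoI) simp_all
    then show ?thesis by (auto simp: contact_equiv_def)
  next
    case True
    define D where "D = {subdegree (x - y) | x y. x \<in> Y \<and> y \<in> Y \<and> x \<noteq> y}"
    \<comment> \<open>The least contact is the level of the first branching: all series agree below
      \<open>h\<close>, and some two differ at \<open>h\<close>.\<close>
    define h where "h = (LEAST d. d \<in> D)"
    have "\<exists>d. d \<in> D" using True by (auto simp: D_def)
    then have hD: "h \<in> D" unfolding h_def by (rule LeastI_ex)
    have hmin: "h \<le> d" if "d \<in> D" for d unfolding h_def using that by (rule Least_le)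
    have lev: "agree_below h Y"
      unfolding agree_below_def
    proof (intro ballI allI impI)
      fix x y k assume xy: "x \<in> Y" "y \<in> Y" "k < h"
      show "fps_nth x k = fps_nth y k"
      proof (cases "x = y")
        case False
        then have "h \<le> subdegree (x - y)" using xy by (intro hmin) (auto simp: D_def)
        then show ?thesis using xy nth_less_subdegree_zero[of k "x - y"] by auto
      qed simp
    qed
    have lev': "agree_below h Y'"
      unfolding agree_below_def
    proof (intro ballI allI impI)
      fix x' y' k assume xy: "x' \<in> Y'" "y' \<in> Y'" "k < h"
      obtain x y where R': "(x, x') \<in> R" "(y, y') \<in> R" using xy DR by blast
      show "fps_nth x' k = fps_nth y' k"
      proof (cases "x = y")
        case True
        then show ?thesis using contact_iso_eq[OF R R'] by simp
      next
        case False
        then have "h \<le> subdegree (x - y)" using R' DR by (intro hmin) (auto simp: D_def)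
        then show ?thesis using xy nth_less_subdegree_zero[of k "x' - y'"] contact_iso_subdegree[OF R R'] by auto
      qed
    qed
    obtain x0 y0 where xy0: "x0 \<in> Y" "y0 \<in> Y" "fps_nth x0 h \<noteq> fps_nth y0 h"
    proof -
      obtain x y where "x \<in> Y" "y \<in> Y" "x \<noteq> y" "subdegree (x - y) = h"
        using hD by (auto simp: D_def)
      moreover then have "fps_nth x h \<noteq> fps_nth y h"
        by (metis fps_sub_nth nth_subdegree_nonzero right_minus_eq)
      ultimately show ?thesis using that by blast
    qed
    have small: "card (jet_class h Y a) < card Y" for a
    proof (rule psubset_card_mono)
      have "\<not> (x0 \<in> jet_class h Y a \<and> y0 \<in> jet_class h Y a)" using xy0 by (auto simp: jet_class_def)
      then show "jet_class h Y a \<subset> Y" using xy0(1,2) by (auto simp: jet_class_def)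
    qed (use less.prems in simp)
    define q where "q = (LEAST q. q > 0 \<and> (w ^ h) ^ q = 1)"
    have "N > 0 \<and> (w ^ h) ^ N = 1" using N by (simp add: mult.commute[of h] power_mult flip: power_mult)
         (metis N(1) mult.commute power_mult power_one)
    then have q: "q > 0 \<and> (w ^ h) ^ q = 1" unfolding q_def by (rule LeastI)
    have qmin: "\<not> (j > 0 \<and> (w ^ h) ^ j = 1)" if "j < q" for j
      using that not_less_Least unfolding q_def by blast
    have dist: "(w ^ h) ^ j * a \<noteq> (w ^ h) ^ k * a" if "j < q" "k < q" "j \<noteq> k" "a \<noteq> 0 \<or> q = 1" for j k and a :: complex
    proof
      assume eq: "(w ^ h) ^ j * a = (w ^ h) ^ k * a"
      have a: "a \<noteq> 0" using that by auto
      define i l where "i = min j k" and "l = max j k - min j k"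
      have "(w ^ h) ^ (i + l) = (w ^ h) ^ i" using eq a by (auto simp: i_def l_def min_def max_def)
      then have "(w ^ h) ^ l = 1" using w by (simp add: power_add)
      moreover have "l < q" "l > 0" using that by (auto simp: l_def)
      ultimately show False using qmin by blast
    qed
    obtain x where x: "x \<in> Y" "fps_nth x h \<noteq> 0" using xy0 by metis
    define a where "a = fps_nth x h"
    obtain x' where xx: "(x, x') \<in> R" using x DR by blast
    have "\<exists>a'. (a' \<noteq> 0 \<or> q = 1) \<and> contact_equiv 1 (jet_class h Y a) (jet_class h Y' a')"
    proof (cases "fps_nth x' h \<noteq> 0 \<or> q = 1")
      case True
      have "contact_equiv 1 (jet_class h Y a) (jet_class h Y' (fps_nth x' h))"
        using contact_equiv_restrict[OF R, of "jet_class h Y a"] contact_iso_jet_class[OF R lev lev' xx]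
        by (auto simp: a_def jet_class_def)
      then show ?thesis using True by blast
    next
      case False
      \<comment> \<open>Here the partner of \<open>x\<close> lies in the class of 0, which rotation
        fixes, so its orbit is too short. The rotated element lies in a different child isomorphic
        to that of \<open>x\<close>, and therefore its partner has a nonzero coefficient.\<close>
      define y where "y = fps_rot w x"
      have y: "y \<in> Y" "fps_nth y h = w ^ h * a" using x inv by (auto simp: y_def a_def)
      have "w ^ h \<noteq> 1" using False qmin[of 1] q by (cases "q > 1") auto
      then have "fps_nth y h \<noteq> fps_nth x h" using y x by (simp add: a_def)
      moreover obtain y' where yy: "(y, y') \<in> R" using y DR by blast
      ultimately have "fps_nth y' h \<noteq> fps_nth x' h" using contact_iso_same_jet[OF R lev lev' xx yy] by simp
      then have ne: "fps_nth y' h \<noteq> 0" using False by simp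
      have "contact_equiv 1 (jet_class h Y a) (jet_class h Y (w ^ h * a))"
        using contact_equiv_rot_image[OF w, of "jet_class h Y a"] fps_rot_jet_class[OF inv(1) N, of 1 h a] by simp
      moreover have "contact_equiv 1 (jet_class h Y (w ^ h * a)) (jet_class h Y' (fps_nth y' h))"
        using contact_equiv_restrict[OF R, of "jet_class h Y (w ^ h * a)"] contact_iso_jet_class[OF R lev lev' yy] y
        by (auto simp: jet_class_def)
      ultimately show ?thesis using contact_equiv_trans ne by blast
    qed
    then obtain a' where a': "a' \<noteq> 0 \<or> q = 1" "contact_equiv 1 (jet_class h Y a) (jet_class h Y' a')" by blast
    have a: "a \<noteq> 0 \<or> q = 1" using x by (simp add: a_def)
    have "contact_equiv (w ^ q) (jet_class h Y a) (jet_class h Y' a')"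
    proof (rule less.hyps[OF small])
      show "finite (jet_class h Y a)" using less.prems by (simp add: jet_class_def)
      show "fps_rot (w ^ q) ` jet_class h Y a \<subseteq> jet_class h Y a" 
        "fps_rot (w ^ q) ` jet_class h Y' a' \<subseteq> jet_class h Y' a'"
        using fps_rot_jet_class[OF inv(1) N, of q h] fps_rot_jet_class[OF inv(2) N, of q h] q by simp_all
      show "(w ^ q) ^ N = 1" using N by (metis mult.commute power_mult power_one)
    qed (use a' N in auto)
    define O1 O2 where "O1 j = (\<Union>k<j. jet_class h Y ((w ^ h) ^ k * a))"
      and "O2 j = (\<Union>k<j. jet_class h Y' ((w ^ h) ^ k * a'))" for j
    have orb: "contact_equiv w (O1 q) (O2 q)"
      unfolding O1_def O2_def
      by (rule contact_equiv_orbit) (use \<open>contact_equiv (w ^ q) _ _\<close> lev lev' inv N q dist a a' in auto)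
    \<comment> \<open>The orbit is removed one child at a time. Each rotated child is isomorphic to
      the class of \<open>a\<close> or \<open>a'\<close>, so cancellation applies to what is
      left.\<close>
    have "contact_equiv 1 (Y - O1 j) (Y' - O2 j)" if "j \<le> q" for j
      using that
    proof (induction j)
      case 0
      then show ?case using less.prems by (simp add: O1_def O2_def)
    next
      case (Suc j)
      define V V' where "V = Y - O1 j" and "V' = Y' - O2 j"
      have c: "jet_class h V ((w ^ h) ^ j * a) = jet_class h Y ((w ^ h) ^ j * a)"
        using dist[of _ j a] Suc.prems a by (auto simp: V_def O1_def jet_class_def)
      have c': "jet_class h V' ((w ^ h) ^ j * a') = jet_class h Y' ((w ^ h) ^ j * a')"
        using dist[of _ j a'] Suc.prems a' by (auto simp: V'_def O2_def jet_class_def)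
      have "contact_equiv 1 (jet_class h Y ((w ^ h) ^ j * a)) (jet_class h Y a)"
        using contact_equiv_sym contact_equiv_rot_image[of "w ^ j" "jet_class h Y a"] w
          fps_rot_jet_class[OF inv(1) N, of j h a] by simp
      also note a'(2)
      also have "contact_equiv 1 (jet_class h Y' a') (jet_class h Y' ((w ^ h) ^ j * a'))"
        using contact_equiv_rot_image[of "w ^ j" "jet_class h Y' a'"] w
          fps_rot_jet_class[OF inv(2) N, of j h a'] by simp
      finally have "contact_equiv 1 (jet_class h V ((w ^ h) ^ j * a)) (jet_class h V' ((w ^ h) ^ j * a'))"
        by (simp add: c c')
      then have "contact_equiv 1 (V - jet_class h V ((w ^ h) ^ j * a)) (V' - jet_class h V' ((w ^ h) ^ j * a'))"
        using Suc lev lev' agree_below_subset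
        by (intro contact_equiv_cancel_class) (auto simp: V_def V'_def intro: agree_below_subset)
      moreover have "V - jet_class h V ((w ^ h) ^ j * a) = Y - O1 (Suc j)"
        unfolding c by (auto simp: V_def O1_def less_Suc_eq)
      moreover have "V' - jet_class h V' ((w ^ h) ^ j * a') = Y' - O2 (Suc j)"
        unfolding c' by (auto simp: V'_def O2_def less_Suc_eq)
      ultimately show ?case by simp
    qed
    then have rest1: "contact_equiv 1 (Y - O1 q) (Y' - O2 q)" by simp
    \<comment> \<open>Stability of the complement of an orbit: the class with index 0 is reached
      from index \<open>q - 1\<close>, because \<open>(w ^ h) ^ q = 1\<close>.\<close>
    have inv_rest: "fps_rot w ` (X - (\<Union>k<q. jet_class h X ((w ^ h) ^ k * b))) \<subseteq> X - (\<Union>k<q. jet_class h X ((w ^ h) ^ k * b))"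
      if "fps_rot w ` X \<subseteq> X" for X b
    proof
      fix y assume "y \<in> fps_rot w ` (X - (\<Union>k<q. jet_class h X ((w ^ h) ^ k * b)))"
      then obtain u where u: "y = fps_rot w u" "u \<in> X" "\<And>k. k < q \<Longrightarrow> fps_nth u h \<noteq> (w ^ h) ^ k * b"
        by (auto simp: jet_class_def)
      have "fps_nth y h \<noteq> (w ^ h) ^ k * b" if k: "k < q" for k
      proof
        assume e: "fps_nth y h = (w ^ h) ^ k * b"
        show False
        proof (cases k)
          case 0
          then have "w ^ h * fps_nth u h = w ^ h * ((w ^ h) ^ (q - 1) * b)"
            using e u q by (simp flip: power_Suc mult.assoc)
          then show ?thesis using w u(3)[of "q - 1"] q by simp
        next
          case (Suc l)
          then have "w ^ h * fps_nth u h = w ^ h * ((w ^ h) ^ l * b)" using e u by simp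
          then show ?thesis using w u(3)[of l] k Suc by simp
        qed
      qed
      then show "y \<in> X - (\<Union>k<q. jet_class h X ((w ^ h) ^ k * b))"
        using u that by (auto simp: jet_class_def)
    qed
    have "contact_equiv w (Y - O1 q) (Y' - O2 q)"
    proof (rule less.hyps)
      have "x \<in> O1 q" using x q unfolding O1_def by (intro UN_I[of 0]) (auto simp: jet_class_def a_def)
      then show "card (Y - O1 q) < card Y" using x less.prems by (intro psubset_card_mono) auto
    qed (use less.prems rest1 inv_rest in \<open>auto simp: O1_def O2_def\<close>)
    then have "contact_equiv w (O1 q \<union> (Y - O1 q)) (O2 q \<union> (Y' - O2 q))"
    proof (rule contact_equiv_glue[OF orb, where h = h])
      show "x \<noteq> z \<and> subdegree (x - z) = h" if "x \<in> O1 q" "z \<in> Y - O1 q" for x z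
        using that by (intro agree_below_subdegree[OF lev]) (auto simp: O1_def jet_class_def)
      show "x \<noteq> z \<and> subdegree (x - z) = h" if "x \<in> O2 q" "z \<in> Y' - O2 q" for x z
        using that by (intro agree_below_subdegree[OF lev']) (auto simp: O2_def jet_class_def)
    qed
    moreover have "O1 q \<union> (Y - O1 q) = Y" "O2 q \<union> (Y' - O2 q) = Y'"
      by (auto simp: O1_def O2_def jet_class_def)
    ultimately show ?thesis by simp
  qed
qed

section \<open>Splitting of monic polynomials over convergent power series\<close>

lemma complex_monic_linear_factors:
  fixes p :: "complex poly"
  assumes "lead_coeff p = 1"
  obtains a where "p = (\<Prod>i<degree p. [:- a i, 1:])"
proof -
  have "p \<noteq> 0" using assms by auto
  from alg_closed_imp_factorization[OF this]
  obtain A where A': "size A = degree p \<and> p = smult (lead_coeff p) (\<Prod>x\<in>#A. [:-x, 1:])" ..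
  then have A: "size A = degree p" and p: "p = (\<Prod>x\<in>#A. [:-x, 1:])" using assms by simp_all
  obtain xs where xs: "mset xs = A" using ex_mset by blast
  have "p = prod_list (map (\<lambda>x. [:-x, 1:]) xs)"
    using xs by (subst p) (metis mset_map prod_mset_prod_list)
  also have "\<dots> = (\<Prod>i<degree p. [:- (xs ! i), 1:])"
    using A xs by (subst prod.list_conv_set_nth) (auto simp: atLeast0LessThan intro!: prod.cong)
  finally show ?thesis by (rule that)
qed

text \<open>Argument principle with weight \<open>y ^ k\<close>: the logarithmic derivative of
  \<open>p\<close> is the sum of the \<open>1 / (y - a i)\<close>, and Cauchy's formula keeps the
  roots inside the circle, with multiplicity.\<close>

lemma has_contour_integral_power_sum:
  fixes a :: "'i \<Rightarrow> complex"
  assumes I: "finite I" and e: "\<epsilon> > 0" and a: "\<And>i. i \<in> I \<Longrightarrow> a i \<notin> sphere \<alpha> \<epsilon>"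
  defines "p \<equiv> (\<Prod>i\<in>I. [:- a i, 1:])"
  shows "((\<lambda>y. y ^ k * poly (pderiv p) y / poly p y) has_contour_integral
     (2 * of_real pi * \<i> * (\<Sum>i\<in>{i\<in>I. a i \<in> ball \<alpha> \<epsilon>}. a i ^ k))) (circlepath \<alpha> \<epsilon>)"
proof -
  have one: "((\<lambda>y. y ^ k / (y - a i)) has_contour_integral
      (if a i \<in> ball \<alpha> \<epsilon> then 2 * of_real pi * \<i> * a i ^ k else 0)) (circlepath \<alpha> \<epsilon>)" if i: "i \<in> I" for i
  proof (cases "a i \<in> ball \<alpha> \<epsilon>")
    case True
    have "((\<lambda>y. y ^ k / (y - a i)) has_contour_integral 2 * of_real pi * \<i> * a i ^ k) (circlepath \<alpha> \<epsilon>)"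
      by (rule Cauchy_integral_circlepath_simple[of "\<lambda>y. y ^ k"])
         (use True in \<open>auto intro!: holomorphic_intros simp: dist_norm norm_minus_commute\<close>)
    then show ?thesis using True by simp
  next
    case False
    then have d: "dist \<alpha> (a i) > \<epsilon>" using a[OF i] by (auto simp: not_less)
    have "((\<lambda>y. y ^ k / (y - a i)) has_contour_integral 0) (circlepath \<alpha> \<epsilon>)"
    proof (rule Cauchy_theorem_convex_simple[of _ "ball \<alpha> (dist \<alpha> (a i))"])
      show "(\<lambda>y. y ^ k / (y - a i)) holomorphic_on ball \<alpha> (dist \<alpha> (a i))"
        by (auto intro!: holomorphic_intros)
      show "path_image (circlepath \<alpha> \<epsilon>) \<subseteq> ball \<alpha> (dist \<alpha> (a i))"
        using d e by (auto simp: dist_norm)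
    qed (use e in auto)
    then show ?thesis using False by simp
  qed
  have "((\<lambda>y. \<Sum>i\<in>I. y ^ k / (y - a i)) has_contour_integral
      (\<Sum>i\<in>I. if a i \<in> ball \<alpha> \<epsilon> then 2 * of_real pi * \<i> * a i ^ k else 0)) (circlepath \<alpha> \<epsilon>)"
    using I one by (intro has_contour_integral_sum) auto
  also have "(\<Sum>i\<in>I. if a i \<in> ball \<alpha> \<epsilon> then 2 * of_real pi * \<i> * a i ^ k else 0)
      = 2 * of_real pi * \<i> * (\<Sum>i\<in>{i\<in>I. a i \<in> ball \<alpha> \<epsilon>}. a i ^ k)"
    using I by (auto simp: sum.inter_filter sum_distrib_left intro!: sum.cong)
  finally have 1: "((\<lambda>y. \<Sum>i\<in>I. y ^ k / (y - a i)) has_contour_integral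
      2 * of_real pi * \<i> * (\<Sum>i\<in>{i\<in>I. a i \<in> ball \<alpha> \<epsilon>}. a i ^ k)) (circlepath \<alpha> \<epsilon>)" .
  show ?thesis
  proof (rule has_contour_integral_eq[OF 1])
    fix y assume "y \<in> path_image (circlepath \<alpha> \<epsilon>)"
    then have ne: "y - a i \<noteq> 0" if "i \<in> I" for i using a[OF that] e by auto
    have pp: "poly p y = (\<Prod>i\<in>I. y - a i)" by (simp add: p_def poly_prod)
    have "poly (pderiv p) y = (\<Sum>i\<in>I. \<Prod>j\<in>I - {i}. y - a j)"
      unfolding p_def by (simp add: pderiv_prod poly_sum poly_prod pderiv_pCons)
    also have "\<dots> = (\<Sum>i\<in>I. poly p y / (y - a i))"
    proof (rule sum.cong)
      fix i assume i: "i \<in> I"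
      then have "poly p y = (y - a i) * (\<Prod>j\<in>I - {i}. y - a j)" unfolding pp using I by (simp add: prod.remove)
      then show "(\<Prod>j\<in>I - {i}. y - a j) = poly p y / (y - a i)" using ne[OF i] by simp
    qed simp
    finally have D: "poly (pderiv p) y = poly p y * (\<Sum>i\<in>I. 1 / (y - a i))" by (simp add: sum_distrib_left)
    have "poly p y \<noteq> 0" unfolding pp using I ne by simp
    then have "y ^ k * poly (pderiv p) y / poly p y = y ^ k * (\<Sum>i\<in>I. 1 / (y - a i))" unfolding D by simp
    also have "\<dots> = (\<Sum>i\<in>I. y ^ k / (y - a i))" by (simp add: sum_distrib_left)
    finally show "(\<Sum>i\<in>I. y ^ k / (y - a i)) = y ^ k * poly (pderiv p) y / poly p y" ..
  qed
qed

text \<open>Differentiation under the integral sign after parametrising the circle; the quotient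
  stays smooth because the denominator has no zero on the circle for any \<open>x\<close> in the
  disc.\<close>

lemma holomorphic_contour_integral_log_deriv:
  fixes c :: "nat \<Rightarrow> complex \<Rightarrow> complex"
  assumes hol: "\<And>k. c k holomorphic_on ball 0 r"
    and ne: "\<And>x y. x \<in> ball 0 r \<Longrightarrow> y \<in> sphere \<alpha> \<epsilon> \<Longrightarrow> (\<Sum>k\<le>m. c k x * y ^ k) \<noteq> 0" and e: "\<epsilon> > 0"
  shows "(\<lambda>x. contour_integral (circlepath \<alpha> \<epsilon>) (\<lambda>y. y ^ j * (\<Sum>k\<le>m. of_nat k * c k x * y ^ (k - 1)) / (\<Sum>k\<le>m. c k x * y ^ k)))
     holomorphic_on ball 0 r"
proof -
  define \<gamma> where "\<gamma> = circlepath \<alpha> \<epsilon>"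
  define \<gamma>' where "\<gamma>' t = vector_derivative \<gamma> (at t)" for t
  have g': "\<gamma>' t = 2 * of_real pi * \<i> * \<epsilon> * exp (2 * of_real pi * \<i> * t)" for t
    by (simp add: \<gamma>'_def \<gamma>_def vector_derivative_circlepath)
  have g: "\<gamma> t = \<alpha> + \<epsilon> * exp (2 * of_real pi * \<i> * t)" for t by (simp add: \<gamma>_def circlepath)
  have gs: "\<gamma> t \<in> sphere \<alpha> \<epsilon>" for t
    using e by (simp add: g dist_norm norm_mult)
  define N D N' D' where "N x y = (\<Sum>k\<le>m. of_nat k * c k x * y ^ (k - 1))"
    and "D x y = (\<Sum>k\<le>m. c k x * y ^ k)"
    and "N' x y = (\<Sum>k\<le>m. of_nat k * deriv (c k) x * y ^ (k - 1))"
    and "D' x y = (\<Sum>k\<le>m. deriv (c k) x * y ^ k)" for x y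
  have Dne: "D x (\<gamma> t) \<noteq> 0" if "x \<in> ball 0 r" for x t using ne[OF that gs] by (simp add: D_def)
  have der: "(c k has_field_derivative deriv (c k) x) (at x within A)" if "x \<in> ball 0 r" for k x A
    using holomorphic_derivI[OF hol _ that] by (auto intro: has_field_derivative_at_within)
  have ND: "((\<lambda>x. N x y) has_field_derivative N' x y) (at x within A)"
    "((\<lambda>x. D x y) has_field_derivative D' x y) (at x within A)" if "x \<in> ball 0 r" for x y A
    unfolding N_def N'_def D_def D'_def using that
    by (intro DERIV_sum DERIV_cmult_right DERIV_cmult der, assumption)+
  have hol': "deriv (c k) holomorphic_on ball 0 r" for k using hol by (intro holomorphic_deriv) auto
  have cc: "continuous_on (ball 0 r \<times> A) (\<lambda>p. c k (fst p))" "continuous_on (ball 0 r \<times> A) (\<lambda>p. deriv (c k) (fst p))"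
    for k and A :: "real set"
    by (rule continuous_on_compose2[OF holomorphic_on_imp_continuous_on[OF hol[of k]]]
          continuous_on_compose2[OF holomorphic_on_imp_continuous_on[OF hol'[of k]]],
        intro continuous_intros, auto)+
  have gc: "continuous_on (ball (0::complex) r \<times> A) (\<lambda>p. \<gamma> (snd p))" "continuous_on (ball (0::complex) r \<times> A) (\<lambda>p. \<gamma>' (snd p))" for A
    unfolding g g' by (intro continuous_intros)+
  have cont: "continuous_on (ball 0 r \<times> A) (\<lambda>p. N (fst p) (\<gamma> (snd p)))" "continuous_on (ball 0 r \<times> A) (\<lambda>p. D (fst p) (\<gamma> (snd p)))"
    "continuous_on (ball 0 r \<times> A) (\<lambda>p. N' (fst p) (\<gamma> (snd p)))" "continuous_on (ball 0 r \<times> A) (\<lambda>p. D' (fst p) (\<gamma> (snd p)))" for A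
    unfolding N_def D_def N'_def D'_def by (intro continuous_intros cc gc)+
  have "(\<lambda>x. integral (cbox 0 1) (\<lambda>t. \<gamma> t ^ j * N x (\<gamma> t) / D x (\<gamma> t) * \<gamma>' t)) holomorphic_on ball 0 r"
  proof (rule leibniz_rule_holomorphic)
    fix x :: complex and t :: real assume x: "x \<in> ball 0 r"
    show "((\<lambda>x. \<gamma> t ^ j * N x (\<gamma> t) / D x (\<gamma> t) * \<gamma>' t) has_field_derivative
        \<gamma> t ^ j * ((N' x (\<gamma> t) * D x (\<gamma> t) - N x (\<gamma> t) * D' x (\<gamma> t)) / (D x (\<gamma> t) * D x (\<gamma> t))) * \<gamma>' t) (at x within ball 0 r)"
      using Dne[OF x, of t] x
      by (auto intro!: derivative_eq_intros ND simp: field_simps)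
  next
    fix x :: complex assume x: "x \<in> ball 0 r"
    have "continuous_on (cbox 0 1) (\<lambda>t. (\<lambda>p. N (fst p) (\<gamma> (snd p))) (x, t))"
      by (rule continuous_on_compose2[OF cont(1)[of "cbox 0 1"]]) (use x in \<open>auto intro!: continuous_intros\<close>)
    moreover have "continuous_on (cbox 0 1) (\<lambda>t. (\<lambda>p. D (fst p) (\<gamma> (snd p))) (x, t))"
      by (rule continuous_on_compose2[OF cont(2)[of "cbox 0 1"]]) (use x in \<open>auto intro!: continuous_intros\<close>)
    moreover have "continuous_on (cbox 0 1) \<gamma>" "continuous_on (cbox 0 1) \<gamma>'"
      unfolding g g' by (intro continuous_intros)+
    ultimately show "(\<lambda>t. \<gamma> t ^ j * N x (\<gamma> t) / D x (\<gamma> t) * \<gamma>' t) integrable_on cbox 0 1"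
      using Dne[OF x] by (intro integrable_continuous continuous_intros) auto
  next
    show "continuous_on (ball 0 r \<times> cbox 0 1) (\<lambda>(x, t). \<gamma> t ^ j *
       ((N' x (\<gamma> t) * D x (\<gamma> t) - N x (\<gamma> t) * D' x (\<gamma> t)) / (D x (\<gamma> t) * D x (\<gamma> t))) * \<gamma>' t)"
      unfolding case_prod_beta using Dne by (intro continuous_intros cont gc) auto
  qed auto
  moreover have "contour_integral (circlepath \<alpha> \<epsilon>) (\<lambda>y. y ^ j * (\<Sum>k\<le>m. of_nat k * c k x * y ^ (k - 1)) / (\<Sum>k\<le>m. c k x * y ^ k))
     = integral (cbox 0 1) (\<lambda>t. \<gamma> t ^ j * N x (\<gamma> t) / D x (\<gamma> t) * \<gamma>' t)" for x
    by (simp add: contour_integral_integral N_def D_def \<gamma>_def \<gamma>'_def)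
  ultimately show ?thesis by simp
qed

definition conv_coeffs :: "complex fps poly \<Rightarrow> bool" where
  "conv_coeffs G \<longleftrightarrow> (\<forall>k. fps_conv_radius (coeff G k) > 0)"

lemma holomorphic_monic_family_fps:
  fixes p :: "complex \<Rightarrow> complex poly"
  assumes r: "r > 0" and deg: "\<And>x. x \<in> ball 0 r \<Longrightarrow> degree (p x) = d \<and> lead_coeff (p x) = 1"
    and hol: "\<And>k. k \<le> d \<Longrightarrow> (\<lambda>x. coeff (p x) k) holomorphic_on ball 0 r"
  obtains P where "degree P = d" "lead_coeff P = 1" "\<And>k. (\<lambda>x. coeff (p x) k) has_fps_expansion coeff P k"
proof -
  define P where "P = (\<Sum>k\<le>d. monom (fps_expansion (\<lambda>x. coeff (p x) k) 0) k)"
  have nb: "eventually (\<lambda>x. x \<in> ball 0 r) (nhds (0::complex))" using r by (intro eventually_nhds_in_open) auto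
  have cP: "coeff P k = (if k \<le> d then fps_expansion (\<lambda>x. coeff (p x) k) 0 else 0)" for k
    by (simp add: P_def coeff_sum coeff_monom)
  have ex: "(\<lambda>x. coeff (p x) k) has_fps_expansion coeff P k" for k
  proof (cases "k \<le> d")
    case True
    then show ?thesis unfolding cP using hol[OF True] r
      by (auto intro!: has_fps_expansion_fps_expansion[of "ball 0 r"])
  next
    case False
    have "eventually (\<lambda>x. 0 = coeff (p x) k) (nhds 0)"
      using nb
    proof eventually_elim
      case (elim x)
      then have "degree (p x) = d" using deg by blast
      then show ?case using False by (simp add: coeff_eq_0)
    qed
    then show ?thesis using False cP by (simp add: has_fps_expansion_def)
  qed
  have "eventually (\<lambda>x. 1 = coeff (p x) d) (nhds 0)"
    using nb by eventually_elim (use deg in auto)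
  then have "(\<lambda>x. coeff (p x) d) has_fps_expansion 1" by (simp add: has_fps_expansion_def)
  then have 1: "coeff P d = 1" using ex[of d] fps_expansion_unique_complex by blast
  have "degree P \<le> d" by (rule degree_le) (simp add: cP)
  moreover have "d \<le> degree P" using 1 by (intro le_degree) simp
  ultimately have "degree P = d" by simp
  then show ?thesis using that 1 ex by simp
qed

text \<open>A form of Hensel's lemma that keeps convergence. The roots near \<alpha> and the other
  roots form two groups with holomorphic power sums, so each group belongs to a monic polynomial
  with convergent coefficients. The roots \<alpha> and \<beta> at \<open>x = 0\<close> make both
  groups nonempty.\<close>

theorem monic_fps_poly_split:
  fixes G :: "complex fps poly"
  assumes lc: "lead_coeff G = 1" and conv: "conv_coeffs G"
    and roots: "\<alpha> \<noteq> \<beta>" "poly (map_poly (\<lambda>a. fps_nth a 0) G) \<alpha> = 0" "poly (map_poly (\<lambda>a. fps_nth a 0) G) \<beta> = 0"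
  obtains P Q where "G = P * Q" "lead_coeff P = 1" "lead_coeff Q = 1" "degree P < degree G" "degree Q < degree G"
    "conv_coeffs P" "conv_coeffs Q"
proof -
  define m where "m = degree G"
  define c where "c k = eval_fps (coeff G k)" for k
  define g where "g x = map_poly (\<lambda>a. eval_fps a x) G" for x
  obtain r1 where r1: "r1 > 0" "\<And>a. a \<in> coeff G ` {..m} \<Longrightarrow> ereal r1 < fps_conv_radius a"
    using finite_common_conv_radius[of "coeff G ` {..m}"] conv by (auto simp: conv_coeffs_def)
  have hol1: "c k holomorphic_on ball 0 r1" for k
  proof (cases "k \<le> m")
    case True
    then have "ball 0 r1 \<subseteq> eball 0 (fps_conv_radius (coeff G k))"
      using r1(2)[of "coeff G k"] by (intro ball_eball_mono) auto
    then show ?thesis unfolding c_def by (intro holomorphic_on_eval_fps)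
  next
    case False
    then have "c k = (\<lambda>x. 0)" by (simp add: c_def m_def coeff_eq_0 fun_eq_iff)
    then show ?thesis by simp
  qed
  have cg: "coeff (g x) k = c k x" for x k by (simp add: g_def c_def coeff_map_poly)
  have dg: "degree (g x) = m" "lead_coeff (g x) = 1" for x
  proof -
    have 1: "coeff (g x) m = 1" using lc by (simp add: cg c_def m_def)
    have "degree (g x) \<le> m" by (rule degree_le) (simp add: cg c_def m_def coeff_eq_0)
    moreover have "m \<le> degree (g x)" using 1 by (intro le_degree) simp
    ultimately show "degree (g x) = m" by simp
    then show "lead_coeff (g x) = 1" using 1 by simp
  qed
  have pg: "poly (g x) y = (\<Sum>k\<le>m. c k x * y ^ k)" for x y by (simp add: poly_altdef dg cg)
  have pdg: "poly (pderiv (g x)) y = (\<Sum>k\<le>m. of_nat k * c k x * y ^ (k - 1))" for x y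
  proof (rule DERIV_unique)
    show "(poly (g x) has_field_derivative poly (pderiv (g x)) y) (at y)" by (rule poly_DERIV)
    have "((\<lambda>y. \<Sum>k\<le>m. c k x * y ^ k) has_field_derivative (\<Sum>k\<le>m. of_nat k * c k x * y ^ (k - 1))) (at y)"
      by (auto intro!: derivative_eq_intros DERIV_sum sum.cong simp: mult_ac)
    then show "(poly (g x) has_field_derivative (\<Sum>k\<le>m. of_nat k * c k x * y ^ (k - 1))) (at y)"
      by (simp add: pg[abs_def])
  qed
  have g0: "map_poly (\<lambda>a. fps_nth a 0) G = g 0" by (simp add: g_def eval_fps_at_0)
  have g0ne: "g 0 \<noteq> 0" using dg(2)[of 0] by auto
  obtain \<delta> where \<delta>: "\<delta> > 0" "\<forall>x\<in>{x. poly (g 0) x = 0}. x \<noteq> \<alpha> \<longrightarrow> \<delta> \<le> dist \<alpha> x"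
    using finite_set_avoid[OF poly_roots_finite[OF g0ne], of \<alpha>] by blast
  define \<epsilon> where "\<epsilon> = \<delta> / 2"
  have e: "\<epsilon> > 0" "\<epsilon> < \<delta>" using \<delta> by (auto simp: \<epsilon>_def)
  have sph: "poly (g 0) y \<noteq> 0" if "y \<in> sphere \<alpha> \<epsilon>" for y using \<delta>(2) e that by fastforce
  \<comment> \<open>Compactness of the circle yields one radius in \<open>x\<close> for which no
    root meets the circle: the projection of the zero set \<open>K\<close> is closed and misses
    0.\<close>
  define K where "K = {p \<in> cball 0 (r1 / 2) \<times> sphere \<alpha> \<epsilon>. (\<Sum>k\<le>m. c k (fst p) * snd p ^ k) = 0}"
  have "continuous_on (cball 0 (r1 / 2) \<times> sphere \<alpha> \<epsilon>) (\<lambda>p. c k (fst p))" for k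
    by (rule continuous_on_compose2[OF holomorphic_on_imp_continuous_on[OF hol1[of k]]])
       (use r1 in \<open>auto intro!: continuous_intros\<close>)
  then have "continuous_on (cball 0 (r1 / 2) \<times> sphere \<alpha> \<epsilon>) (\<lambda>p. \<Sum>k\<le>m. c k (fst p) * snd p ^ k)"
    by (intro continuous_intros)
  then have "closed K" unfolding K_def
    by (rule continuous_closed_preimage_constant) (auto intro: closed_Times)
  moreover have "compact (cball (0::complex) (r1 / 2) \<times> sphere \<alpha> \<epsilon>)" by (intro compact_Times) auto
  moreover have "K = (cball 0 (r1 / 2) \<times> sphere \<alpha> \<epsilon>) \<inter> K" by (auto simp: K_def)
  ultimately have "compact K" using compact_Int_closed by metis
  then have "open (- (fst ` K))"
    by (intro open_Compl compact_imp_closed compact_continuous_image) (auto intro!: continuous_intros)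
  moreover have "0 \<in> - (fst ` K)" using sph pg by (auto simp: K_def)
  ultimately obtain r2 where r2: "r2 > 0" "ball 0 r2 \<subseteq> - (fst ` K)"
    using open_contains_ball by blast
  define r where "r = min r2 (r1 / 2)"
  have r: "r > 0" using r1 r2 by (simp add: r_def)
  have ne: "(\<Sum>k\<le>m. c k x * y ^ k) \<noteq> 0" if "x \<in> ball 0 r" "y \<in> sphere \<alpha> \<epsilon>" for x y
  proof
    assume "(\<Sum>k\<le>m. c k x * y ^ k) = 0"
    then have "(x, y) \<in> K" using that by (auto simp: K_def r_def)
    then have "x \<in> fst ` K" by force
    moreover have "x \<in> ball 0 r2" using that by (simp add: r_def)
    ultimately show False using r2 by blast
  qed
  have hol: "c k holomorphic_on ball 0 r" for k
    using hol1[of k] by (rule holomorphic_on_subset) (use r1 in \<open>auto simp: r_def\<close>)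
  have "\<exists>a. g x = (\<Prod>i<m. [:- a i, 1:])" for x
    using complex_monic_linear_factors[OF dg(2)[of x]] dg(1)[of x] by metis
  \<comment> \<open>The numbering of the roots is an arbitrary choice at each \<open>x\<close>; no
    continuity of \<open>a\<close> is claimed.\<close>
  then obtain a where a: "\<And>x. g x = (\<Prod>i<m. [:- a x i, 1:])" by metis
  have root: "poly (g x) y = 0 \<longleftrightarrow> (\<exists>i<m. a x i = y)" for x y
    unfolding a by (auto simp: poly_prod)
  define I where "I x = {i\<in>{..<m}. a x i \<in> ball \<alpha> \<epsilon>}" for x
  define J where "J x = {..<m} - I x" for x
  have fin: "finite (I x)" "finite (J x)" for x by (simp_all add: I_def J_def)
  have s1: "(\<lambda>x. \<Sum>i\<in>I x. a x i ^ k) holomorphic_on ball 0 r" for k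
  proof -
    have "(\<lambda>x. contour_integral (circlepath \<alpha> \<epsilon>) (\<lambda>y. y ^ k * (\<Sum>k\<le>m. of_nat k * c k x * y ^ (k - 1)) / (\<Sum>k\<le>m. c k x * y ^ k)) / (2 * of_real pi * \<i>))
        holomorphic_on ball 0 r"
      by (intro holomorphic_intros holomorphic_contour_integral_log_deriv hol ne e) auto
    then show ?thesis
    proof (rule holomorphic_transform)
      fix x :: complex assume x: "x \<in> ball 0 r"
      have ns: "a x i \<notin> sphere \<alpha> \<epsilon>" if "i \<in> {..<m}" for i
        using ne[OF x] root[of x "a x i"] that by (auto simp: pg)
      have "((\<lambda>y. y ^ k * poly (pderiv (g x)) y / poly (g x) y) has_contour_integral
          (2 * of_real pi * \<i> * (\<Sum>i\<in>I x. a x i ^ k))) (circlepath \<alpha> \<epsilon>)"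
        unfolding a I_def by (rule has_contour_integral_power_sum) (use e ns in auto)
      from contour_integral_unique[OF this]
      show "contour_integral (circlepath \<alpha> \<epsilon>) (\<lambda>y. y ^ k * (\<Sum>k\<le>m. of_nat k * c k x * y ^ (k - 1)) / (\<Sum>k\<le>m. c k x * y ^ k)) / (2 * of_real pi * \<i>)
         = (\<Sum>i\<in>I x. a x i ^ k)" by (simp add: pg pdg)
    qed
  qed
  \<comment> \<open>Total power sums are polynomial in the coefficients; subtracting the sums over
    the disc leaves those over the remaining roots.\<close>
  have s2: "(\<lambda>x. \<Sum>i\<in>J x. a x i ^ k) holomorphic_on ball 0 r" for k
  proof -
    define E where "E x j = (if j \<le> m then c (m - j) x else 0)" for x j
    have E: "fps_nth (recip_fps (a x) {..<m}) = E x" for x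
    proof
      fix j
      show "fps_nth (recip_fps (a x) {..<m}) j = E x j"
        using coeff_prod_linear[of "{..<m}" "a x"] by (auto simp: E_def not_le simp flip: a cg)
    qed
    have "(\<lambda>x. newton_psum (E x) m k) holomorphic_on ball 0 r"
    proof (rule newton_psum_holomorphic)
      show "(\<lambda>x. E x j) holomorphic_on ball 0 r" for j by (cases "j \<le> m") (simp_all add: E_def hol)
    qed
    then have "(\<lambda>x. newton_psum (E x) m k - (\<Sum>i\<in>I x. a x i ^ k)) holomorphic_on ball 0 r"
      using s1 by (intro holomorphic_intros)
    moreover have "newton_psum (E x) m k - (\<Sum>i\<in>I x. a x i ^ k) = (\<Sum>i\<in>J x. a x i ^ k)" for x
    proof -
      have "(\<Sum>i<m. a x i ^ k) = newton_psum (E x) m k"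
        using power_sum_eq_newton_psum[of "{..<m}" "a x" k] by (simp add: E)
      moreover have "(\<Sum>i<m. a x i ^ k) = (\<Sum>i\<in>J x. a x i ^ k) + (\<Sum>i\<in>I x. a x i ^ k)"
        unfolding J_def by (rule sum.subset_diff) (auto simp: I_def)
      ultimately show ?thesis by (simp add: diff_eq_eq)
    qed
    ultimately show ?thesis by simp
  qed
  define p where "p = card (I 0)"
  have card: "card (I x) = p" "card (J x) = m - p" if "x \<in> ball 0 r" for x
  proof -
    have cI: "card (I x) \<le> m" for x using card_mono[of "{..<m}" "I x"] by (auto simp: I_def)
    \<comment> \<open>The power sum with exponent 0 counts the roots in the disc. It is continuous
      with finitely many values on a connected set.\<close>
    have "(\<lambda>x. of_nat (card (I x)) :: complex) constant_on ball 0 r"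
    proof (rule continuous_finite_range_constant)
      show "continuous_on (ball 0 r) (\<lambda>x. of_nat (card (I x)) :: complex)"
        using holomorphic_on_imp_continuous_on[OF s1[of 0]] by simp
      have "(\<lambda>x. of_nat (card (I x)) :: complex) ` ball 0 r \<subseteq> of_nat ` {..m}" using cI by auto
      then show "finite ((\<lambda>x. of_nat (card (I x)) :: complex) ` ball 0 r)" using finite_subset by blast
    qed auto
    then have "(of_nat (card (I x)) :: complex) = of_nat (card (I 0))"
      using that r unfolding constant_on_def by (metis centre_in_ball)
    then show 1: "card (I x) = p" by (simp add: p_def)
    have "card (J x) = m - card (I x)" unfolding J_def by (subst card_Diff_subset) (auto simp: I_def)
    then show "card (J x) = m - p" using 1 by simp
  qed
  have pm: "0 < p" "p < m"
  proof -
    obtain i where i: "i < m" "a 0 i = \<alpha>" using roots(2) root[of 0 \<alpha>] g0 by auto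
    then have "i \<in> I 0" using e by (simp add: I_def)
    then show "0 < p" unfolding p_def using fin by (auto simp: card_gt_0_iff)
    obtain j where j: "j < m" "a 0 j = \<beta>" using roots(3) root[of 0 \<beta>] g0 by auto
    have "\<delta> \<le> dist \<alpha> \<beta>" using \<delta>(2) roots g0 by auto
    then have "j \<notin> I 0" using j e by (auto simp: I_def)
    then have "I 0 \<subset> {..<m}" using j by (auto simp: I_def)
    then show "p < m" unfolding p_def using psubset_card_mono[of "{..<m}" "I 0"] by simp
  qed
  have famI: "\<exists>P. degree P = d \<and> lead_coeff P = 1 \<and> (\<forall>k. (\<lambda>x. coeff (\<Prod>i\<in>A x. [:- a x i, 1:]) k) has_fps_expansion coeff P k)"
    if s: "\<And>k. (\<lambda>x. \<Sum>i\<in>A x. a x i ^ k) holomorphic_on ball 0 r" and fA: "\<And>x. finite (A x)"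
      and cA: "\<And>x. x \<in> ball 0 r \<Longrightarrow> card (A x) = d" for A :: "complex \<Rightarrow> nat set" and d
  proof -
    have "(\<lambda>x. coeff (\<Prod>i\<in>A x. [:- a x i, 1:]) k) holomorphic_on ball 0 r" if "k \<le> d" for k
    proof (rule holomorphic_transform[OF recip_fps_holomorphic[where I = A and a = a and A = "ball 0 r" and j = "d - k"]])
      show "fps_nth (recip_fps (a x) (A x)) (d - k) = coeff (\<Prod>i\<in>A x. [:- a x i, 1:]) k" if "x \<in> ball 0 r" for x
        using coeff_prod_linear_rev[OF fA, of k x "a x"] \<open>k \<le> d\<close> cA[OF that] by simp
    qed (use s fA in auto)
    moreover have "degree (\<Prod>i\<in>A x. [:- a x i, 1:]) = d \<and> lead_coeff (\<Prod>i\<in>A x. [:- a x i, 1:]) = 1"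
      if "x \<in> ball 0 r" for x using degree_prod_linear[OF fA, of "a x" x] cA[OF that] by simp
    ultimately obtain P where "degree P = d" "lead_coeff P = 1"
      "\<And>k. (\<lambda>x. coeff (\<Prod>i\<in>A x. [:- a x i, 1:]) k) has_fps_expansion coeff P k"
      using holomorphic_monic_family_fps[OF r, of "\<lambda>x. \<Prod>i\<in>A x. [:- a x i, 1:]" d] by blast
    then show ?thesis by blast
  qed
  obtain P where P: "degree P = p" "lead_coeff P = 1" "\<And>k. (\<lambda>x. coeff (\<Prod>i\<in>I x. [:- a x i, 1:]) k) has_fps_expansion coeff P k"
    using famI[of I p] s1 fin card by blast
  obtain Q where Q: "degree Q = m - p" "lead_coeff Q = 1" "\<And>k. (\<lambda>x. coeff (\<Prod>i\<in>J x. [:- a x i, 1:]) k) has_fps_expansion coeff Q k"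
    using famI[of J "m - p"] s2 fin card by blast
  have gPQ: "g x = (\<Prod>i\<in>I x. [:- a x i, 1:]) * (\<Prod>i\<in>J x. [:- a x i, 1:])" for x
    unfolding a J_def by (subst prod.subset_diff[of "I x"]) (auto simp: I_def mult.commute)
  have "G = P * Q"
  proof (rule poly_eqI)
    fix n
    have "(\<lambda>x. \<Sum>i\<le>n. coeff (\<Prod>i\<in>I x. [:- a x i, 1:]) i * coeff (\<Prod>i\<in>J x. [:- a x i, 1:]) (n - i)) has_fps_expansion
       (\<Sum>i\<le>n. coeff P i * coeff Q (n - i))"
      using P Q by (intro fps_expansion_intros) auto
    then have "(\<lambda>x. coeff (g x) n) has_fps_expansion coeff (P * Q) n"
      by (simp add: gPQ coeff_mult)
    moreover have "(\<lambda>x. coeff (g x) n) has_fps_expansion coeff G n"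
      unfolding cg c_def using conv by (simp add: has_fps_expansion_def conv_coeffs_def)
    ultimately show "coeff G n = coeff (P * Q) n" using fps_expansion_unique_complex by blast
  qed
  moreover have "conv_coeffs P" "conv_coeffs Q"
    using P(3) Q(3) by (auto simp: conv_coeffs_def has_fps_expansion_def)
  ultimately show ?thesis using that P Q pm by (auto simp: m_def)
qed

section \<open>Puiseux roots\<close>

lemma conv_add: "fps_conv_radius f > 0 \<Longrightarrow> fps_conv_radius g > 0 \<Longrightarrow> fps_conv_radius (f + g :: complex fps) > 0"
  by (rule less_le_trans[OF _ fps_conv_radius_add]) simp

lemma conv_mult: "fps_conv_radius f > 0 \<Longrightarrow> fps_conv_radius g > 0 \<Longrightarrow> fps_conv_radius (f * g :: complex fps) > 0"
  by (rule less_le_trans[OF _ fps_conv_radius_mult]) simp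

lemma conv_power: "fps_conv_radius f > 0 \<Longrightarrow> fps_conv_radius (f ^ n :: complex fps) > 0"
  by (rule less_le_trans[OF _ fps_conv_radius_power])

lemma conv_sum: "(\<And>i. i \<in> A \<Longrightarrow> fps_conv_radius (f i) > 0) \<Longrightarrow> fps_conv_radius (\<Sum>i\<in>A. f i :: complex fps) > 0"
  by (induction A rule: infinite_finite_induct) (auto intro: conv_add)

lemma conv_compose_X_power:
  assumes "fps_conv_radius f > 0" "M > 0"
  shows "fps_conv_radius (f oo fps_X ^ M :: complex fps) > 0"
proof -
  have "(eval_fps f \<circ> (\<lambda>x. x ^ M)) has_fps_expansion (f oo fps_X ^ M)"
    using assms by (intro has_fps_expansion_compose has_fps_expansion_fps_X_power)
      (auto simp: has_fps_expansion_def)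
  then show ?thesis by (simp add: has_fps_expansion_def)
qed

lemma fps_compose_X_power_mult:
  "M > 0 \<Longrightarrow> (f * g) oo fps_X ^ M = (f oo fps_X ^ M) * (g oo fps_X ^ M :: 'a::idom fps)"
  by (rule fps_compose_mult_distrib) (simp add: fps_X_power_nth)

lemma fps_compose_X_power_compose:
  "(f oo fps_X ^ M) oo fps_X ^ N = (f oo fps_X ^ (M * N) :: complex fps)" if "N > 0"
proof (rule fps_ext)
  fix n
  have "M * N dvd n \<longleftrightarrow> N dvd n \<and> M dvd n div N"
    using that by (auto elim!: dvdE simp: mult.commute)
  moreover have "n div (M * N) = n div N div M" by (metis div_mult2_eq mult.commute)
  ultimately show "fps_nth ((f oo fps_X ^ M) oo fps_X ^ N) n = fps_nth (f oo fps_X ^ (M * N)) n"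
    by (simp add: fps_nth_compose_X_power)
qed

lemma subdegree_compose_X_power:
  fixes f :: "complex fps"
  assumes "M > 0" "f \<noteq> 0"
  shows "subdegree (f oo fps_X ^ M) = subdegree f * M"
proof (rule subdegreeI)
  show "fps_nth (f oo fps_X ^ M) (subdegree f * M) \<noteq> 0"
    using assms by (simp add: fps_nth_compose_X_power)
  show "fps_nth (f oo fps_X ^ M) i = 0" if "i < subdegree f * M" for i
    using that assms by (auto simp: fps_nth_compose_X_power div_less_iff_less_mult intro!: nth_less_subdegree_zero)
qed

lemma map_poly_compose_add:
  "map_poly (\<lambda>f. f oo h) (P + Q) = map_poly (\<lambda>f. f oo h) P + map_poly (\<lambda>f. f oo h) (Q :: 'a::idom fps poly)"
  by (rule poly_eqI) (simp add: coeff_map_poly fps_compose_add_distrib)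

lemma map_poly_compose_mult:
  fixes P Q :: "complex fps poly"
  assumes "M > 0"
  shows "map_poly (\<lambda>f. f oo fps_X ^ M) (P * Q) = map_poly (\<lambda>f. f oo fps_X ^ M) P * map_poly (\<lambda>f. f oo fps_X ^ M) Q"
  by (rule poly_eqI)
     (simp add: coeff_map_poly coeff_mult fps_compose_sum_distrib fps_compose_X_power_mult[OF assms])

lemma map_poly_compose_pcompose:
  fixes P Q :: "complex fps poly"
  assumes "M > 0"
  shows "map_poly (\<lambda>f. f oo fps_X ^ M) (pcompose P Q)
    = pcompose (map_poly (\<lambda>f. f oo fps_X ^ M) P) (map_poly (\<lambda>f. f oo fps_X ^ M) Q)"
proof (induction P)
  case (pCons a P)
  then show ?case
    by (simp add: pcompose_pCons map_poly_compose_add map_poly_compose_mult[OF assms] map_poly_pCons)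
qed simp

text \<open>The exponent \<open>M\<close> is the ramification \<open>x = t ^ M\<close>. A list of
  roots, not a set, keeps multiplicities.\<close>

definition splits_at :: "nat \<Rightarrow> complex fps poly \<Rightarrow> bool" where
  "splits_at M G \<longleftrightarrow> (\<exists>ys. (\<forall>y\<in>set ys. fps_conv_radius y > 0) \<and>
     map_poly (\<lambda>f. f oo fps_X ^ M) G = (\<Prod>y\<leftarrow>ys. [:- y, 1:]))"

lemma splits_at_mult:
  assumes "M > 0" "splits_at M P" "splits_at M Q"
  shows "splits_at M (P * Q)"
proof -
  obtain ys zs where "\<forall>y\<in>set ys. fps_conv_radius y > 0" "map_poly (\<lambda>f. f oo fps_X ^ M) P = (\<Prod>y\<leftarrow>ys. [:- y, 1:])"
    "\<forall>y\<in>set zs. fps_conv_radius y > 0" "map_poly (\<lambda>f. f oo fps_X ^ M) Q = (\<Prod>y\<leftarrow>zs. [:- y, 1:])"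
    using assms(2,3) unfolding splits_at_def by blast
  then show ?thesis unfolding splits_at_def map_poly_compose_mult[OF assms(1)]
    by (intro exI[of _ "ys @ zs"]) auto
qed

lemma splits_at_shift:
  assumes M: "M > 0" and s: "splits_at M (pcompose G [:c, 1:])" and c: "fps_conv_radius c > 0"
  shows "splits_at M G"
proof -
  define f where "f = (\<lambda>f :: complex fps. f oo fps_X ^ M)"
  obtain ys where ys: "\<forall>y\<in>set ys. fps_conv_radius y > 0" "map_poly f (pcompose G [:c, 1:]) = (\<Prod>y\<leftarrow>ys. [:- y, 1:])"
    using s unfolding splits_at_def f_def by blast
  have "G = pcompose (pcompose G [:c, 1:]) [:- c, 1:]"
    by (simp add: pcompose_assoc[symmetric] pcompose_pCons pcompose_idR)
  then have "map_poly f G = pcompose (\<Prod>y\<leftarrow>ys. [:- y, 1:]) (map_poly f [:- c, 1:])"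
    using map_poly_compose_pcompose[OF M, of "pcompose G [:c, 1:]" "[:- c, 1:]"] ys by (simp add: f_def)
  also have "map_poly f [:- c, 1:] = [:- f c, 1:]"
    by (simp add: map_poly_pCons f_def fps_compose_uminus)
  also have "pcompose (\<Prod>y\<leftarrow>ys. [:- y, 1:]) [:- f c, 1:] = (\<Prod>y\<leftarrow>map (\<lambda>y. y + f c) ys. [:- y, 1:])"
  proof -
    have lin: "pcompose [:- y, 1:] [:- f c, 1:] = [:- (y + f c), 1:]" for y by (simp add: pcompose_pCons)
    show ?thesis
      by (induction ys) (simp_all add: pcompose_mult lin pcompose_1 o_def del: mult_pCons_left)
  qed
  finally show ?thesis
    unfolding splits_at_def f_def
    using ys(1) conv_compose_X_power[OF c M]
    by (intro exI[of _ "map (\<lambda>y. y + (c oo fps_X ^ M)) ys"]) (auto intro!: conv_add)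
qed

text \<open>Multiplying through by \<open>u ^ k\<close> avoids the exponent
  \<open>length ys - k\<close>, so neither an inverse of \<open>u\<close> nor a bound on
  \<open>k\<close> is required.\<close>

lemma coeff_prod_list_linear_scale:
  fixes ys :: "'a::comm_ring_1 list"
  shows "coeff (\<Prod>y\<leftarrow>ys. [:- (u * y), 1:]) k * u ^ k = u ^ length ys * coeff (\<Prod>y\<leftarrow>ys. [:- y, 1:]) k"
proof (induction ys arbitrary: k)
  case Nil
  then show ?case by (cases k) auto
next
  case (Cons y ys)
  define P Q where "P = (\<Prod>y\<leftarrow>ys. [:- (u * y), 1:])" and "Q = (\<Prod>y\<leftarrow>ys. [:- y, 1:])"
  have IH: "coeff P k * u ^ k = u ^ length ys * coeff Q k" for k using Cons.IH by (simp add: P_def Q_def)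
  have "coeff ([:- (u * y), 1:] * P) k * u ^ k = u ^ Suc (length ys) * coeff ([:- y, 1:] * Q) k"
  proof (cases k)
    case 0
    then show ?thesis using IH[of 0] by (simp add: mult_ac)
  next
    case (Suc j)
    have "coeff ([:- (u * y), 1:] * P) k * u ^ k = - (u * y) * (coeff P k * u ^ k) + u * (coeff P j * u ^ j)"
      by (simp add: Suc algebra_simps)
    also have "\<dots> = u ^ Suc (length ys) * coeff ([:- y, 1:] * Q) k"
      unfolding IH by (simp add: Suc algebra_simps)
    finally show ?thesis .
  qed
  then show ?case by (simp add: P_def Q_def)
qed

lemma degree_prod_list_linear:
  fixes ys :: "'a::idom list"
  shows "degree (\<Prod>y\<leftarrow>ys. [:- y, 1:]) = length ys" "lead_coeff (\<Prod>y\<leftarrow>ys. [:- y, 1:]) = 1"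
proof -
  have "degree (\<Prod>y\<leftarrow>ys. [:- y, 1:]) = length ys \<and> lead_coeff (\<Prod>y\<leftarrow>ys. [:- y, 1:]) = 1"
  proof (induction ys)
    case (Cons y ys)
    then have "(\<Prod>y\<leftarrow>ys. [:- y, 1:]) \<noteq> 0" by auto
    moreover have "degree (\<Prod>y\<leftarrow>ys. [:- y, 1:]) = length ys" "coeff (\<Prod>y\<leftarrow>ys. [:- y, 1:]) (length ys) = 1"
      using Cons by auto
    ultimately show ?case
      using lead_coeff_mult[of "[:- y, 1:]" "\<Prod>y\<leftarrow>ys. [:- y, 1:]"]
      by (simp add: degree_mult_eq del: mult_pCons_left)
  qed simp
  then show "degree (\<Prod>y\<leftarrow>ys. [:- y, 1:]) = length ys" "lead_coeff (\<Prod>y\<leftarrow>ys. [:- y, 1:]) = 1" by auto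
qed

text \<open>If all roots were equal, the vanishing root sum would make them 0, and \<open>p\<close>
  would be the pure power of degree \<open>m\<close>, against the nonzero lower coefficient.\<close>

lemma monic_two_roots:
  fixes p :: "complex poly"
  assumes lc: "lead_coeff p = 1" and m: "degree p = m" "m > 0" and z: "coeff p (m - 1) = 0" and k: "k < m" "coeff p k \<noteq> 0"
  obtains \<alpha> \<beta> where "\<alpha> \<noteq> \<beta>" "poly p \<alpha> = 0" "poly p \<beta> = 0"
proof -
  obtain a where a: "p = (\<Prod>i<m. [:- a i, 1:])" using complex_monic_linear_factors[OF lc] m by metis
  have root: "poly p (a i) = 0" if "i < m" for i unfolding a using that by (auto simp: poly_prod)
  show ?thesis
  proof (cases "\<exists>i<m. a i \<noteq> a 0")
    case True
    then obtain i where i: "i < m" "a i \<noteq> a 0" by blast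
    show ?thesis by (rule that[OF i(2) root[OF i(1)] root[OF m(2)]])
  next
    case False
    have "(\<Prod>i<m. [:- a i, 1:]) = (\<Prod>i<m. [:- a 0, 1:])"
    proof (rule prod.cong)
      fix i assume "i \<in> {..<m}"
      then have "a i = a 0" using False by blast
      then show "[:- a i, 1:] = [:- a 0, 1:]" by (simp only:)
    qed simp
    then have p: "p = [:- a 0, 1:] ^ m" using a by simp
    have "coeff p (m - 1) = of_nat (m choose (m - 1)) * 1 ^ (m - 1) * (- a 0) ^ (m - (m - 1))"
      unfolding p by (rule coeff_linear_poly_power) simp
    then have "a 0 = 0" using z m(2) binomial_symmetric[of 1 m] by auto
    moreover have "coeff p k = of_nat (m choose k) * 1 ^ k * (- a 0) ^ (m - k)"
      unfolding p by (rule coeff_linear_poly_power) (use k in simp)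
    ultimately show ?thesis using k by simp
  qed
qed

lemma pcompose_power: "pcompose (p ^ n) q = pcompose p q ^ n" for p q :: "'a::comm_ring_1 poly"
  by (induction n) (simp_all add: pcompose_mult pcompose_1)

lemma coeff_pcompose_shift:
  fixes G :: "'a::comm_ring_1 poly"
  shows "coeff (pcompose G [:c, 1:]) k = (\<Sum>i\<le>degree G. coeff G i * coeff ([:c, 1:] ^ i) k)"
proof -
  have "pcompose G [:c, 1:] = pcompose (\<Sum>i\<le>degree G. monom (coeff G i) i) [:c, 1:]"
    by (simp add: poly_as_sum_of_monoms)
  also have "\<dots> = (\<Sum>i\<le>degree G. smult (coeff G i) ([:c, 1:] ^ i))"
    by (simp add: pcompose_sum monom_altdef pcompose_smult pcompose_power pcompose_pCons)
  finally show ?thesis by (simp add: coeff_sum)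
qed

lemma coeff_linear_power_gt:
  "k > i \<Longrightarrow> coeff ([:c, 1:] ^ i :: 'a::comm_ring_1 poly) k = 0"
  by (rule coeff_eq_0, rule le_less_trans[OF degree_power_le]) simp

text \<open>Newton's algorithm by induction on the degree: rescaling by the first slope of the
  Newton polygon produces a polynomial that splits. The exponent depends on the degree only, and all
  its multiples work, so two factors of unknown degrees can share one ramification.\<close>

theorem puiseux:
  "\<exists>L>0. \<forall>G. degree G = m \<longrightarrow> lead_coeff G = 1 \<longrightarrow> conv_coeffs G \<longrightarrow> (\<forall>M>0. L dvd M \<longrightarrow> splits_at M G)"
proof (induction m rule: less_induct)
  case (less m)
  then have "\<forall>j<m. \<exists>L>0. \<forall>G. degree G = j \<longrightarrow> lead_coeff G = 1 \<longrightarrow> conv_coeffs G \<longrightarrow> (\<forall>M>0. L dvd M \<longrightarrow> splits_at M G)"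
    by blast
  then obtain Lf where Lf: "\<And>j. j < m \<Longrightarrow> Lf j > (0::nat)"
    "\<And>j G M. j < m \<Longrightarrow> degree G = j \<Longrightarrow> lead_coeff G = 1 \<Longrightarrow> conv_coeffs G \<Longrightarrow> M > 0 \<Longrightarrow> Lf j dvd M \<Longrightarrow> splits_at M G"
    by metis
  \<comment> \<open>\<open>fact m\<close> is divisible by every \<open>m - k\<close> and so clears
    the denominator of any slope; the product serves all possible degrees of the factors.\<close>
  define L where "L = fact m * (\<Prod>j<m. Lf j)"
  have L: "L > 0" using Lf(1) by (auto simp: L_def intro!: prod_pos)
  have "splits_at M G" if deg: "degree G = m" and lc: "lead_coeff G = 1" and conv: "conv_coeffs G"
    and M: "M > 0" "L dvd M" for G M
  proof (cases "m = 0")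
    case True
    then have "G = 1" using deg lc by (metis degree_eq_zeroE lead_coeff_pCons(2) one_pCons pCons_eq_0_iff zero_neq_one)
    then show ?thesis unfolding splits_at_def by (intro exI[of _ "[]"]) (simp add: one_pCons map_poly_pCons)
  next
    case False
    \<comment> \<open>\<open>c\<close> is the mean of the roots; translating by it removes the
      coefficient of index \<open>m - 1\<close>.\<close>
    define c where "c = - (coeff G (m - 1)) * fps_const (1 / of_nat m)"
    have cc: "fps_conv_radius c > 0"
      using conv by (auto simp: c_def conv_coeffs_def intro!: conv_mult)
    define H where "H = pcompose G [:c, 1:]"
    have "lead_coeff H = lead_coeff G * lead_coeff [:c, 1:] ^ degree G"
      unfolding H_def by (rule lead_coeff_comp) simp
    then have H: "degree H = m" "lead_coeff H = 1"
      using deg lc by (simp_all add: H_def degree_pcompose)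
    have convH: "fps_conv_radius (coeff H k) > 0" for k
    proof -
      have "fps_conv_radius (coeff ([:c, 1:] ^ i) k) > 0" for i
      proof (cases "k \<le> i")
        case True
        have "of_nat (i choose k) = (fps_const (of_nat (i choose k)) :: complex fps)"
          by (simp add: fps_of_nat)
        then show ?thesis using cc True
          by (simp only: coeff_linear_poly_power[OF True]) (auto intro!: conv_mult conv_power)
      next
        case False
        then show ?thesis by (simp add: coeff_linear_power_gt)
      qed
      then show ?thesis unfolding H_def coeff_pcompose_shift
        using conv by (intro conv_sum conv_mult) (auto simp: conv_coeffs_def)
    qed
    have H0: "coeff H (m - 1) = 0"
    proof -
      have "coeff H (m - 1) = (\<Sum>i\<in>{m - 1, m}. coeff G i * coeff ([:c, 1:] ^ i) (m - 1))"
        unfolding H_def coeff_pcompose_shift deg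
        by (rule sum.mono_neutral_right) (auto intro!: coeff_linear_power_gt)
      also have "\<dots> = coeff G (m - 1) + of_nat (m choose (m - 1)) * c"
        using False lc deg by (simp add: coeff_linear_poly_power)
      also have "of_nat (m choose (m - 1)) * c = - coeff G (m - 1) * (of_nat m * fps_const (1 / of_nat m))"
        using False binomial_symmetric[of 1 m] by (simp add: c_def mult_ac)
      also have "of_nat m * fps_const (1 / of_nat m) = (1 :: complex fps)"
        using False by (simp flip: fps_of_nat)
      finally show ?thesis by simp
    qed
    have "splits_at M H"
    proof (cases "\<forall>k<m. coeff H k = 0")
      case True
      have "H = monom 1 m"
      proof (rule poly_eqI)
        show "coeff H n = coeff (monom 1 m) n" for n
          by (cases n m rule: linorder_cases) (use True H in \<open>auto simp: coeff_eq_0\<close>)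
      qed
      moreover have "(\<Prod>y\<leftarrow>replicate m (0 :: complex fps). [:- y, 1:]) = monom 1 m"
        by (simp add: prod_list_replicate monom_altdef)
      ultimately show ?thesis unfolding splits_at_def
        by (intro exI[of _ "replicate m 0"]) (auto simp: map_poly_monom)
    next
      case nz: False
      define A where "A = {k. k < m \<and> coeff H k \<noteq> 0}"
      \<comment> \<open>\<open>\<nu> k\<close> over \<open>fact m\<close> is the order of the
        \<open>k\<close>-th coefficient divided by \<open>m - k\<close>. The common denominator
        keeps the comparison in the natural numbers; the minimum \<open>p / q\<close> is the first
        Newton slope, the least order of a root.\<close>
      define \<nu> where "\<nu> k = subdegree (coeff H k) * (fact m div (m - k))" for k
      have A: "finite A" "A \<noteq> {}" using nz by (auto simp: A_def)
      define p where "p = Min (\<nu> ` A)"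
      define q :: nat where "q = fact m"
      have q: "q > 0" by (simp add: q_def)
      have qk: "fact m div (m - k) * (m - k) = q" if "k < m" for k
        using that unfolding q_def by (intro dvd_div_mult_self) (auto intro: dvd_fact)
      have sub: "subdegree (coeff H k) * q = \<nu> k * (m - k)" if "k < m" for k
        using qk[OF that] by (simp add: \<nu>_def mult.assoc)
      have subq: "subdegree (coeff H k oo fps_X ^ q) = subdegree (coeff H k) * q" if "coeff H k \<noteq> 0" for k
        using q that by (rule subdegree_compose_X_power)
      \<comment> \<open>Coefficients after substituting \<open>t ^ q\<close> for \<open>x\<close>
        and \<open>t ^ p * y\<close> for \<open>y\<close> and dividing by
        \<open>t ^ (p * m)\<close>.\<close>
      define h where "h k = fps_shift (p * (m - k)) (coeff H k oo fps_X ^ q)" for k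
      have hH: "coeff H k oo fps_X ^ q = h k * fps_X ^ (p * (m - k))" if "k \<le> m" for k
      proof (cases "k < m \<and> coeff H k \<noteq> 0")
        case True
        then have "p \<le> \<nu> k" unfolding p_def using A by (intro Min_le) (auto simp: A_def)
        then have "p * (m - k) \<le> subdegree (coeff H k oo fps_X ^ q)" using True sub[of k] subq[of k] by simp
        then show ?thesis unfolding h_def by (simp add: fps_shift_times_fps_X_power)
      next
        case False
        then show ?thesis using that by (cases "k = m") (auto simp: h_def)
      qed
      have hconv: "fps_conv_radius (h k) > 0" for k
        using conv_compose_X_power[OF convH q, of k] by (simp add: h_def)
      define K where "K = (\<Sum>k\<le>m. monom (h k) k)"
      have cK: "coeff K k = (if k \<le> m then h k else 0)" for k by (simp add: K_def coeff_sum coeff_monom)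
      have hm: "h m = 1" using H by (simp add: h_def)
      have dK: "degree K = m" "lead_coeff K = 1"
      proof -
        have "degree K \<le> m" by (rule degree_le) (simp add: cK)
        moreover have "m \<le> degree K" by (rule le_degree) (simp add: cK hm)
        ultimately show "degree K = m" by simp
        then show "lead_coeff K = 1" by (simp add: cK hm)
      qed
      have convK: "conv_coeffs K" using hconv by (auto simp: conv_coeffs_def cK)
      define K0 where "K0 = map_poly (\<lambda>a. fps_nth a 0) K"
      have cK0: "coeff K0 k = fps_nth (coeff K k) 0" for k by (simp add: K0_def coeff_map_poly)
      have dK0: "degree K0 = m" "lead_coeff K0 = 1"
      proof -
        have "degree K0 \<le> m" by (rule degree_le) (simp add: cK0 cK)
        moreover have "m \<le> degree K0" by (rule le_degree) (simp add: cK0 cK hm)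
        ultimately show "degree K0 = m" by simp
        then show "lead_coeff K0 = 1" by (simp add: cK0 cK hm)
      qed
      have "p \<in> \<nu> ` A" unfolding p_def using A by (intro Min_in) auto
      then obtain k where k: "k < m" "coeff H k \<noteq> 0" "p = \<nu> k" by (auto simp: A_def)
      \<comment> \<open>At an index attaining the minimum the order is exactly
        \<open>p * (m - k)\<close>, so the reduction at 0 is not a pure power and has two distinct
        roots.\<close>
      have "coeff K0 k \<noteq> 0"
        using k sub[OF k(1)] subq[OF k(2)] by (simp add: cK0 cK h_def fps_nth_compose_X_power q)
          (metis k(2) nonzero_mult_div_cancel_right nth_subdegree_nonzero q dvd_triv_right less_numeral_extra(3))
      moreover have "coeff K0 (m - 1) = 0" using H0 by (simp add: cK0 cK h_def)
      ultimately obtain \<alpha> \<beta> where ab: "\<alpha> \<noteq> \<beta>" "poly K0 \<alpha> = 0" "poly K0 \<beta> = 0"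
        using monic_two_roots[OF dK0(2,1) _ _ k(1)] False by blast
      obtain P Q where PQ: "K = P * Q" "lead_coeff P = 1" "lead_coeff Q = 1" "degree P < m" "degree Q < m"
        "conv_coeffs P" "conv_coeffs Q"
        using monic_fps_poly_split[OF dK(2) convK ab[unfolded K0_def]] dK(1) by metis
      obtain M' where M': "M = L * M'" using M by (auto elim: dvdE)
      define N where "N = (\<Prod>j<m. Lf j) * M'"
      have N: "M = q * N" "N > 0" using M' M by (auto simp: N_def L_def q_def mult.assoc)
      have dvd: "Lf j dvd N" if "j < m" for j
        unfolding N_def using that by (intro dvd_mult2 dvd_prodI) auto
      have "splits_at N K" unfolding PQ(1)
        using PQ N dvd by (intro splits_at_mult Lf(2)[OF _ refl]) auto
      then obtain ws where ws: "\<forall>w\<in>set ws. fps_conv_radius w > 0" "map_poly (\<lambda>f. f oo fps_X ^ N) K = (\<Prod>y\<leftarrow>ws. [:- y, 1:])"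
        unfolding splits_at_def by blast
      have len: "length ws = m"
      proof -
        have "degree (map_poly (\<lambda>f. f oo fps_X ^ N) K) = m"
        proof (rule antisym)
          show "degree (map_poly (\<lambda>f. f oo fps_X ^ N) K) \<le> m" by (rule degree_le) (simp add: coeff_map_poly cK)
          show "m \<le> degree (map_poly (\<lambda>f. f oo fps_X ^ N) K)" by (rule le_degree) (simp add: coeff_map_poly cK hm)
        qed
        then show ?thesis unfolding ws(2) by (simp add: degree_prod_list_linear)
      qed
      \<comment> \<open>After the further substitution of \<open>t ^ N\<close>, the scaling factor
        \<open>t ^ p\<close> of the roots becomes \<open>u\<close>.\<close>
      define u :: "complex fps" where "u = fps_X ^ (p * N)"
      have u: "u \<noteq> 0" by (simp add: u_def)
      have "map_poly (\<lambda>f. f oo fps_X ^ M) H = (\<Prod>y\<leftarrow>map ((*) u) ws. [:- y, 1:])"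
      proof (rule poly_eqI)
        fix k
        show "coeff (map_poly (\<lambda>f. f oo fps_X ^ M) H) k = coeff (\<Prod>y\<leftarrow>map ((*) u) ws. [:- y, 1:]) k"
        proof (cases "k \<le> m")
          case True
          have "coeff (map_poly (\<lambda>f. f oo fps_X ^ M) H) k = (coeff H k oo fps_X ^ q) oo fps_X ^ N"
            using N by (simp add: coeff_map_poly fps_compose_X_power_compose)
          also have "\<dots> = (h k oo fps_X ^ N) * (fps_X ^ (p * (m - k)) oo fps_X ^ N)"
            unfolding hH[OF True] using N by (intro fps_compose_X_power_mult)
          also have "fps_X ^ (p * (m - k)) oo fps_X ^ N = u ^ (m - k)"
          proof -
            have "fps_X ^ (p * (m - k)) oo fps_X ^ N = (fps_X oo fps_X ^ N :: complex fps) ^ (p * (m - k))"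
              using N by (intro fps_compose_power[symmetric]) (simp add: fps_X_power_nth)
            also have "fps_X oo fps_X ^ N = (fps_X ^ N :: complex fps)"
              using N by (intro fps_X_fps_compose_startby0) (simp add: fps_X_power_nth)
            finally show ?thesis by (simp add: u_def mult_ac flip: power_mult)
          qed
          also have "h k oo fps_X ^ N = coeff (\<Prod>y\<leftarrow>ws. [:- y, 1:]) k"
            using True by (simp add: cK coeff_map_poly flip: ws(2))
          finally have "coeff (map_poly (\<lambda>f. f oo fps_X ^ M) H) k * u ^ k = u ^ m * coeff (\<Prod>y\<leftarrow>ws. [:- y, 1:]) k"
            using True by (simp add: mult_ac flip: power_add)
          also have "\<dots> = coeff (\<Prod>y\<leftarrow>ws. [:- (u * y), 1:]) k * u ^ k"
            using coeff_prod_list_linear_scale[of u ws k] len by simp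
          finally show ?thesis using u by (simp add: o_def)
        next
          case False
          then have "coeff H k = 0" "coeff (\<Prod>y\<leftarrow>map ((*) u) ws. [:- y, 1:]) k = 0"
            using H len by (auto intro!: coeff_eq_0 simp del: map_map simp: degree_prod_list_linear)
          then show ?thesis by (simp add: coeff_map_poly)
        qed
      qed
      then show ?thesis unfolding splits_at_def
        using ws(1) by (intro exI[of _ "map ((*) u) ws"]) (auto simp: u_def intro!: conv_mult)
    qed
    then show ?thesis using splits_at_shift[OF M(1) _ cc] by (simp add: H_def)
  qed
  then show ?case using L by blast
qed

section \<open>Contact orders from symmetric functions\<close>

text \<open>The index \<open>k\<close> codes the pair \<open>(k div r, k mod r)\<close>, and only
  increasing pairs contribute, so weights and digits can be indexed by plain numbers. With all
  weights 1 this is, up to sign, a Vandermonde determinant.\<close>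

definition contact_prod :: "nat \<Rightarrow> (nat \<Rightarrow> nat) \<Rightarrow> (nat \<Rightarrow> 'a::comm_ring_1) \<Rightarrow> 'a" where
  "contact_prod r w v = (\<Prod>k<r * r. (if k div r < k mod r then v (k div r) - v (k mod r) else 1) ^ w k)"

text \<open>Summing over all selections, also those with repetitions, is what makes the sum factor
  into power sums. A repeated value contributes 0 as soon as the weights and \<open>l\<close> are
  positive.\<close>

definition contact_sum :: "nat \<Rightarrow> (nat \<Rightarrow> nat) \<Rightarrow> nat \<Rightarrow> nat \<Rightarrow> (nat \<Rightarrow> 'a::comm_ring_1) \<Rightarrow> 'a" where
  "contact_sum r w l m y = (\<Sum>\<phi>\<in>{..<r} \<rightarrow>\<^sub>E {..<m}. contact_prod r w (\<lambda>i. y (\<phi> i)) ^ l)"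

definition monomial_sum :: "nat \<Rightarrow> ((nat \<Rightarrow> 'a::comm_ring_1) \<Rightarrow> 'a) \<Rightarrow> bool" where
  "monomial_sum r H \<longleftrightarrow> (\<exists>xs :: (int \<times> (nat \<Rightarrow> nat)) list.
     \<forall>v. H v = (\<Sum>x\<leftarrow>xs. of_int (fst x) * (\<Prod>i<r. v i ^ snd x i)))"

lemma monomial_sum_const: "monomial_sum r (\<lambda>v. of_int c)"
  unfolding monomial_sum_def by (intro exI[of _ "[(c, \<lambda>_. 0)]"]) simp

lemma monomial_sum_var: "i < r \<Longrightarrow> monomial_sum r (\<lambda>v. v i)"
  unfolding monomial_sum_def
proof (intro exI[of _ "[(1, \<lambda>j. if j = i then 1 else 0)]"] allI)
  fix v :: "nat \<Rightarrow> 'a" assume "i < r"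
  have "(\<Prod>j<r. v j ^ (if j = i then 1 else 0)) = (\<Prod>j<r. if j = i then v j else 1)"
    by (rule prod.cong) auto
  also have "\<dots> = v i" using \<open>i < r\<close> by (simp add: prod.delta)
  finally show "v i = (\<Sum>x\<leftarrow>[(1, \<lambda>j. if j = i then 1 else 0)]. of_int (fst x) * (\<Prod>i<r. v i ^ snd x i))"
    by simp
qed

lemma monomial_sum_add:
  assumes "monomial_sum r H" "monomial_sum r K"
  shows "monomial_sum r (\<lambda>v. H v + K v)"
proof -
  obtain xs ys where "\<forall>v. H v = (\<Sum>x\<leftarrow>xs. of_int (fst x) * (\<Prod>i<r. v i ^ snd x i))"
    "\<forall>v. K v = (\<Sum>x\<leftarrow>ys. of_int (fst x) * (\<Prod>i<r. v i ^ snd x i))"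
    using assms unfolding monomial_sum_def by blast
  then show ?thesis unfolding monomial_sum_def by (intro exI[of _ "xs @ ys"]) simp
qed

lemma monomial_sum_mult:
  assumes "monomial_sum r H" "monomial_sum r K"
  shows "monomial_sum r (\<lambda>v. H v * K v)"
proof -
  define mon where "mon v x = of_int (fst x) * (\<Prod>i<r. v i ^ snd x i)" for v :: "nat \<Rightarrow> 'a" and x :: "int \<times> (nat \<Rightarrow> nat)"
  obtain xs ys where xs: "\<And>v. H v = (\<Sum>x\<leftarrow>xs. mon v x)" and ys: "\<And>v. K v = (\<Sum>x\<leftarrow>ys. mon v x)"
    using assms unfolding monomial_sum_def mon_def by blast
  define f where "f x y = (fst x * fst y, \<lambda>i. snd x i + snd y i)" for x y :: "int \<times> (nat \<Rightarrow> nat)"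
  have f: "mon v (f x y) = mon v x * mon v y" for v x y
    by (simp add: mon_def f_def power_add prod.distrib mult_ac)
  have one: "(\<Sum>z\<leftarrow>map (f x) ys. mon v z) = mon v x * (\<Sum>y\<leftarrow>ys. mon v y)" for x v
    by (simp add: o_def f sum_list_const_mult)
  have "(\<Sum>z\<leftarrow>concat (map (\<lambda>x. map (f x) ys) xs). mon v z) = (\<Sum>x\<leftarrow>xs. mon v x) * (\<Sum>y\<leftarrow>ys. mon v y)" for v
    by (induction xs) (simp_all add: one algebra_simps del: map_map)
  then have "\<forall>v. H v * K v = (\<Sum>z\<leftarrow>concat (map (\<lambda>x. map (f x) ys) xs). mon v z)" by (simp add: xs ys)
  then show ?thesis unfolding monomial_sum_def mon_def by blast
qed

lemma monomial_sum_uminus: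
  assumes "monomial_sum r H" shows "monomial_sum r (\<lambda>v. - H v)"
  using monomial_sum_mult[OF monomial_sum_const[of r "-1"] assms] by simp

lemma monomial_sum_diff:
  assumes "monomial_sum r H" "monomial_sum r K" shows "monomial_sum r (\<lambda>v. H v - K v)"
  using monomial_sum_add[OF assms(1) monomial_sum_uminus[OF assms(2)]] by simp

lemma monomial_sum_power: "monomial_sum r H \<Longrightarrow> monomial_sum r (\<lambda>v. H v ^ n)"
  by (induction n) (auto intro: monomial_sum_mult simp: monomial_sum_const[of r 1, simplified])

lemma monomial_sum_prod: "(\<And>i. i \<in> A \<Longrightarrow> monomial_sum r (H i)) \<Longrightarrow> monomial_sum r (\<lambda>v. \<Prod>i\<in>A. H i v)"
  by (induction A rule: infinite_finite_induct)
     (auto intro: monomial_sum_mult simp: monomial_sum_const[of r 1, simplified])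

lemma monomial_sum_contact_prod: "monomial_sum r (\<lambda>v. contact_prod r w v ^ l)"
  unfolding contact_prod_def
proof (intro monomial_sum_power monomial_sum_prod)
  fix k assume "k \<in> {..<r * r}"
  then have "k div r < r" "k mod r < r" by (auto simp: less_mult_imp_div_less intro!: mod_less_divisor gr0I)
  then show "monomial_sum r (\<lambda>v::nat \<Rightarrow> 'a. if k div r < k mod r then v (k div r) - v (k mod r) else 1)"
    using monomial_sum_const[of r 1, simplified]
    by (cases "k div r < k mod r") (auto intro!: monomial_sum_diff monomial_sum_var)
qed

lemma sum_list_sum_swap: "(\<Sum>a\<in>A. \<Sum>x\<leftarrow>xs. f a x) = (\<Sum>x\<leftarrow>xs. \<Sum>a\<in>A. f a x :: 'b::comm_monoid_add)"
  by (induction xs) (simp_all add: sum.distrib)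

text \<open>Expand the product into monomials; summing a monomial over all selections gives a
  product with one power sum per variable. The list depends neither on \<open>m\<close> nor on
  \<open>y\<close>, so one formula serves all parameters.\<close>

theorem contact_sum_power_sums:
  "\<exists>xs :: (int \<times> (nat \<Rightarrow> nat)) list. \<forall>m (y :: nat \<Rightarrow> 'a::comm_ring_1).
     contact_sum r w l m y = (\<Sum>x\<leftarrow>xs. of_int (fst x) * (\<Prod>i<r. \<Sum>j<m. y j ^ snd x i))"
proof -
  obtain xs :: "(int \<times> (nat \<Rightarrow> nat)) list" where xs: "\<And>v :: nat \<Rightarrow> 'a. contact_prod r w v ^ l = (\<Sum>x\<leftarrow>xs. of_int (fst x) * (\<Prod>i<r. v i ^ snd x i))"
    using monomial_sum_contact_prod[of r w l] unfolding monomial_sum_def by blast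
  have "contact_sum r w l m y = (\<Sum>x\<leftarrow>xs. of_int (fst x) * (\<Prod>i<r. \<Sum>j<m. y j ^ snd x i))"
    for m and y :: "nat \<Rightarrow> 'a"
  proof -
    have "(\<Prod>i<r. \<Sum>j<m. y j ^ snd x i) = (\<Sum>\<phi>\<in>{..<r} \<rightarrow>\<^sub>E {..<m}. \<Prod>i<r. y (\<phi> i) ^ snd x i)" for x :: "int \<times> (nat \<Rightarrow> nat)"
      by (rule prod_sum_PiE) auto
    then show ?thesis unfolding contact_sum_def xs sum_list_sum_swap by (simp add: sum_distrib_left)
  qed
  then show ?thesis by blast
qed

text \<open>Test with a polynomial \<open>P\<close> without constant term that vanishes at all
  values except \<open>a \<phi>\<close>. Its sum over the family is a positive integer multiple of
  \<open>P (a \<phi>)\<close>, so one of the power sums in it is nonzero; the bound on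
  \<open>l\<close> is the degree of \<open>P\<close>.\<close>

lemma power_sums_nonzero:
  fixes a :: "'p \<Rightarrow> complex"
  assumes fin: "finite \<Phi>" and p: "\<phi> \<in> \<Phi>" "a \<phi> \<noteq> 0"
  obtains l where "l \<ge> 1" "l \<le> card \<Phi>" "(\<Sum>\<phi>\<in>\<Phi>. a \<phi> ^ l) \<noteq> 0"
proof -
  define V where "V = a ` \<Phi> - {0, a \<phi>}"
  define P where "P = [:0, 1:] * (\<Prod>v\<in>V. [:- v, 1:])"
  have finV: "finite V" using fin by (simp add: V_def)
  have "V \<subseteq> a ` \<Phi> - {a \<phi>}" by (auto simp: V_def)
  then have "card V \<le> card (a ` \<Phi> - {a \<phi>})" using fin by (intro card_mono) auto
  also have "\<dots> < card (a ` \<Phi>)" using fin p by (intro psubset_card_mono) auto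
  also have "\<dots> \<le> card \<Phi>" using fin by (rule card_image_le)
  finally have cV: "Suc (card V) \<le> card \<Phi>" by simp
  have "degree P \<le> degree [:0, 1 :: complex:] + degree (\<Prod>v\<in>V. [:- v, 1:])"
    unfolding P_def by (rule degree_mult_le)
  then have degP: "degree P \<le> card \<Phi>" using degree_prod_linear(1)[OF finV, of "\<lambda>v. v"] cV by simp
  have P0: "coeff P 0 = 0" by (simp add: P_def)
  have root: "poly P v = 0" if "v \<in> a ` \<Phi>" "v \<noteq> a \<phi>" for v
    using that finV by (auto simp: P_def poly_prod V_def)
  have nz: "poly P (a \<phi>) \<noteq> 0" using p finV by (auto simp: P_def poly_prod V_def)
  have "(\<Sum>\<psi>\<in>\<Phi>. poly P (a \<psi>)) = (\<Sum>\<psi>\<in>{\<psi>\<in>\<Phi>. a \<psi> = a \<phi>}. poly P (a \<psi>))"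
    by (rule sum.mono_neutral_right) (use fin root in auto)
  also have "\<dots> = of_nat (card {\<psi>\<in>\<Phi>. a \<psi> = a \<phi>}) * poly P (a \<phi>)" by simp
  also have "\<dots> \<noteq> 0" using nz fin p by auto
  finally have "(\<Sum>\<psi>\<in>\<Phi>. poly P (a \<psi>)) \<noteq> 0" .
  moreover have "(\<Sum>\<psi>\<in>\<Phi>. poly P (a \<psi>)) = (\<Sum>l\<le>degree P. coeff P l * (\<Sum>\<psi>\<in>\<Phi>. a \<psi> ^ l))"
    unfolding poly_altdef sum_distrib_left by (rule sum.swap)
  ultimately obtain l where l: "l \<le> degree P" "coeff P l * (\<Sum>\<psi>\<in>\<Phi>. a \<psi> ^ l) \<noteq> 0"
    by (metis (no_types, lifting) atMost_iff sum.neutral)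
  then have "l \<noteq> 0" using P0 by (cases l) auto
  then show ?thesis using that[of l] l degP by auto
qed

definition same_order :: "complex fps \<Rightarrow> complex fps \<Rightarrow> bool" where
  "same_order f g \<longleftrightarrow> (f = 0 \<longleftrightarrow> g = 0) \<and> subdegree f = subdegree g"

text \<open>Zero members are left out because their subdegree is 0 by convention.\<close>

definition min_order :: "('p \<Rightarrow> complex fps) \<Rightarrow> 'p set \<Rightarrow> nat" where
  "min_order A \<Phi> = Min (subdegree ` (A ` \<Phi> - {0}))"

lemma same_order_sym: "same_order f g \<Longrightarrow> same_order g f"
  by (auto simp: same_order_def)

lemma fps_nth_power_min:
  fixes f :: "complex fps"
  assumes "\<And>j. j < \<nu> \<Longrightarrow> fps_nth f j = 0"
  shows "(\<forall>j<l * \<nu>. fps_nth (f ^ l) j = 0) \<and> fps_nth (f ^ l) (l * \<nu>) = fps_nth f \<nu> ^ l"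
proof -
  have "f = fps_shift \<nu> f * fps_X ^ \<nu>"
    by (rule fps_ext) (use assms in \<open>auto simp: fps_X_power_mult_right_nth\<close>)
  then have "f ^ l = fps_shift \<nu> f ^ l * fps_X ^ (l * \<nu>)"
    by (metis power_mult_distrib power_mult mult.commute)
  moreover have "fps_nth (g ^ l) 0 = fps_nth g 0 ^ l" for g :: "complex fps"
    by (induction l) (simp_all add: fps_mult_nth_0)
  ultimately show ?thesis by (simp add: fps_X_power_mult_right_nth)
qed

text \<open>Every \<open>l\<close>-th power has order at least \<open>l\<close> times the minimum,
  and the coefficient at that place is the power sum of the coefficients at the minimal order,
  nonzero for a suitable \<open>l\<close>. So the minimum is visible in finitely many symmetric
  sums, although any single one may cancel.\<close>

lemma min_order_detected:
  fixes A :: "'p \<Rightarrow> complex fps"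
  assumes fin: "finite \<Phi>" and nz: "\<exists>\<phi>\<in>\<Phi>. A \<phi> \<noteq> 0"
  shows "\<And>l. (\<Sum>\<phi>\<in>\<Phi>. A \<phi> ^ l) \<noteq> 0 \<Longrightarrow> l * min_order A \<Phi> \<le> subdegree (\<Sum>\<phi>\<in>\<Phi>. A \<phi> ^ l)"
    and "\<exists>l\<in>{1..card \<Phi>}. (\<Sum>\<phi>\<in>\<Phi>. A \<phi> ^ l) \<noteq> 0 \<and> subdegree (\<Sum>\<phi>\<in>\<Phi>. A \<phi> ^ l) = l * min_order A \<Phi>"
proof -
  define \<nu> where "\<nu> = min_order A \<Phi>"
  have ne: "subdegree ` (A ` \<Phi> - {0}) \<noteq> {}" "finite (subdegree ` (A ` \<Phi> - {0}))" using fin nz by auto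
  have low: "fps_nth (A \<phi>) j = 0" if "\<phi> \<in> \<Phi>" "j < \<nu>" for \<phi> j
  proof (cases "A \<phi> = 0")
    case False
    then have "\<nu> \<le> subdegree (A \<phi>)" unfolding \<nu>_def min_order_def using ne that by (intro Min_le) auto
    then show ?thesis using that by (intro nth_less_subdegree_zero) simp
  qed simp
  have "\<nu> \<in> subdegree ` (A ` \<Phi> - {0})" unfolding \<nu>_def min_order_def using ne by (intro Min_in)
  then obtain \<phi> where \<phi>: "\<phi> \<in> \<Phi>" "A \<phi> \<noteq> 0" "subdegree (A \<phi>) = \<nu>" by auto
  have zero: "fps_nth (\<Sum>\<phi>\<in>\<Phi>. A \<phi> ^ l) j = 0" if "j < l * \<nu>" for j l
    unfolding fps_sum_nth using fps_nth_power_min[OF low] that by (intro sum.neutral) blast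
  have lead: "fps_nth (\<Sum>\<phi>\<in>\<Phi>. A \<phi> ^ l) (l * \<nu>) = (\<Sum>\<phi>\<in>\<Phi>. fps_nth (A \<phi>) \<nu> ^ l)" for l
    unfolding fps_sum_nth using fps_nth_power_min[OF low] by (intro sum.cong) blast+
  show "l * min_order A \<Phi> \<le> subdegree (\<Sum>\<phi>\<in>\<Phi>. A \<phi> ^ l)" if "(\<Sum>\<phi>\<in>\<Phi>. A \<phi> ^ l) \<noteq> 0" for l
    unfolding \<nu>_def[symmetric] using that zero by (intro subdegree_geI) auto
  have "fps_nth (A \<phi>) \<nu> \<noteq> 0" using \<phi> by (metis nth_subdegree_nonzero)
  then obtain l where l: "l \<ge> 1" "l \<le> card \<Phi>" "(\<Sum>\<phi>\<in>\<Phi>. fps_nth (A \<phi>) \<nu> ^ l) \<noteq> 0"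
    using power_sums_nonzero[OF fin \<phi>(1), of "\<lambda>\<phi>. fps_nth (A \<phi>) \<nu>"] by blast
  then have "subdegree (\<Sum>\<phi>\<in>\<Phi>. A \<phi> ^ l) = l * \<nu>" using zero lead by (intro subdegreeI) auto
  moreover have "(\<Sum>\<phi>\<in>\<Phi>. A \<phi> ^ l) \<noteq> 0" using l lead by (metis fps_zero_nth)
  ultimately show "\<exists>l\<in>{1..card \<Phi>}. (\<Sum>\<phi>\<in>\<Phi>. A \<phi> ^ l) \<noteq> 0 \<and> subdegree (\<Sum>\<phi>\<in>\<Phi>. A \<phi> ^ l) = l * min_order A \<Phi>"
    using l unfolding \<nu>_def by auto
qed

lemma min_order_same:
  fixes A A' :: "'p \<Rightarrow> complex fps"
  assumes fin: "finite \<Phi>" and so: "\<And>l. l \<in> {1..card \<Phi>} \<Longrightarrow> same_order (\<Sum>\<phi>\<in>\<Phi>. A \<phi> ^ l) (\<Sum>\<phi>\<in>\<Phi>. A' \<phi> ^ l)"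
    and nz: "\<exists>\<phi>\<in>\<Phi>. A \<phi> \<noteq> 0"
  shows "(\<exists>\<phi>\<in>\<Phi>. A' \<phi> \<noteq> 0) \<and> min_order A' \<Phi> = min_order A \<Phi>"
proof -
  have *: "(\<exists>\<phi>\<in>\<Phi>. A' \<phi> \<noteq> 0) \<and> min_order A' \<Phi> \<le> min_order A \<Phi>"
    if so: "\<And>l. l \<in> {1..card \<Phi>} \<Longrightarrow> same_order (\<Sum>\<phi>\<in>\<Phi>. A \<phi> ^ l) (\<Sum>\<phi>\<in>\<Phi>. A' \<phi> ^ l)"
      and nz: "\<exists>\<phi>\<in>\<Phi>. A \<phi> \<noteq> 0" for A A' :: "'p \<Rightarrow> complex fps"
  proof -
    obtain l where l: "l \<in> {1..card \<Phi>}" "(\<Sum>\<phi>\<in>\<Phi>. A \<phi> ^ l) \<noteq> 0" "subdegree (\<Sum>\<phi>\<in>\<Phi>. A \<phi> ^ l) = l * min_order A \<Phi>"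
      using min_order_detected(2)[OF fin nz] by blast
    have l': "(\<Sum>\<phi>\<in>\<Phi>. A' \<phi> ^ l) \<noteq> 0" "subdegree (\<Sum>\<phi>\<in>\<Phi>. A' \<phi> ^ l) = l * min_order A \<Phi>"
      using so[OF l(1)] l by (auto simp: same_order_def)
    have nz': "\<exists>\<phi>\<in>\<Phi>. A' \<phi> \<noteq> 0"
    proof (rule ccontr)
      assume "\<not> (\<exists>\<phi>\<in>\<Phi>. A' \<phi> \<noteq> 0)"
      then have "(\<Sum>\<phi>\<in>\<Phi>. A' \<phi> ^ l) = 0" using l(1) by (intro sum.neutral) (auto simp: power_0_left)
      then show False using l' by simp
    qed
    then have "l * min_order A' \<Phi> \<le> l * min_order A \<Phi>" using min_order_detected(1)[OF fin nz' l'(1)] l'(2) by simp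
    then show ?thesis using nz' l(1) by simp
  qed
  show ?thesis using *[OF so nz] *[of A' A] so same_order_sym by (metis antisym)
qed

lemma digits_unique:
  fixes d d' :: "nat \<Rightarrow> nat"
  assumes "\<And>k. k < n \<Longrightarrow> d k < B" "\<And>k. k < n \<Longrightarrow> d' k < B" "(\<Sum>k<n. B ^ k * d k) = (\<Sum>k<n. B ^ k * d' k)" "k < n"
  shows "d k = d' k"
  using assms
proof (induction n arbitrary: d d' k)
  case (Suc n)
  have e: "(\<Sum>k<Suc n. B ^ k * f k) = f 0 + B * (\<Sum>k<n. B ^ k * f (Suc k))" for f :: "nat \<Rightarrow> nat"
    by (subst sum.lessThan_Suc_shift) (simp add: sum_distrib_left mult_ac)
  have eq: "d 0 + B * (\<Sum>k<n. B ^ k * d (Suc k)) = d' 0 + B * (\<Sum>k<n. B ^ k * d' (Suc k))"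
    using Suc.prems(3) unfolding e .
  have lt: "d 0 < B" "d' 0 < B" using Suc.prems by auto
  have "d 0 = (d 0 + B * (\<Sum>k<n. B ^ k * d (Suc k))) mod B" using lt by simp
  also have "\<dots> = d' 0" unfolding eq using lt by simp
  finally have 0: "d 0 = d' 0" .
  then have "(\<Sum>k<n. B ^ k * d (Suc k)) = (\<Sum>k<n. B ^ k * d' (Suc k))" using eq lt by simp
  then have "d (Suc j) = d' (Suc j)" if "j < n" for j
    using Suc.IH[of "\<lambda>k. d (Suc k)" "\<lambda>k. d' (Suc k)" j] Suc.prems that by simp
  then show ?case using 0 Suc.prems(4) by (cases k) auto
qed simp

lemma contact_prod_nonzero_iff:
  fixes v :: "nat \<Rightarrow> complex fps"
  assumes "\<And>k. w k > 0"
  shows "contact_prod r w v \<noteq> 0 \<longleftrightarrow> inj_on v {..<r}"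
proof
  assume nz: "contact_prod r w v \<noteq> 0"
  have ne: "v i \<noteq> v j" if "i < j" "j < r" for i j
  proof -
    define k where "k = i * r + j"
    have k: "k div r = i" "k mod r = j" using that by (auto simp: k_def)
    have "k < Suc i * r" using that by (simp add: k_def)
    also have "\<dots> \<le> r * r" using that by (intro mult_le_mono1) simp
    finally have "k < r * r" .
    then have "(if k div r < k mod r then v (k div r) - v (k mod r) else 1) ^ w k \<noteq> 0"
      using nz unfolding contact_prod_def by (metis (no_types, lifting) finite_lessThan lessThan_iff prod_zero)
    then show ?thesis using k that assms[of k] by auto
  qed
  show "inj_on v {..<r}"
    by (rule inj_onI) (metis ne lessThan_iff linorder_neqE_nat)
next
  assume inj: "inj_on v {..<r}"
  have "(if k div r < k mod r then v (k div r) - v (k mod r) else 1) ^ w k \<noteq> 0" if "k < r * r" for k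
  proof (cases "k div r < k mod r")
    case True
    have "k mod r < r" using that by (auto intro!: mod_less_divisor gr0I)
    then have "v (k div r) \<noteq> v (k mod r)" using True inj inj_onD[OF inj, of "k div r" "k mod r"] by auto
    then show ?thesis using True by simp
  qed simp
  then show "contact_prod r w v \<noteq> 0" unfolding contact_prod_def by simp
qed

lemma subdegree_contact_prod:
  fixes v :: "nat \<Rightarrow> complex fps"
  assumes "inj_on v {..<r}"
  shows "subdegree (contact_prod r w v)
    = (\<Sum>k<r * r. w k * (if k div r < k mod r then subdegree (v (k div r) - v (k mod r)) else 0))"
proof -
  have nz: "(if k div r < k mod r then v (k div r) - v (k mod r) else 1) \<noteq> 0" if "k < r * r" for k
  proof (cases "k div r < k mod r")
    case True
    have "k mod r < r" using that by (auto intro!: mod_less_divisor gr0I)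
    then show ?thesis using True inj_onD[OF assms, of "k div r" "k mod r"] by auto
  qed simp
  show ?thesis unfolding contact_prod_def
    by (subst subdegree_prod) (use nz in \<open>auto simp: subdegree_power intro!: sum.cong\<close>)
qed

lemma ex_injective_selection_iff:
  fixes z :: "nat \<Rightarrow> 'a"
  shows "(\<exists>\<phi>\<in>{..<r} \<rightarrow>\<^sub>E {..<m}. inj_on (\<lambda>i. z (\<phi> i)) {..<r}) \<longleftrightarrow> r \<le> card (z ` {..<m})"
proof
  assume "\<exists>\<phi>\<in>{..<r} \<rightarrow>\<^sub>E {..<m}. inj_on (\<lambda>i. z (\<phi> i)) {..<r}"
  then obtain \<phi> where \<phi>: "\<phi> \<in> {..<r} \<rightarrow>\<^sub>E {..<m}" "inj_on (\<lambda>i. z (\<phi> i)) {..<r}" by blast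
  have "card {..<r} \<le> card (z ` {..<m})"
    by (rule card_inj_on_le[OF \<phi>(2)]) (use \<phi>(1) in \<open>auto simp: PiE_def Pi_def\<close>)
  then show "r \<le> card (z ` {..<m})" by simp
next
  assume le: "r \<le> card (z ` {..<m})"
  obtain T where T: "T \<subseteq> z ` {..<m}" "card T = r" "finite T"
    using obtain_subset_with_card_n[OF le] by blast
  obtain f where f: "bij_betw f {..<r} T" using T ex_bij_betw_nat_finite[of T] by (auto simp: atLeast0LessThan)
  define \<phi> where "\<phi> = (\<lambda>i\<in>{..<r}. SOME j. j < m \<and> z j = f i)"
  have \<phi>: "\<phi> i < m \<and> z (\<phi> i) = f i" if "i < r" for i
  proof -
    have "f i \<in> T" using f that by (auto simp: bij_betw_def)
    then have "f i \<in> z ` {..<m}" using T(1) by blast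
    then have "\<exists>j. j < m \<and> z j = f i" by force
    then show ?thesis using that someI_ex[of "\<lambda>j. j < m \<and> z j = f i"] by (simp add: \<phi>_def)
  qed
  have "\<phi> \<in> {..<r} \<rightarrow>\<^sub>E {..<m}" using \<phi> by (auto simp: \<phi>_def)
  moreover have "inj_on (\<lambda>i. z (\<phi> i)) {..<r}"
    using f \<phi> by (auto simp: bij_betw_def inj_on_def)
  ultimately show "\<exists>\<phi>\<in>{..<r} \<rightarrow>\<^sub>E {..<m}. inj_on (\<lambda>i. z (\<phi> i)) {..<r}" by blast
qed

lemma ex_contact_prod_nonzero_iff:
  fixes z :: "nat \<Rightarrow> complex fps"
  assumes "\<And>k. w k > 0"
  shows "(\<exists>\<phi>\<in>{..<r} \<rightarrow>\<^sub>E {..<m}. contact_prod r w (\<lambda>i. z (\<phi> i)) \<noteq> 0) \<longleftrightarrow> r \<le> card (z ` {..<m})"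
  using contact_prod_nonzero_iff[OF assms] ex_injective_selection_iff[of r m z] by simp

text \<open>The number of distinct roots is the largest \<open>r\<close> for which some product over
  \<open>r\<close> selected roots is nonzero, and the sums detect this. For that \<open>r\<close>
  and weights 1 the minimal order is the total contact of the distinct roots.\<close>

lemma contact_count_by_sums:
  fixes m r :: nat and y y' :: "nat \<Rightarrow> complex fps"
  defines "\<Phi> \<equiv> \<lambda>r. {..<r} \<rightarrow>\<^sub>E {..<m}"
  assumes one: "\<And>r l. r \<le> m \<Longrightarrow> l \<in> {1..card (\<Phi> r)} \<Longrightarrow>
      same_order (contact_sum r (\<lambda>_. 1) l m y) (contact_sum r (\<lambda>_. 1) l m y')"
    and r: "r = card (y ` {..<m})"
  shows "card (y' ` {..<m}) = r"
    and "min_order (\<lambda>\<phi>. contact_prod r (\<lambda>_. 1) (\<lambda>i. y' (\<phi> i))) (\<Phi> r)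
       = min_order (\<lambda>\<phi>. contact_prod r (\<lambda>_. 1) (\<lambda>i. y (\<phi> i))) (\<Phi> r)"
proof -
  have fin: "finite (\<Phi> r)" for r by (auto simp: \<Phi>_def intro: finite_PiE)
  have ex': "(\<exists>\<phi>\<in>\<Phi> r. contact_prod r w (\<lambda>i. z (\<phi> i)) \<noteq> 0) \<longleftrightarrow> r \<le> card (z ` {..<m})"
    if "\<And>k. w k > 0" for r w and z :: "nat \<Rightarrow> complex fps"
    unfolding \<Phi>_def by (rule ex_contact_prod_nonzero_iff[OF that])
  have card_le: "card (z ` {..<m}) \<le> m" for z :: "nat \<Rightarrow> complex fps"
    using card_image_le[of "{..<m}" z] by simp
  have iff: "(\<exists>\<phi>\<in>\<Phi> s. contact_prod s (\<lambda>_. 1) (\<lambda>i. y' (\<phi> i)) \<noteq> 0) \<and>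
       min_order (\<lambda>\<phi>. contact_prod s (\<lambda>_. 1) (\<lambda>i. y' (\<phi> i))) (\<Phi> s)
         = min_order (\<lambda>\<phi>. contact_prod s (\<lambda>_. 1) (\<lambda>i. y (\<phi> i))) (\<Phi> s)"
    if "s \<le> m" "\<exists>\<phi>\<in>\<Phi> s. contact_prod s (\<lambda>_. 1) (\<lambda>i. y (\<phi> i)) \<noteq> 0" for s
    by (rule min_order_same[OF fin]) (use one that in \<open>auto simp: contact_sum_def \<Phi>_def\<close>)
  have iff': "\<exists>\<phi>\<in>\<Phi> s. contact_prod s (\<lambda>_. 1) (\<lambda>i. y (\<phi> i)) \<noteq> 0"
    if "s \<le> m" "\<exists>\<phi>\<in>\<Phi> s. contact_prod s (\<lambda>_. 1) (\<lambda>i. y' (\<phi> i)) \<noteq> 0" for s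
  proof -
    have "same_order (\<Sum>\<phi>\<in>\<Phi> s. contact_prod s (\<lambda>_. 1) (\<lambda>i. y' (\<phi> i)) ^ l) (\<Sum>\<phi>\<in>\<Phi> s. contact_prod s (\<lambda>_. 1) (\<lambda>i. y (\<phi> i)) ^ l)"
      if "l \<in> {1..card (\<Phi> s)}" for l
      using same_order_sym[OF one[OF \<open>s \<le> m\<close> that]] by (simp add: contact_sum_def \<Phi>_def)
    then show ?thesis using min_order_same[OF fin _ that(2), of "\<lambda>\<phi>. contact_prod s (\<lambda>_. 1) (\<lambda>i. y (\<phi> i))"] by blast
  qed
  have c1: "s \<le> card (y ` {..<m}) \<longleftrightarrow> s \<le> card (y' ` {..<m})" if "s \<le> m" for s
    using iff[OF that] iff'[OF that] ex'[of "\<lambda>_. 1" s y] ex'[of "\<lambda>_. 1" s y'] by auto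
  show "card (y' ` {..<m}) = r"
    using c1[OF card_le[of y]] c1[OF card_le[of y']] r by auto
  have rm: "r \<le> m" using card_le r by simp
  have nz: "\<exists>\<phi>\<in>\<Phi> r. contact_prod r (\<lambda>_. 1) (\<lambda>i. y (\<phi> i)) \<noteq> 0" using ex'[of "\<lambda>_. 1" r y] r by simp
  show "min_order (\<lambda>\<phi>. contact_prod r (\<lambda>_. 1) (\<lambda>i. y' (\<phi> i))) (\<Phi> r)
       = min_order (\<lambda>\<phi>. contact_prod r (\<lambda>_. 1) (\<lambda>i. y (\<phi> i))) (\<Phi> r)"
    using iff[OF rm nz] by blast
qed

text \<open>Selections of \<open>r\<close> distinct values are the orderings of the root set. For an
  ordering that minimises the order of the product with weights \<open>B ^ k\<close>, the contacts
  are the base-\<open>B\<close> digits of this order. The minima agree on both sides, so matching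
  two minimising orderings preserves every contact.\<close>

theorem contact_equiv_by_sums:
  fixes m r B :: nat and y y' :: "nat \<Rightarrow> complex fps"
  defines "\<Phi> \<equiv> \<lambda>r. {..<r} \<rightarrow>\<^sub>E {..<m}"
  assumes one: "\<And>r l. r \<le> m \<Longrightarrow> l \<in> {1..card (\<Phi> r)} \<Longrightarrow>
      same_order (contact_sum r (\<lambda>_. 1) l m y) (contact_sum r (\<lambda>_. 1) l m y')"
    and r: "r = card (y ` {..<m})"
    and B: "B > min_order (\<lambda>\<phi>. contact_prod r (\<lambda>_. 1) (\<lambda>i. y (\<phi> i))) (\<Phi> r)"
    and two: "\<And>l. l \<in> {1..card (\<Phi> r)} \<Longrightarrow>
      same_order (contact_sum r (\<lambda>k. B ^ k) l m y) (contact_sum r (\<lambda>k. B ^ k) l m y')"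
  shows "contact_equiv 1 (y ` {..<m}) (y' ` {..<m})"
proof -
  have fin: "finite (\<Phi> r)" for r by (auto simp: \<Phi>_def intro: finite_PiE)
  have ex': "(\<exists>\<phi>\<in>\<Phi> r. contact_prod r w (\<lambda>i. z (\<phi> i)) \<noteq> 0) \<longleftrightarrow> r \<le> card (z ` {..<m})"
    if "\<And>k. w k > 0" for r w and z :: "nat \<Rightarrow> complex fps"
    unfolding \<Phi>_def by (rule ex_contact_prod_nonzero_iff[OF that])
  have "same_order (contact_sum r (\<lambda>_. 1) l m y) (contact_sum r (\<lambda>_. 1) l m y')"
    if "r \<le> m" "l \<in> {1..card ({..<r} \<rightarrow>\<^sub>E {..<m})}" for r l
    using one that unfolding \<Phi>_def by blast
  note count = contact_count_by_sums[OF this r]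
  have cy': "card (y' ` {..<m}) = r" by (rule count(1))
  have mo: "min_order (\<lambda>\<phi>. contact_prod r (\<lambda>_. 1) (\<lambda>i. y' (\<phi> i))) (\<Phi> r)
       = min_order (\<lambda>\<phi>. contact_prod r (\<lambda>_. 1) (\<lambda>i. y (\<phi> i))) (\<Phi> r)" unfolding \<Phi>_def by (rule count(2))
  have attained: "\<exists>\<phi>\<in>\<Phi> r. inj_on (\<lambda>i. z (\<phi> i)) {..<r} \<and>
      subdegree (contact_prod r w (\<lambda>i. z (\<phi> i))) = min_order (\<lambda>\<phi>. contact_prod r w (\<lambda>i. z (\<phi> i))) (\<Phi> r)"
    if w: "\<And>k. w k > 0" and c: "card (z ` {..<m}) = r" for w and z :: "nat \<Rightarrow> complex fps"
  proof -
    let ?A = "\<lambda>\<phi>. contact_prod r w (\<lambda>i. z (\<phi> i))"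
    have "\<exists>\<phi>\<in>\<Phi> r. ?A \<phi> \<noteq> 0" using ex'[of w r z] w c by simp
    then have "min_order ?A (\<Phi> r) \<in> subdegree ` (?A ` \<Phi> r - {0})"
      unfolding min_order_def using fin by (intro Min_in) auto
    then obtain g where g: "g \<in> ?A ` \<Phi> r" "g \<noteq> 0" "min_order ?A (\<Phi> r) = subdegree g" by blast
    then obtain \<phi> where \<phi>: "\<phi> \<in> \<Phi> r" "g = ?A \<phi>" by blast
    have "inj_on (\<lambda>i. z (\<phi> i)) {..<r}"
      using contact_prod_nonzero_iff[OF w, where r = r and v = "\<lambda>i. z (\<phi> i)"] g(2) \<phi>(2) by simp
    then show ?thesis using \<phi> g(3) by (intro bexI[of _ \<phi>]) simp_all
  qed
  have onto: "(\<lambda>i. z (\<phi> i)) ` {..<r} = z ` {..<m}" if "\<phi> \<in> \<Phi> r" "inj_on (\<lambda>i. z (\<phi> i)) {..<r}" "card (z ` {..<m}) = r"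
    for \<phi> and z :: "nat \<Rightarrow> complex fps"
  proof (rule card_subset_eq)
    show "(\<lambda>i. z (\<phi> i)) ` {..<r} \<subseteq> z ` {..<m}" using that(1) by (auto simp: \<Phi>_def PiE_def Pi_def)
    show "card ((\<lambda>i. z (\<phi> i)) ` {..<r}) = card (z ` {..<m})" using card_image[OF that(2)] that(3) by simp
  qed simp
  have sw: "subdegree (a - b) = subdegree (b - a)" for a b :: "complex fps"
    by (metis minus_diff_eq subdegree_uminus)
  \<comment> \<open>The total contact is a sum of natural numbers, so a base above it exceeds each
    single contact, as digits require.\<close>
  have small: "subdegree (a - b) < B" if ab: "a \<in> z ` {..<m}" "b \<in> z ` {..<m}" "a \<noteq> b" and c: "card (z ` {..<m}) = r"
    and Bz: "B > min_order (\<lambda>\<phi>. contact_prod r (\<lambda>_. 1) (\<lambda>i. z (\<phi> i))) (\<Phi> r)" for a b and z :: "nat \<Rightarrow> complex fps"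
  proof -
    obtain \<phi> where \<phi>: "\<phi> \<in> \<Phi> r" "inj_on (\<lambda>i. z (\<phi> i)) {..<r}"
      "subdegree (contact_prod r (\<lambda>_. 1) (\<lambda>i. z (\<phi> i))) = min_order (\<lambda>\<phi>. contact_prod r (\<lambda>_. 1) (\<lambda>i. z (\<phi> i))) (\<Phi> r)"
      using attained[of "\<lambda>_. 1" z] c by auto
    define v where "v = (\<lambda>i. z (\<phi> i))"
    have vinj: "inj_on v {..<r}" unfolding v_def by (rule \<phi>(2))
    have le: "subdegree (v i - v j) < B" if "i < j" "j < r" for i j
    proof -
      define k where "k = i * r + j"
      have k: "k div r = i" "k mod r = j" using that by (auto simp: k_def)
      have "k < Suc i * r" using that by (simp add: k_def)
      also have "\<dots> \<le> r * r" using that by (intro mult_le_mono1) simp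
      finally have kr: "k \<in> {..<r * r}" by simp
      have "(if k div r < k mod r then subdegree (v (k div r) - v (k mod r)) else 0)
          \<le> (\<Sum>k<r * r. if k div r < k mod r then subdegree (v (k div r) - v (k mod r)) else 0)"
        by (rule member_le_sum[OF kr]) auto
      also have "\<dots> = subdegree (contact_prod r (\<lambda>_. 1) v)"
        using subdegree_contact_prod[OF vinj, of "\<lambda>_. 1"] by simp
      also have "\<dots> < B" using \<phi>(3) Bz by (simp add: v_def)
      finally show ?thesis using k that by simp
    qed
    have "a \<in> v ` {..<r}" "b \<in> v ` {..<r}" using onto[OF \<phi>(1,2) c] ab by (simp_all add: v_def)
    then obtain i j where ij: "i < r" "j < r" "a = v i" "b = v j" by blast
    then have "i \<noteq> j" using ab by auto
    then show ?thesis using le[of i j] le[of j i] ij sw[of a b] by (cases "i < j") auto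
  qed
  have Bpos: "B > 0" using B by simp
  then have wpos: "B ^ k > 0" for k by simp
  obtain \<phi> where \<phi>: "\<phi> \<in> \<Phi> r" "inj_on (\<lambda>i. y (\<phi> i)) {..<r}"
      "subdegree (contact_prod r (\<lambda>k. B ^ k) (\<lambda>i. y (\<phi> i))) = min_order (\<lambda>\<phi>. contact_prod r (\<lambda>k. B ^ k) (\<lambda>i. y (\<phi> i))) (\<Phi> r)"
    using attained[of "\<lambda>k. B ^ k" y] wpos r by auto
  obtain \<phi>' where \<phi>': "\<phi>' \<in> \<Phi> r" "inj_on (\<lambda>i. y' (\<phi>' i)) {..<r}"
      "subdegree (contact_prod r (\<lambda>k. B ^ k) (\<lambda>i. y' (\<phi>' i))) = min_order (\<lambda>\<phi>. contact_prod r (\<lambda>k. B ^ k) (\<lambda>i. y' (\<phi> i))) (\<Phi> r)"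
    using attained[of "\<lambda>k. B ^ k" y'] wpos cy' by auto
  have moB: "min_order (\<lambda>\<phi>. contact_prod r (\<lambda>k. B ^ k) (\<lambda>i. y' (\<phi> i))) (\<Phi> r)
      = min_order (\<lambda>\<phi>. contact_prod r (\<lambda>k. B ^ k) (\<lambda>i. y (\<phi> i))) (\<Phi> r)"
  proof -
    have "\<exists>\<phi>\<in>\<Phi> r. contact_prod r (\<lambda>k. B ^ k) (\<lambda>i. y (\<phi> i)) \<noteq> 0" using ex'[of "\<lambda>k. B ^ k" r y] wpos r by simp
    moreover have "same_order (\<Sum>\<phi>\<in>\<Phi> r. contact_prod r (\<lambda>k. B ^ k) (\<lambda>i. y (\<phi> i)) ^ l) (\<Sum>\<phi>\<in>\<Phi> r. contact_prod r (\<lambda>k. B ^ k) (\<lambda>i. y' (\<phi> i)) ^ l)"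
      if "l \<in> {1..card (\<Phi> r)}" for l
      using two[OF that] by (simp add: contact_sum_def \<Phi>_def)
    ultimately show ?thesis
      using min_order_same[OF fin, of r "\<lambda>\<phi>. contact_prod r (\<lambda>k. B ^ k) (\<lambda>i. y (\<phi> i))" "\<lambda>\<phi>. contact_prod r (\<lambda>k. B ^ k) (\<lambda>i. y' (\<phi> i))"]
      by blast
  qed
  define v v' where "v = (\<lambda>i. y (\<phi> i))" and "v' = (\<lambda>i. y' (\<phi>' i))"
  define d d' where "d k = (if k div r < k mod r then subdegree (v (k div r) - v (k mod r)) else 0)"
    and "d' k = (if k div r < k mod r then subdegree (v' (k div r) - v' (k mod r)) else 0)" for k
  have inj: "inj_on v {..<r}" "inj_on v' {..<r}" using \<phi> \<phi>' by (auto simp: v_def v'_def)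
  have im: "v ` {..<r} = y ` {..<m}" "v' ` {..<r} = y' ` {..<m}"
    using onto[OF \<phi>(1,2)] onto[OF \<phi>'(1,2) cy'] r by (auto simp: v_def v'_def)
  have "(\<Sum>k<r * r. B ^ k * d k) = (\<Sum>k<r * r. B ^ k * d' k)"
    using subdegree_contact_prod[OF inj(1), of "\<lambda>k. B ^ k"] subdegree_contact_prod[OF inj(2), of "\<lambda>k. B ^ k"]
      \<phi>(3) \<phi>'(3) moB by (simp add: d_def d'_def v_def v'_def)
  moreover have "d k < B \<and> d' k < B" if "k < r * r" for k
  proof (cases "k div r < k mod r")
    case True
    have mr: "k mod r < r" using that by (auto intro!: mod_less_divisor gr0I)
    then have "k div r < r" using True by simp
    have "subdegree (v (k div r) - v (k mod r)) < B"
    proof (rule small[of _ y])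
      show "v (k div r) \<in> y ` {..<m}" "v (k mod r) \<in> y ` {..<m}" using mr \<open>k div r < r\<close> by (auto simp flip: im)
      show "v (k div r) \<noteq> v (k mod r)" using inj_onD[OF inj(1), of "k div r" "k mod r"] True mr by auto
    qed (use r B in auto)
    moreover have "subdegree (v' (k div r) - v' (k mod r)) < B"
    proof (rule small[of _ y'])
      show "v' (k div r) \<in> y' ` {..<m}" "v' (k mod r) \<in> y' ` {..<m}" using mr \<open>k div r < r\<close> by (auto simp flip: im)
      show "v' (k div r) \<noteq> v' (k mod r)" using inj_onD[OF inj(2), of "k div r" "k mod r"] True mr by auto
    qed (use cy' B mo in auto)
    ultimately show ?thesis by (simp add: d_def d'_def)
  next
    case False
    then show ?thesis using Bpos by (simp add: d_def d'_def)
  qed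
  ultimately have dd: "d k = d' k" if "k < r * r" for k
    using digits_unique[of "r * r" d B d' k] that by blast
  have lt: "subdegree (v i - v j) = subdegree (v' i - v' j)" if "i < j" "j < r" for i j
  proof -
    define k where "k = i * r + j"
    have k: "k div r = i" "k mod r = j" using that by (auto simp: k_def)
    have "k < Suc i * r" using that by (simp add: k_def)
    also have "\<dots> \<le> r * r" using that by (intro mult_le_mono1) simp
    finally show ?thesis using dd[of k] k that by (simp add: d_def d'_def)
  qed
  have "contact_iso 1 (y ` {..<m}) (y' ` {..<m}) ((\<lambda>i. (v i, v' i)) ` {..<r})"
  proof (rule contact_isoI)
    show "Domain ((\<lambda>i. (v i, v' i)) ` {..<r}) = y ` {..<m}"
      using im(1) by (simp add: Domain_fst image_image)
    show "Range ((\<lambda>i. (v i, v' i)) ` {..<r}) = y' ` {..<m}"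
      using im(2) by (simp add: Range_snd image_image)
  next
    fix x x' z z' assume "(x, x') \<in> (\<lambda>i. (v i, v' i)) ` {..<r}" "(z, z') \<in> (\<lambda>i. (v i, v' i)) ` {..<r}"
    then obtain i j where ij: "i < r" "j < r" "x = v i" "x' = v' i" "z = v j" "z' = v' j" by auto
    show "(x = z) = (x' = z')" using ij inj by (auto simp: inj_on_def)
    show "subdegree (x - z) = subdegree (x' - z')"
    proof (cases i j rule: linorder_cases)
      case greater
      then have "subdegree (v j - v i) = subdegree (v' j - v' i)" using lt ij by blast
      then show ?thesis unfolding ij by (metis sw)
    qed (use lt ij in auto)
  qed auto
  then show "contact_equiv 1 (y ` {..<m}) (y' ` {..<m})" by (auto simp: contact_equiv_def)
qed

section \<open>Generic orders over irreducible sets\<close>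

lemma poly_fun_const: "poly_fun N (\<lambda>z. c)"
  unfolding poly_fun_def by (intro exI[of _ "{\<lambda>_. 0}"] exI[of _ "\<lambda>_. c"]) simp

lemma poly_fun_var:
  assumes "i < N"
  shows "poly_fun N (\<lambda>z. z i)"
proof -
  define e where "e = (\<lambda>j. if j = i then 1 else (0::nat))"
  have "(\<Prod>j<N. z j ^ e j) = z i" for z :: "nat \<Rightarrow> complex"
  proof -
    have "(\<Prod>j<N. z j ^ e j) = (\<Prod>j<N. if j = i then z j else 1)" by (rule prod.cong) (auto simp: e_def)
    then show ?thesis using assms by (simp add: prod.delta)
  qed
  then show ?thesis unfolding poly_fun_def using assms
    by (intro exI[of _ "{e}"] exI[of _ "\<lambda>_. 1"]) (auto simp: e_def)
qed

lemma poly_fun_add: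
  assumes "poly_fun N p" "poly_fun N q"
  shows "poly_fun N (\<lambda>z. p z + q z)"
proof -
  obtain A a where A: "finite A" "\<forall>\<alpha>\<in>A. \<forall>i\<ge>N. \<alpha> i = 0" "p = (\<lambda>z. \<Sum>\<alpha>\<in>A. a \<alpha> * (\<Prod>i<N. z i ^ \<alpha> i))"
    using assms(1) unfolding poly_fun_def by blast
  obtain B b where B: "finite B" "\<forall>\<alpha>\<in>B. \<forall>i\<ge>N. \<alpha> i = 0" "q = (\<lambda>z. \<Sum>\<alpha>\<in>B. b \<alpha> * (\<Prod>i<N. z i ^ \<alpha> i))"
    using assms(2) unfolding poly_fun_def by blast
  define c where "c \<alpha> = (if \<alpha> \<in> A then a \<alpha> else 0) + (if \<alpha> \<in> B then b \<alpha> else 0)" for \<alpha>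
  have "p z + q z = (\<Sum>\<alpha>\<in>A \<union> B. c \<alpha> * (\<Prod>i<N. z i ^ \<alpha> i))" for z
  proof -
    have "(\<Sum>\<alpha>\<in>A. a \<alpha> * (\<Prod>i<N. z i ^ \<alpha> i)) = (\<Sum>\<alpha>\<in>A \<union> B. (if \<alpha> \<in> A then a \<alpha> else 0) * (\<Prod>i<N. z i ^ \<alpha> i))"
      by (rule sum.mono_neutral_cong_left) (use A B in auto)
    moreover have "(\<Sum>\<alpha>\<in>B. b \<alpha> * (\<Prod>i<N. z i ^ \<alpha> i)) = (\<Sum>\<alpha>\<in>A \<union> B. (if \<alpha> \<in> B then b \<alpha> else 0) * (\<Prod>i<N. z i ^ \<alpha> i))"
      by (rule sum.mono_neutral_cong_left) (use A B in auto)
    ultimately show ?thesis unfolding A(3) B(3) by (simp add: c_def distrib_right sum.distrib)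
  qed
  then show ?thesis unfolding poly_fun_def using A B
    by (intro exI[of _ "A \<union> B"] exI[of _ c]) auto
qed

lemma poly_fun_sum: "(\<And>i. i \<in> I \<Longrightarrow> poly_fun N (f i)) \<Longrightarrow> poly_fun N (\<lambda>z. \<Sum>i\<in>I. f i z)"
  by (induction I rule: infinite_finite_induct) (auto intro: poly_fun_add poly_fun_const)

lemma poly_fun_monomial:
  assumes "\<forall>i\<ge>N. \<alpha> i = 0"
  shows "poly_fun N (\<lambda>z. c * (\<Prod>i<N. z i ^ \<alpha> i))"
  unfolding poly_fun_def using assms by (intro exI[of _ "{\<alpha>}"] exI[of _ "\<lambda>_. c"]) auto

lemma poly_fun_mult:
  assumes "poly_fun N p" "poly_fun N q"
  shows "poly_fun N (\<lambda>z. p z * q z)"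
proof -
  obtain A a where A: "finite A" "\<forall>\<alpha>\<in>A. \<forall>i\<ge>N. \<alpha> i = 0" "p = (\<lambda>z. \<Sum>\<alpha>\<in>A. a \<alpha> * (\<Prod>i<N. z i ^ \<alpha> i))"
    using assms(1) unfolding poly_fun_def by blast
  obtain B b where B: "finite B" "\<forall>\<alpha>\<in>B. \<forall>i\<ge>N. \<alpha> i = 0" "q = (\<lambda>z. \<Sum>\<alpha>\<in>B. b \<alpha> * (\<Prod>i<N. z i ^ \<alpha> i))"
    using assms(2) unfolding poly_fun_def by blast
  have eq: "(\<lambda>z. p z * q z) = (\<lambda>z. \<Sum>\<alpha>\<in>A. \<Sum>\<beta>\<in>B. (a \<alpha> * b \<beta>) * (\<Prod>i<N. z i ^ (\<alpha> i + \<beta> i)))"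
    unfolding A(3) B(3) sum_product by (simp add: power_add prod.distrib mult_ac)
  show ?thesis unfolding eq using A B by (intro poly_fun_sum poly_fun_monomial) auto
qed

lemma zclosed_zeros:
  assumes "poly_fun N p"
  shows "zclosed N {z \<in> aff N. p z = 0}"
  unfolding zclosed_def using assms by (intro exI[of _ "{p}"]) auto

lemma zclosed_empty: "zclosed N {}"
  using zclosed_zeros[OF poly_fun_const[of N 1]] by simp

lemma zclosed_Un:
  assumes "zclosed N F" "zclosed N G"
  shows "zclosed N (F \<union> G)"
proof -
  obtain P where P: "\<forall>p\<in>P. poly_fun N p" "F = {z \<in> aff N. \<forall>p\<in>P. p z = 0}" using assms(1) unfolding zclosed_def by blast
  obtain Q where Q: "\<forall>p\<in>Q. poly_fun N p" "G = {z \<in> aff N. \<forall>p\<in>Q. p z = 0}" using assms(2) unfolding zclosed_def by blast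
  define S where "S = (\<lambda>(p, q). \<lambda>z. p z * q z) ` (P \<times> Q)"
  have "F \<union> G = {z \<in> aff N. \<forall>p\<in>S. p z = 0}"
    unfolding P(2) Q(2) S_def by auto
  moreover have "\<forall>p\<in>S. poly_fun N p" using P(1) Q(1) by (auto simp: S_def intro: poly_fun_mult)
  ultimately show ?thesis unfolding zclosed_def by blast
qed

text \<open>The second component of a parameter is the slope \<open>a / b\<close> of the direction of the polar \<open>a f\<^sub>x + b f\<^sub>y\<close>.\<close>

definition param_fun :: "nat \<Rightarrow> ((nat \<Rightarrow> complex) \<times> complex \<Rightarrow> complex) \<Rightarrow> bool" where
  "param_fun N h \<longleftrightarrow> (\<exists>P :: (nat \<Rightarrow> complex) \<Rightarrow> complex poly.
     (\<forall>k. poly_fun N (\<lambda>z. coeff (P z) k)) \<and> (\<forall>z l. h (z, l) = poly (P z) l))"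

lemma param_fun_poly_fun:
  assumes "poly_fun N p"
  shows "param_fun N (\<lambda>s. p (fst s))"
proof -
  have "poly_fun N (\<lambda>z. coeff [:p z:] k)" for k
    using assms by (cases k) (simp_all add: poly_fun_const)
  then show ?thesis unfolding param_fun_def by (intro exI[of _ "\<lambda>z. [:p z:]"]) auto
qed

lemma param_fun_const: "param_fun N (\<lambda>s. c)"
  using param_fun_poly_fun[OF poly_fun_const] by simp

lemma param_fun_slope: "param_fun N snd"
  unfolding param_fun_def by (intro exI[of _ "\<lambda>z. [:0, 1:]"]) (auto intro: poly_fun_const)

lemma param_fun_add:
  assumes "param_fun N g" "param_fun N h"
  shows "param_fun N (\<lambda>s. g s + h s)"
proof -
  obtain P where P: "\<forall>k. poly_fun N (\<lambda>z. coeff (P z) k)" "\<forall>z l. g (z, l) = poly (P z) l"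
    using assms(1) unfolding param_fun_def by blast
  obtain Q where Q: "\<forall>k. poly_fun N (\<lambda>z. coeff (Q z) k)" "\<forall>z l. h (z, l) = poly (Q z) l"
    using assms(2) unfolding param_fun_def by blast
  show ?thesis unfolding param_fun_def using P Q
    by (intro exI[of _ "\<lambda>z. P z + Q z"]) (auto intro: poly_fun_add)
qed

lemma param_fun_mult:
  assumes "param_fun N g" "param_fun N h"
  shows "param_fun N (\<lambda>s. g s * h s)"
proof -
  obtain P where P: "\<forall>k. poly_fun N (\<lambda>z. coeff (P z) k)" "\<forall>z l. g (z, l) = poly (P z) l"
    using assms(1) unfolding param_fun_def by blast
  obtain Q where Q: "\<forall>k. poly_fun N (\<lambda>z. coeff (Q z) k)" "\<forall>z l. h (z, l) = poly (Q z) l"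
    using assms(2) unfolding param_fun_def by blast
  show ?thesis unfolding param_fun_def using P Q
    by (intro exI[of _ "\<lambda>z. P z * Q z"]) (auto simp: coeff_mult intro!: poly_fun_sum poly_fun_mult)
qed

lemma param_fun_sum: "(\<And>i. i \<in> I \<Longrightarrow> param_fun N (f i)) \<Longrightarrow> param_fun N (\<lambda>s. \<Sum>i\<in>I. f i s)"
  by (induction I rule: infinite_finite_induct) (auto intro: param_fun_add param_fun_const)

definition param_fps :: "nat \<Rightarrow> ((nat \<Rightarrow> complex) \<times> complex \<Rightarrow> complex fps) \<Rightarrow> bool" where
  "param_fps N S \<longleftrightarrow> (\<forall>i. param_fun N (\<lambda>s. fps_nth (S s) i))"

lemma param_fps_const: "param_fps N (\<lambda>s. f)"
  by (simp add: param_fps_def param_fun_const)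

lemma param_fps_add: "param_fps N S \<Longrightarrow> param_fps N T \<Longrightarrow> param_fps N (\<lambda>s. S s + T s)"
  by (simp add: param_fps_def param_fun_add)

lemma param_fps_mult: "param_fps N S \<Longrightarrow> param_fps N T \<Longrightarrow> param_fps N (\<lambda>s. S s * T s)"
  by (auto simp: param_fps_def fps_mult_nth intro!: param_fun_sum param_fun_mult)

lemma param_fps_uminus: "param_fps N S \<Longrightarrow> param_fps N (\<lambda>s. - S s)"
  using param_fps_mult[OF param_fps_const[of N "-1"]] by simp

lemma param_fps_diff: "param_fps N S \<Longrightarrow> param_fps N T \<Longrightarrow> param_fps N (\<lambda>s. S s - T s)"
  using param_fps_add[OF _ param_fps_uminus, of N S T] by simp

lemma param_fps_sum: "(\<And>i. i \<in> I \<Longrightarrow> param_fps N (f i)) \<Longrightarrow> param_fps N (\<lambda>s. \<Sum>i\<in>I. f i s)"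
  by (induction I rule: infinite_finite_induct) (auto intro: param_fps_add param_fps_const)

lemma param_fps_prod: "(\<And>i. i \<in> I \<Longrightarrow> param_fps N (f i)) \<Longrightarrow> param_fps N (\<lambda>s. \<Prod>i\<in>I. f i s)"
  by (induction I rule: infinite_finite_induct) (auto intro: param_fps_mult param_fps_const)

lemma param_fps_power: "param_fps N S \<Longrightarrow> param_fps N (\<lambda>s. S s ^ n)"
  by (induction n) (auto intro: param_fps_mult param_fps_const)

lemma param_fps_sum_list: "(\<And>x. x \<in> set xs \<Longrightarrow> param_fps N (f x)) \<Longrightarrow> param_fps N (\<lambda>s. \<Sum>x\<leftarrow>xs. f x s)"
  by (induction xs) (auto intro: param_fps_add param_fps_const)

lemma param_fps_deriv: "param_fps N S \<Longrightarrow> param_fps N (\<lambda>s. fps_deriv (S s))"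
  by (auto simp: param_fps_def intro!: param_fun_mult param_fun_const param_fun_add)

lemma param_fps_newton_psum:
  assumes "\<And>j. param_fps N (\<lambda>s. e s j)"
  shows "param_fps N (\<lambda>s. newton_psum (e s) m k)"
proof (induction k rule: less_induct)
  case (less k)
  show ?case
  proof (cases k)
    case 0
    then show ?thesis by (simp add: param_fps_const)
  next
    case (Suc n)
    show ?thesis unfolding Suc newton_psum.simps
      using less.IH Suc by (intro param_fps_diff param_fps_uminus param_fps_mult param_fps_sum param_fps_const assms) auto
  qed
qed

text \<open>The finite set of exceptional slopes may vary with \<open>z\<close>; this matches the
  finitely many directions that each curve excludes for its general polar.\<close>

definition generic_on :: "nat \<Rightarrow> (nat \<Rightarrow> complex) set \<Rightarrow> ((nat \<Rightarrow> complex) \<times> complex \<Rightarrow> bool) \<Rightarrow> bool" where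
  "generic_on N Z Q \<longleftrightarrow> (\<exists>F. zclosed N F \<and> \<not> Z \<subseteq> F \<and> (\<forall>z\<in>Z - F. finite {l. \<not> Q (z, l)}))"

lemma generic_on_always:
  assumes "Z \<noteq> {}" "\<And>z l. z \<in> Z \<Longrightarrow> Q (z, l)"
  shows "generic_on N Z Q"
  unfolding generic_on_def using assms zclosed_empty by (intro exI[of _ "{}"]) auto

text \<open>Two closed sets that each fail to contain an irreducible \<open>Z\<close> cannot cover
  it together.\<close>

lemma generic_on_conj:
  assumes Z: "zirreducible N Z" and "generic_on N Z Q" "generic_on N Z Q'"
  shows "generic_on N Z (\<lambda>s. Q s \<and> Q' s)"
proof -
  obtain F where F: "zclosed N F" "\<not> Z \<subseteq> F" "\<And>z. z \<in> Z - F \<Longrightarrow> finite {l. \<not> Q (z, l)}"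
    using assms(2) unfolding generic_on_def by blast
  obtain G where G: "zclosed N G" "\<not> Z \<subseteq> G" "\<And>z. z \<in> Z - G \<Longrightarrow> finite {l. \<not> Q' (z, l)}"
    using assms(3) unfolding generic_on_def by blast
  have "\<not> Z \<subseteq> F \<union> G" using Z F G unfolding zirreducible_def by blast
  moreover have "finite {l. \<not> (Q (z, l) \<and> Q' (z, l))}" if "z \<in> Z - (F \<union> G)" for z
  proof -
    have "{l. \<not> (Q (z, l) \<and> Q' (z, l))} = {l. \<not> Q (z, l)} \<union> {l. \<not> Q' (z, l)}" by auto
    then show ?thesis using F(3)[of z] G(3)[of z] that by simp
  qed
  ultimately show ?thesis unfolding generic_on_def using zclosed_Un[OF F(1) G(1)] by blast
qed

lemma generic_on_ball:
  assumes Z: "zirreducible N Z" and "finite I" "\<And>i. i \<in> I \<Longrightarrow> generic_on N Z (Q i)"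
  shows "generic_on N Z (\<lambda>s. \<forall>i\<in>I. Q i s)"
  using assms(2,3)
proof (induction I rule: finite_induct)
  case empty
  then show ?case using Z by (intro generic_on_always) (auto simp: zirreducible_def)
next
  case (insert i I)
  then show ?case using generic_on_conj[OF Z, of "Q i" "\<lambda>s. \<forall>i\<in>I. Q i s"] by simp
qed

text \<open>Take the least exponent whose coefficient does not vanish identically for points of
  \<open>Z\<close> and all slopes. As a polynomial in the slope it has a coefficient that is nonzero
  somewhere on \<open>Z\<close>; off the zero set of that coefficient, only roots of a nonzero
  polynomial are exceptional slopes.\<close>

theorem generic_order:
  assumes Z: "zirreducible N Z" and S: "param_fps N S"
  shows "\<exists>zero d. generic_on N Z (\<lambda>s. (S s = 0 \<longleftrightarrow> zero) \<and> subdegree (S s) = d)"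
proof (cases "\<forall>z\<in>Z. \<forall>l. S (z, l) = 0")
  case True
  then have "generic_on N Z (\<lambda>s. (S s = 0 \<longleftrightarrow> True) \<and> subdegree (S s) = 0)"
    using Z by (intro generic_on_always) (auto simp: zirreducible_def)
  then show ?thesis by blast
next
  case False
  define D where "D = {d. \<exists>z\<in>Z. \<exists>l. fps_nth (S (z, l)) d \<noteq> 0}"
  have "\<exists>d. d \<in> D" using False by (auto simp: D_def fps_eq_iff)
  define d where "d = (LEAST d. d \<in> D)"
  have dD: "d \<in> D" unfolding d_def using \<open>\<exists>d. d \<in> D\<close> by (rule LeastI_ex)
  have low: "fps_nth (S (z, l)) j = 0" if "z \<in> Z" "j < d" for z l j
  proof -
    have "j \<notin> D" using that(2) unfolding d_def by (rule not_less_Least)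
    then show ?thesis using that(1) unfolding D_def by blast
  qed
  have "param_fun N (\<lambda>s. fps_nth (S s) d)" using S by (simp add: param_fps_def)
  then obtain P where P: "\<And>k. poly_fun N (\<lambda>z. coeff (P z) k)" "\<And>z l. fps_nth (S (z, l)) d = poly (P z) l"
    unfolding param_fun_def by blast
  obtain z0 l0 where z0: "z0 \<in> Z" "poly (P z0) l0 \<noteq> 0" using dD P(2) by (auto simp: D_def)
  then have "P z0 \<noteq> 0" by auto
  then obtain k where k: "coeff (P z0) k \<noteq> 0" by (metis leading_coeff_0_iff)
  define F where "F = {z \<in> aff N. coeff (P z) k = 0}"
  have "zclosed N F" unfolding F_def using P(1) by (rule zclosed_zeros)
  moreover have "\<not> Z \<subseteq> F" using z0 k by (auto simp: F_def)
  moreover have "finite {l. \<not> ((S (z, l) = 0 \<longleftrightarrow> False) \<and> subdegree (S (z, l)) = d)}" if z: "z \<in> Z - F" for z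
  proof (rule finite_subset)
    have "P z \<noteq> 0" using z Z by (auto simp: F_def zirreducible_def)
    then show "finite {l. poly (P z) l = 0}" by (rule poly_roots_finite)
    show "{l. \<not> ((S (z, l) = 0 \<longleftrightarrow> False) \<and> subdegree (S (z, l)) = d)} \<subseteq> {l. poly (P z) l = 0}"
    proof (rule subsetI, rule ccontr)
      fix l assume l: "l \<in> {l. \<not> ((S (z, l) = 0 \<longleftrightarrow> False) \<and> subdegree (S (z, l)) = d)}" "l \<notin> {l. poly (P z) l = 0}"
      then have nz: "fps_nth (S (z, l)) d \<noteq> 0" using P(2) by simp
      then have "S (z, l) \<noteq> 0" by auto
      moreover have "subdegree (S (z, l)) = d" using nz low z by (intro subdegreeI) auto
      ultimately show False using l by simp
    qed
  qed
  ultimately have "generic_on N Z (\<lambda>s. (S s = 0 \<longleftrightarrow> False) \<and> subdegree (S s) = d)"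
    unfolding generic_on_def by blast
  then show ?thesis by blast
qed

section \<open>Homeomorphisms from contact data\<close>

definition germ_equiv :: "(complex \<times> complex) set \<Rightarrow> (complex \<times> complex) set \<Rightarrow> bool" where
  "germ_equiv S T \<longleftrightarrow> (\<exists>U V \<phi> \<psi>. open U \<and> open V \<and> (0,0) \<in> U \<and>
     homeomorphism U V \<phi> \<psi> \<and> \<phi> (0,0) = (0,0) \<and> \<phi> ` (U \<inter> S) = V \<inter> T)"

lemma top_equiv_iff_germ_equiv: "top_equiv g h \<longleftrightarrow> germ_equiv {p. g p = 0} {p. h p = 0}"
  by (simp add: top_equiv_def germ_equiv_def)

lemma germ_equiv_local:
  assumes "open V" "(0,0) \<in> V" "V \<inter> S = V \<inter> T"
  shows "germ_equiv S T"
proof -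
  have "homeomorphism V V id id" by (simp add: homeomorphism_def)
  then show ?thesis unfolding germ_equiv_def using assms
    by (intro exI[of _ V] exI[of _ id]) auto
qed

lemma germ_equiv_sym:
  assumes "germ_equiv S T"
  shows "germ_equiv T S"
proof -
  obtain U V \<phi> \<psi> where h: "open U" "open V" "(0,0) \<in> U" "homeomorphism U V \<phi> \<psi>" "\<phi> (0,0) = (0,0)"
    "\<phi> ` (U \<inter> S) = V \<inter> T" using assms unfolding germ_equiv_def by blast
  have inv: "\<psi> (\<phi> p) = p" "\<phi> p \<in> V" if "p \<in> U" for p
    using h(4) that by (auto simp: homeomorphism_def)
  have "(0,0) \<in> V" "\<psi> (0,0) = (0,0)" using inv[OF h(3)] h(5) by auto
  moreover have "\<psi> ` \<phi> ` (U \<inter> S) = (\<lambda>p. p) ` (U \<inter> S)"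
    unfolding image_image by (rule image_cong) (use inv in auto)
  then have "\<psi> ` (V \<inter> T) = U \<inter> S" using h(6) by simp
  ultimately show ?thesis
    unfolding germ_equiv_def using h(1,2) homeomorphism_symD[OF h(4)]
    by (intro exI[of _ V] exI[of _ U] exI[of _ \<psi>] exI[of _ \<phi>] conjI) simp_all
qed

lemma germ_equiv_trans:
  assumes "germ_equiv S T" "germ_equiv T W"
  shows "germ_equiv S W"
proof -
  obtain U V \<phi> \<psi> where h: "open U" "open V" "(0,0) \<in> U" "homeomorphism U V \<phi> \<psi>" "\<phi> (0,0) = (0,0)"
    "\<phi> ` (U \<inter> S) = V \<inter> T" using assms(1) unfolding germ_equiv_def by blast
  obtain U' V' \<phi>' \<psi>' where h': "open U'" "open V'" "(0,0) \<in> U'" "homeomorphism U' V' \<phi>' \<psi>'"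
    "\<phi>' (0,0) = (0,0)" "\<phi>' ` (U' \<inter> T) = V' \<inter> W" using assms(2) unfolding germ_equiv_def by blast
  \<comment> \<open>The image of the first map need not lie in the domain of the second, so both
    maps are cut down to meet in \<open>V \<inter> U'\<close>.\<close>
  define A where "A = U \<inter> \<phi> -` (V \<inter> U')"
  define B where "B = V' \<inter> \<psi>' -` (V \<inter> U')"
  have cont: "continuous_on U \<phi>" "continuous_on V' \<psi>'" using h(4) h'(4) by (auto simp: homeomorphism_def)
  have oA: "open A" unfolding A_def
    using continuous_open_preimage[OF cont(1) h(1), of "V \<inter> U'"] h h' by (simp add: open_Int)
  have oB: "open B" unfolding B_def
    using continuous_open_preimage[OF cont(2) h'(2), of "V \<inter> U'"] h h' by (simp add: open_Int)
  have i: "\<psi> (\<phi> p) = p" "\<phi> p \<in> V" if "p \<in> U" for p using h(4) that by (auto simp: homeomorphism_def)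
  have j: "\<phi> (\<psi> p) = p" "\<psi> p \<in> U" if "p \<in> V" for p using h(4) that by (auto simp: homeomorphism_def)
  have i': "\<psi>' (\<phi>' p) = p" "\<phi>' p \<in> V'" if "p \<in> U'" for p using h'(4) that by (auto simp: homeomorphism_def)
  have j': "\<phi>' (\<psi>' p) = p" "\<psi>' p \<in> U'" if "p \<in> V'" for p using h'(4) that by (auto simp: homeomorphism_def)
  have im1: "\<phi> ` A = V \<inter> U'" 
  proof
    show "V \<inter> U' \<subseteq> \<phi> ` A"
    proof
      fix p assume "p \<in> V \<inter> U'"
      then have "p = \<phi> (\<psi> p)" "\<psi> p \<in> A" using j[of p] by (simp_all add: A_def)
      then show "p \<in> \<phi> ` A" by (rule image_eqI)
    qed
  qed (auto simp: A_def)
  have im2: "\<phi>' ` (V \<inter> U') = B" 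
  proof
    show "B \<subseteq> \<phi>' ` (V \<inter> U')"
    proof
      fix p assume "p \<in> B"
      then have "p = \<phi>' (\<psi>' p)" "\<psi>' p \<in> V \<inter> U'" using j'[of p] by (simp_all add: B_def)
      then show "p \<in> \<phi>' ` (V \<inter> U')" by (rule image_eqI)
    qed
  qed (use i' in \<open>auto simp: B_def\<close>)
  have h1: "homeomorphism A (V \<inter> U') \<phi> \<psi>"
    by (rule homeomorphism_of_subsets[OF h(4) _ subset_refl im1]) (simp add: A_def)
  have h2: "homeomorphism (V \<inter> U') B \<phi>' \<psi>'"
    by (rule homeomorphism_of_subsets[OF h'(4) _ subset_refl im2]) simp
  have hom: "homeomorphism A B (\<phi>' \<circ> \<phi>) (\<psi> \<circ> \<psi>')" using homeomorphism_compose[OF h1 h2] .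
  have "(0,0) \<in> A" using h h' i(2)[OF h(3)] by (auto simp: A_def)
  moreover have "(\<phi>' \<circ> \<phi>) (0,0) = (0,0)" using h h' by simp
  moreover have "(\<phi>' \<circ> \<phi>) ` (A \<inter> S) = B \<inter> W"
  proof -
    have "\<phi> ` (A \<inter> S) = V \<inter> U' \<inter> T"
    proof
      show "\<phi> ` (A \<inter> S) \<subseteq> V \<inter> U' \<inter> T" using h(6) by (auto simp: A_def)
      show "V \<inter> U' \<inter> T \<subseteq> \<phi> ` (A \<inter> S)"
      proof
        fix p assume p: "p \<in> V \<inter> U' \<inter> T"
        then obtain s where "s \<in> U \<inter> S" "p = \<phi> s" using h(6) by blast
        then show "p \<in> \<phi> ` (A \<inter> S)" using p by (auto simp: A_def)
      qed
    qed
    moreover have "\<phi>' ` (V \<inter> U' \<inter> T) = B \<inter> W"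
    proof
      show "\<phi>' ` (V \<inter> U' \<inter> T) \<subseteq> B \<inter> W" using h'(6) im2 by blast
      show "B \<inter> W \<subseteq> \<phi>' ` (V \<inter> U' \<inter> T)"
      proof
        fix p assume p: "p \<in> B \<inter> W"
        then have "p \<in> V' \<inter> W" by (auto simp: B_def)
        then obtain s where s: "s \<in> U' \<inter> T" "p = \<phi>' s" using h'(6) by blast
        then have "s \<in> V" using p i' by (auto simp: B_def)
        then show "p \<in> \<phi>' ` (V \<inter> U' \<inter> T)" using s by auto
      qed
    qed
    ultimately show ?thesis by (metis image_comp)
  qed
  ultimately show ?thesis unfolding germ_equiv_def using oA oB hom
    by (intro exI[of _ A] exI[of _ B] exI[of _ "\<phi>' \<circ> \<phi>"] exI[of _ "\<psi> \<circ> \<psi>'"] conjI)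
qed

section \<open>McShane extension and descent along \<open>x = t ^ L\<close>\<close>

lemma continuous_on_Min_image:
  fixes f :: "'i \<Rightarrow> 'a::topological_space \<Rightarrow> real"
  assumes "finite I" "I \<noteq> {}" "\<And>i. i \<in> I \<Longrightarrow> continuous_on S (f i)"
  shows "continuous_on S (\<lambda>x. Min ((\<lambda>i. f i x) ` I))"
  using assms
proof (induction I rule: finite_ne_induct)
  case (insert i I)
  have "(\<lambda>x. Min ((\<lambda>i. f i x) ` insert i I)) = (\<lambda>x. min (f i x) (Min ((\<lambda>i. f i x) ` I)))"
    using insert by (auto simp: fun_eq_iff)
  then show ?case using insert by (auto intro!: continuous_on_min)
qed simp

lemma Min_image_Lipschitz:
  fixes f g :: "'i \<Rightarrow> real"
  assumes "finite I" "I \<noteq> {}" "\<And>i. i \<in> I \<Longrightarrow> \<bar>f i - g i\<bar> \<le> c"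
  shows "\<bar>Min (f ` I) - Min (g ` I)\<bar> \<le> c"
proof -
  have *: "Min (f ` I) \<le> Min (g ` I) + c" if fg: "\<And>i. i \<in> I \<Longrightarrow> \<bar>f i - g i\<bar> \<le> c" for f g :: "'i \<Rightarrow> real"
  proof -
    have "Min (g ` I) \<in> g ` I" using assms by (intro Min_in) auto
    then obtain i where i: "i \<in> I" "Min (g ` I) = g i" by auto
    have "Min (f ` I) \<le> f i" using assms i by simp
    then show ?thesis using fg[OF i(1)] i by linarith
  qed
  show ?thesis using *[of f g] *[of g f] assms(3) by (simp add: abs_minus_commute abs_le_iff)
qed

text \<open>The Lipschitz bound on the data says that at the \<open>k\<close>-th point no other term
  falls below the \<open>k\<close>-th one, so the extension takes the prescribed value
  there.\<close>

lemma Min_McShane: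
  fixes d :: "'i \<Rightarrow> real" and y :: "'i \<Rightarrow> complex"
  assumes "finite I" "k \<in> I" "\<And>i. i \<in> I \<Longrightarrow> \<bar>d i - d k\<bar> \<le> \<delta> * cmod (y k - y i)"
  shows "Min ((\<lambda>i. d i + \<delta> * cmod (y k - y i)) ` I) = d k"
proof (rule Min_eqI)
  show "d k \<le> v" if "v \<in> (\<lambda>i. d i + \<delta> * cmod (y k - y i)) ` I" for v
    using that assms(3) by force
  show "d k \<in> (\<lambda>i. d i + \<delta> * cmod (y k - y i)) ` I" using assms(2) by force
qed (use assms in auto)

text \<open>Power maps are open by the open mapping theorem. Hence a function that is continuous in
  \<open>t\<close> and invariant under roots of unity is continuous in
  \<open>x = t ^ L\<close>.\<close>

lemma open_map_power_prod:
  fixes W :: "(complex \<times> complex) set"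
  assumes "L > 0" "open W"
  shows "open ((\<lambda>(t, v). (t ^ L, v)) ` W)"
proof (rule openI)
  fix p assume "p \<in> (\<lambda>(t, v). (t ^ L, v)) ` W"
  then obtain t v where tv: "(t, v) \<in> W" "p = (t ^ L, v)" by auto
  obtain A B where AB: "open A" "open B" "(t, v) \<in> A \<times> B" "A \<times> B \<subseteq> W"
    using assms(2) tv(1) by (auto elim!: open_prod_elim)
  have "\<not> (\<lambda>t::complex. t ^ L) constant_on UNIV"
    using assms(1) unfolding constant_on_def by (metis UNIV_I power_one zero_neq_one zero_power)
  then have "open ((\<lambda>t. t ^ L) ` A)"
    using AB by (intro open_mapping_thm[of _ UNIV]) (auto intro!: holomorphic_intros)
  then have "open (((\<lambda>t. t ^ L) ` A) \<times> B)" using AB by (intro open_Times)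
  moreover have "((\<lambda>t. t ^ L) ` A) \<times> B \<subseteq> (\<lambda>(t, v). (t ^ L, v)) ` W" using AB by force
  moreover have "p \<in> ((\<lambda>t. t ^ L) ` A) \<times> B" using AB tv by auto
  ultimately show "\<exists>e>0. ball p e \<subseteq> (\<lambda>(t, v). (t ^ L, v)) ` W"
    by (meson open_contains_ball subset_trans)
qed

lemma complex_root_exists:
  fixes x :: complex
  assumes "L > 0"
  obtains t where "t ^ L = x"
proof (cases "x = 0")
  case True
  then show ?thesis using assms that[of 0] by simp
next
  case False
  have "exp (Ln x / of_nat L) ^ L = exp (of_nat L * (Ln x / of_nat L))" by (simp only: exp_of_nat_mult)
  also have "\<dots> = x" using False assms by simp
  finally show ?thesis using that by blast
qed

lemma power_eq_imp_cis_mult: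
  fixes s t :: complex
  assumes "L > 0" "s ^ L = t ^ L"
  obtains k where "s = cis (2 * pi / L) ^ k * t"
proof (cases "t = 0")
  case True
  then have "s = 0" using assms by (simp add: power_0_left)
  then show ?thesis using True that[of 0] by simp
next
  case False
  then have "(s / t) ^ L = 1" using assms by (simp add: power_divide)
  then obtain k where "s / t = cis (2 * pi * real k / real L)"
    using Complex.bij_betw_roots_unity[of L] assms unfolding bij_betw_def by blast
  also have "\<dots> = cis (2 * pi / L) ^ k" unfolding Complex.DeMoivre by (rule arg_cong[of _ _ cis]) simp
  finally show ?thesis using that False by (simp add: field_simps)
qed

text \<open>Each of \<open>s\<close> and \<open>t\<close> arises from the other by repeated
  rotation, so the one-sided inclusion yields equality.\<close>

lemma rot_invariant_pts:
  fixes P :: "complex \<Rightarrow> 'b set"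
  assumes "L > 0" and inv: "\<And>t. cmod t < r \<Longrightarrow> P (cis (2 * pi / L) * t) \<subseteq> P t"
    and "s ^ L = t ^ L" "cmod t < r"
  shows "P s = P t"
proof -
  let ?w = "cis (2 * pi / L)"
  have w: "cmod ?w = 1" by simp
  have sub: "P (?w ^ k * t) \<subseteq> P t" if "cmod t < r" for k t
  proof (induction k)
    case (Suc k)
    have "P (?w * (?w ^ k * t)) \<subseteq> P (?w ^ k * t)"
      using that by (intro inv) (simp add: norm_mult norm_power)
    then show ?case using Suc by (simp add: mult.assoc)
  qed simp
  have norm: "cmod s = cmod t"
    using assms(1,3) by (metis norm_ge_zero norm_power power_eq_imp_eq_base)
  obtain k where k: "s = ?w ^ k * t" using power_eq_imp_cis_mult[OF assms(1,3)] by blast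
  obtain l where l: "t = ?w ^ l * s" using power_eq_imp_cis_mult[OF assms(1) assms(3)[symmetric]] by blast
  have "P s \<subseteq> P t" using sub[of t k] assms(4) k by simp
  moreover have "P t \<subseteq> P s" using sub[of s l] assms(4) norm l by simp
  ultimately show ?thesis by blast
qed

text \<open>The homeomorphism moves the roots by McShane's formula for Lipschitz extension, which depends only
  on the set of pairs (root, displacement) over a point and hence descends from the \<open>t\<close>-disc to
  the disc of \<open>x = t ^ L\<close>.\<close>

lemma germ_equiv_Lipschitz_displacement:
  fixes y y' :: "'i \<Rightarrow> complex \<Rightarrow> complex"
  assumes I: "finite I" "I \<noteq> {}" and L: "L > 0" and r: "r > 0"
    and cont: "\<And>i. i \<in> I \<Longrightarrow> continuous_on (ball 0 r) (y i)" "\<And>i. i \<in> I \<Longrightarrow> continuous_on (ball 0 r) (y' i)"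
    and zero: "\<And>i. i \<in> I \<Longrightarrow> y i 0 = 0" "\<And>i. i \<in> I \<Longrightarrow> y' i 0 = 0"
    and lip: "\<And>t i j. cmod t < r \<Longrightarrow> i \<in> I \<Longrightarrow> j \<in> I \<Longrightarrow>
       cmod ((y' i t - y i t) - (y' j t - y j t)) \<le> 1/4 * cmod (y i t - y j t)"
    and inv: "\<And>t. cmod t < r \<Longrightarrow>
       (\<lambda>i. (y i (cis (2 * pi / L) * t), y' i (cis (2 * pi / L) * t))) ` I \<subseteq> (\<lambda>i. (y i t, y' i t)) ` I"
    and S: "\<And>t v. cmod t < r \<Longrightarrow> (t ^ L, v) \<in> S \<longleftrightarrow> (\<exists>i\<in>I. v = y i t)"
    and T: "\<And>t v. cmod t < r \<Longrightarrow> (t ^ L, v) \<in> T \<longleftrightarrow> (\<exists>i\<in>I. v = y' i t)"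
  shows "germ_equiv S T"
proof -
  define pts where "pts t = (\<lambda>i. (y i t, y' i t)) ` I" for t
  \<comment> \<open>Real and imaginary parts are extended separately, each with constant 1/4. The
    complex displacement then has constant 1/2, and adding it to the identity remains
    injective.\<close>
  define G where "G \<pi> p v = (\<lambda>(a, b). \<pi> (b - a) + 1/4 * cmod (v - a)) ` p"
    for \<pi> :: "complex \<Rightarrow> real" and p and v :: complex
  define H where "H t v = Complex (Min (G Re (pts t) v)) (Min (G Im (pts t) v))" for t v
  have G: "G \<pi> (pts t) v = (\<lambda>i. \<pi> (y' i t - y i t) + 1/4 * cmod (v - y i t)) ` I" for \<pi> t v
    by (simp add: G_def pts_def image_image)
  have Hinv: "H s v = H t v" if "s ^ L = t ^ L" "cmod t < r" for s t v
    using rot_invariant_pts[of L r pts s t] L inv that by (simp add: H_def pts_def)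
  have Hcont: "continuous_on (ball 0 r \<times> UNIV) (\<lambda>(t, v). H t v)"
  proof -
    have c: "continuous_on (ball 0 r \<times> UNIV) (\<lambda>p. y i (fst p))"
      "continuous_on (ball 0 r \<times> UNIV) (\<lambda>p. y' i (fst p))" if "i \<in> I" for i
      using that by (auto intro!: continuous_on_compose2[OF cont(1)] continuous_on_compose2[OF cont(2)] continuous_intros)
    have "continuous_on (ball 0 r \<times> UNIV) (\<lambda>p. Min (G Re (pts (fst p)) (snd p)))"
      "continuous_on (ball 0 r \<times> UNIV) (\<lambda>p. Min (G Im (pts (fst p)) (snd p)))"
      unfolding G using I c by (auto intro!: continuous_on_Min_image continuous_intros)
    then show ?thesis unfolding H_def case_prod_beta Complex_eq by (intro continuous_intros)
  qed
  have Hlip: "cmod (H t v - H t v') \<le> 1/2 * cmod (v - v')" for t v v'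
  proof -
    have b: "\<bar>Min (G \<pi> (pts t) v) - Min (G \<pi> (pts t) v')\<bar> \<le> 1/4 * cmod (v - v')" for \<pi>
      unfolding G
    proof (rule Min_image_Lipschitz[OF I])
      fix i
      have "\<bar>cmod (v - y i t) - cmod (v' - y i t)\<bar> \<le> cmod (v - v')"
        by (metis norm_triangle_ineq3 diff_diff_eq2 diff_add_cancel)
      then show "\<bar>\<pi> (y' i t - y i t) + 1/4 * cmod (v - y i t) - (\<pi> (y' i t - y i t) + 1/4 * cmod (v' - y i t))\<bar>
          \<le> 1/4 * cmod (v - v')" by argo
    qed
    have "cmod (H t v - H t v') \<le> \<bar>Re (H t v - H t v')\<bar> + \<bar>Im (H t v - H t v')\<bar>" by (rule cmod_le)
    then show ?thesis using b[of Re] b[of Im] by (simp add: H_def)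
  qed
  have Hroot: "H t (y k t) = y' k t - y k t" if "k \<in> I" "cmod t < r" for k t
  proof -
    have "Min (G \<pi> (pts t) (y k t)) = \<pi> (y' k t - y k t)" if \<pi>: "\<pi> = Re \<or> \<pi> = Im" for \<pi>
      unfolding G
    proof (rule Min_McShane[OF I(1) \<open>k \<in> I\<close>])
      fix i assume "i \<in> I"
      have "\<bar>\<pi> (y' i t - y i t) - \<pi> (y' k t - y k t)\<bar> \<le> cmod ((y' i t - y i t) - (y' k t - y k t))"
        using \<pi> abs_Re_le_cmod[of "(y' i t - y i t) - (y' k t - y k t)"]
          abs_Im_le_cmod[of "(y' i t - y i t) - (y' k t - y k t)"] by auto
      then show "\<bar>\<pi> (y' i t - y i t) - \<pi> (y' k t - y k t)\<bar> \<le> 1/4 * cmod (y k t - y i t)"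
        using lip[OF \<open>cmod t < r\<close> \<open>i \<in> I\<close> \<open>k \<in> I\<close>] by (simp add: norm_minus_commute)
    qed
    then show ?thesis by (simp add: H_def complex_eq_iff)
  qed
  \<comment> \<open>The root is chosen without any continuity; the value \<open>H (rt x) v\<close>
    does not depend on the choice.\<close>
  define rt where "rt x = (SOME t. t ^ L = x)" for x :: complex
  have rt: "rt x ^ L = x" for x unfolding rt_def
    using someI_ex[of "\<lambda>t. t ^ L = x"] complex_root_exists[OF L, of x] by blast
  have rt_small: "cmod (rt x) < r" if "cmod x < r ^ L" for x
  proof -
    have "cmod (rt x) ^ L < r ^ L" using that rt[of x] by (metis norm_power)
    then show ?thesis using r by (simp add: power_less_imp_less_base)
  qed
  define U where "U = ball (0::complex) (r ^ L) \<times> (UNIV :: complex set)"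
  define K where "K = (\<lambda>(x, v). H (rt x) v)"
  define F where "F = (\<lambda>(x, v). (x, v + K (x, v)))"
  have Kpow: "K (t ^ L, v) = H t v" if "cmod t < r" for t v
    unfolding K_def using Hinv[of "rt (t ^ L)" t v] rt that by simp
  have Usmall: "t ^ L \<in> ball 0 (r ^ L) \<longleftrightarrow> cmod t < r" for t
    using r L power_strict_mono[of "cmod t" r L] power_less_imp_less_base[of "cmod t" L r]
    by (auto simp: norm_power)
  have oU: "open U" by (simp add: U_def open_Times)
  have Kcont: "continuous_on U K"
    unfolding continuous_on_open_vimage[OF oU]
  proof (intro allI impI)
    fix B :: "complex set" assume B: "open B"
    have "K -` B \<inter> U = (\<lambda>(t, v). (t ^ L, v)) ` ((\<lambda>(t, v). H t v) -` B \<inter> ball 0 r \<times> UNIV)"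
    proof (intro equalityI subsetI)
      fix p assume p: "p \<in> K -` B \<inter> U"
      obtain x v where xv: "p = (x, v)" by (cases p)
      have "cmod (rt x) < r" using p xv by (intro rt_small) (simp add: U_def)
      moreover have "H (rt x) v \<in> B" using p xv by (simp add: K_def)
      ultimately show "p \<in> (\<lambda>(t, v). (t ^ L, v)) ` ((\<lambda>(t, v). H t v) -` B \<inter> ball 0 r \<times> UNIV)"
        using rt[of x] xv by (intro image_eqI[of _ _ "(rt x, v)"]) auto
    next
      fix p assume "p \<in> (\<lambda>(t, v). (t ^ L, v)) ` ((\<lambda>(t, v). H t v) -` B \<inter> ball 0 r \<times> UNIV)"
      then obtain t v where "p = (t ^ L, v)" "H t v \<in> B" "cmod t < r" by auto
      then show "p \<in> K -` B \<inter> U" using Kpow Usmall by (simp add: U_def)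
    qed
    moreover have "open ((\<lambda>(t, v). H t v) -` B \<inter> ball 0 r \<times> UNIV)"
      using Hcont B continuous_on_open_vimage[of "ball 0 r \<times> UNIV" "\<lambda>(t, v). H t v"]
      by (simp add: open_Times)
    ultimately show "open (K -` B \<inter> U)" using open_map_power_prod[OF L] by simp
  qed
  have Fcont: "continuous_on U F"
    unfolding F_def case_prod_beta using Kcont by (auto intro!: continuous_intros)
  have Finj: "inj_on F U"
  proof (rule inj_onI)
    fix p q assume "F p = F q"
    then obtain x v v' where pq: "p = (x, v)" "q = (x, v')" and e: "v + H (rt x) v = v' + H (rt x) v'"
      by (cases p; cases q) (auto simp: F_def K_def)
    have "v - v' = H (rt x) v' - H (rt x) v" using e by (simp add: algebra_simps)
    then have "cmod (v - v') \<le> 1/2 * cmod (v - v')" using Hlip[of "rt x" v' v] by (metis norm_minus_commute)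
    then show "p = q" using pq norm_ge_zero[of "v - v'"] by simp
  qed
  obtain \<psi> where \<psi>: "homeomorphism U (F ` U) F \<psi>"
    using invariance_of_domain_homeomorphism[OF oU Fcont _ Finj] by auto
  have oV: "open (F ` U)" using invariance_of_domain_gen[OF oU Fcont Finj] by simp
  have Fy: "F (t ^ L, y i t) = (t ^ L, y' i t)" if "i \<in> I" "cmod t < r" for i t
    using Kpow[of t "y i t"] Hroot[OF that] that by (simp add: F_def)
  have F0: "F (0, 0) = (0, 0)"
  proof -
    obtain i where i: "i \<in> I" using I by auto
    show ?thesis using Fy[OF i, of 0] zero[OF i] r L by (simp add: power_0_left)
  qed
  have "F ` (U \<inter> S) = F ` U \<inter> T"
  proof (intro equalityI subsetI)
    fix p assume "p \<in> F ` (U \<inter> S)"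
    then obtain x v where xv: "(x, v) \<in> U" "(x, v) \<in> S" "p = F (x, v)" by auto
    define t where "t = rt x"
    have t: "x = t ^ L" "cmod t < r" using rt rt_small xv by (auto simp: t_def U_def)
    then obtain i where i: "i \<in> I" "v = y i t" using S xv by auto
    then have "p = (t ^ L, y' i t)" using Fy t xv by simp
    then have "p \<in> T" using T[OF t(2)] i by auto
    then show "p \<in> F ` U \<inter> T" using xv by blast
  next
    fix p assume p: "p \<in> F ` U \<inter> T"
    then obtain x v where xv: "(x, v) \<in> U" "p = F (x, v)" by auto
    define t where "t = rt x"
    have t: "x = t ^ L" "cmod t < r" using rt rt_small xv by (auto simp: t_def U_def)
    obtain v' where p': "p = (t ^ L, v')" using xv t by (simp add: F_def)
    then obtain i where i: "i \<in> I" "v' = y' i t" using T[OF t(2)] p by auto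
    then have "p = F (t ^ L, y i t)" using Fy t p' by simp
    moreover have "(t ^ L, y i t) \<in> U \<inter> S" using S[OF t(2)] i xv t by (auto simp: U_def)
    ultimately show "p \<in> F ` (U \<inter> S)" by blast
  qed
  then show ?thesis
    unfolding germ_equiv_def using oU oV \<psi> F0 r
    by (intro exI[of _ U] exI[of _ "F ` U"] exI[of _ F] exI[of _ \<psi>]) (auto simp: U_def)
qed

lemma eval_fps_rot: "eval_fps (fps_rot w x) t = eval_fps x (w * t)"
  by (simp add: eval_fps_def power_mult_distrib mult_ac)

text \<open>Matched roots need not be close enough for the Lipschitz condition, so the displacement
  lemma is applied only between nearby members of the interpolating family. The germ class is then
  locally constant on a connected parameter set.\<close>

theorem germ_equiv_contact:
  fixes Y Y' :: "complex fps set"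
  assumes Y: "finite Y" "Y \<noteq> {}" and L: "L > 0"
    and e: "contact_equiv (cis (2 * pi / L)) Y Y'"
    and conv: "\<And>x. x \<in> Y \<union> Y' \<Longrightarrow> fps_conv_radius x > 0"
    and zero: "\<And>x. x \<in> Y \<union> Y' \<Longrightarrow> fps_nth x 0 = 0"
    and r0: "r0 > 0"
    and S: "\<And>t v. cmod t < r0 \<Longrightarrow> (t ^ L, v) \<in> S \<longleftrightarrow> (\<exists>x\<in>Y. v = eval_fps x t)"
    and T: "\<And>t v. cmod t < r0 \<Longrightarrow> (t ^ L, v) \<in> T \<longleftrightarrow> (\<exists>x\<in>Y'. v = eval_fps x t)"
  shows "germ_equiv S T"
proof -
  let ?w = "cis (2 * pi / L)"
  obtain R where R: "contact_iso ?w Y Y' R" using e by (auto simp: contact_equiv_def)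
  have fY: "fst ` R = Y" "snd ` R = Y'" using contact_iso_Domain[OF R] contact_iso_Range[OF R]
    by (simp_all add: Domain_fst Range_snd)
  have "inj_on fst R"
    by (rule inj_onI) (use contact_iso_eq[OF R] in \<open>auto simp: prod_eq_iff\<close>)
  then have finR: "finite R" using Y fY finite_imageD by blast
  then have finY': "finite Y'" using fY by auto
  have neR: "R \<noteq> {}" using Y fY by auto
  have inY: "fst p \<in> Y" "snd p \<in> Y'" if "p \<in> R" for p using that fY by auto
  obtain r1 where r1: "r1 > 0" "\<And>x. x \<in> Y \<union> Y' \<Longrightarrow> ereal r1 < fps_conv_radius x"
    using finite_common_conv_radius[of "Y \<union> Y'"] Y finY' conv by auto
  define r where "r = min r0 r1"
  have r: "r > 0" "r \<le> r0" using r0 r1 by (auto simp: r_def)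
  have rad: "ereal (cmod t) < fps_conv_radius x" if "x \<in> Y \<union> Y'" "cmod t < r" for x t
    using r1(2)[OF that(1)] that(2) by (auto simp: r_def intro: less_trans[of _ "ereal r1"])
  have evcont: "continuous_on (ball 0 r) (eval_fps x)" if "x \<in> Y \<union> Y'" for x
    by (rule continuous_on_eval_fps') (use rad[OF that] in \<open>auto intro!: continuous_intros\<close>)
  define y where "y u p t = (1 - u) * eval_fps (fst p) t + u * eval_fps (snd p) t"
    for u :: complex and p t
  define C where "C u = {(t ^ L, y u p t) | t p. cmod t < r \<and> p \<in> R}" for u
  have ycont: "continuous_on (ball 0 r) (y u p)" if "p \<in> R" for u p
    unfolding y_def using inY[OF that] by (intro continuous_intros evcont) auto
  have yzero: "y u p 0 = 0" if "p \<in> R" for u p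
    using inY[OF that] zero by (simp add: y_def eval_fps_at_0)
  have inv: "(\<lambda>p. (y u p (?w * t), y v p (?w * t))) ` R \<subseteq> (\<lambda>p. (y u p t, y v p t)) ` R" for u v t
  proof
    fix z assume "z \<in> (\<lambda>p. (y u p (?w * t), y v p (?w * t))) ` R"
    then obtain p where p: "p \<in> R" "z = (y u p (?w * t), y v p (?w * t))" by auto
    define q where "q = (fps_rot ?w (fst p), fps_rot ?w (snd p))"
    have "q \<in> R" using contact_iso_rot[OF R, of "fst p" "snd p"] p by (simp add: q_def)
    moreover have "z = (y u q t, y v q t)" by (simp add: p y_def q_def eval_fps_rot)
    ultimately show "z \<in> (\<lambda>p. (y u p t, y v p t)) ` R" by blast
  qed
  have C: "(t ^ L, v) \<in> C u \<longleftrightarrow> (\<exists>p\<in>R. v = y u p t)" if t: "cmod t < r" for t v u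
  proof
    assume "(t ^ L, v) \<in> C u"
    then obtain s p where sp: "s ^ L = t ^ L" "v = y u p s" "p \<in> R" by (auto simp: C_def)
    have "(\<lambda>p. (y u p s, y u p s)) ` R = (\<lambda>p. (y u p t, y u p t)) ` R"
      using rot_invariant_pts[of L r "\<lambda>t. (\<lambda>p. (y u p t, y u p t)) ` R" s t] L inv sp(1) t by blast
    then have "(v, v) \<in> (\<lambda>p. (y u p t, y u p t)) ` R" using sp by blast
    then show "\<exists>p\<in>R. v = y u p t" by auto
  qed (use t in \<open>auto simp: C_def\<close>)
  define E where "E p q t = (eval_fps (snd p) t - eval_fps (fst p) t) - (eval_fps (snd q) t - eval_fps (fst q) t)"
    for p q :: "complex fps \<times> complex fps" and t
  define c c' where "c p q = fps_nth (fst p - fst q) (subdegree (fst p - fst q))"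
    and "c' p q = fps_nth (snd p - snd q) (subdegree (fst p - fst q))"
    for p q :: "complex fps \<times> complex fps"
  have cc: "c p q \<noteq> 0" "c' p q \<noteq> 0" if pq: "p \<in> R" "q \<in> R" "p \<noteq> q" for p q
  proof -
    have "fst p \<noteq> fst q \<and> snd p \<noteq> snd q"
      using contact_iso_eq[OF R, of "fst p" "snd p" "fst q" "snd q"] pq by (auto simp: prod_eq_iff)
    moreover have "subdegree (fst p - fst q) = subdegree (snd p - snd q)"
      using contact_iso_subdegree[OF R, of "fst p" "snd p" "fst q" "snd q"] pq by simp
    ultimately show "c p q \<noteq> 0" "c' p q \<noteq> 0"
      unfolding c_def c'_def by (metis nth_subdegree_nonzero right_minus_eq)+
  qed
  \<comment> \<open>For these parameters the leading terms of some interpolated difference cancel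
    and its contact is lost. Each pair excludes at most one value, and 0 and 1 are never excluded,
    since \<open>c\<close> and \<open>c'\<close> are nonzero.\<close>
  define B where "B = (\<Union>p\<in>R. \<Union>q\<in>R - {p}. {u. (1 - u) * c p q + u * c' p q = 0})"
  have finB: "finite B"
    unfolding B_def
  proof (intro finite_UN_I)
    fix p q assume pq: "p \<in> R" "q \<in> R - {p}"
    have "{u. (1 - u) * c p q + u * c' p q = 0} \<subseteq> {c p q / (c p q - c' p q)}"
    proof
      fix u assume "u \<in> {u. (1 - u) * c p q + u * c' p q = 0}"
      then have *: "u * (c p q - c' p q) = c p q" by (simp add: algebra_simps)
      then have "c p q - c' p q \<noteq> 0" using cc(1)[of p q] pq by auto
      then show "u \<in> {c p q / (c p q - c' p q)}" using * by (simp add: field_simps)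
    qed
    then show "finite {u. (1 - u) * c p q + u * c' p q = 0}" using finite_subset by blast
  qed (use finR in auto)
  have conn: "connected (UNIV - B)"
    using connected_open_delete_finite[of "UNIV :: complex set" B] finB convex_connected[OF convex_UNIV] by simp
  \<comment> \<open>\<open>E p q\<close> is the derivative in \<open>u\<close> of the difference of
    two interpolated roots. It shares the factor \<open>t ^ d\<close> with that difference, whose
    cofactor \<open>Q\<close> is nonzero at 0, so the ratio is bounded near 0.\<close>
  have bound: "\<exists>K\<ge>0. eventually (\<lambda>t. cmod (E p q t) \<le> K * cmod (y u p t - y u q t)) (nhds 0)"
    if pq: "p \<in> R" "q \<in> R" and u: "u \<notin> B" for p q u
  proof (cases "p = q")
    case True
    then show ?thesis by (intro exI[of _ 0]) (simp add: E_def)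
  next
    case False
    define d where "d = subdegree (fst p - fst q)"
    have d': "d = subdegree (snd p - snd q)"
      using contact_iso_subdegree[OF R, of "fst p" "snd p" "fst q" "snd q"] pq by (simp add: d_def)
    define X X' where "X = fps_shift d (fst p - fst q)" and "X' = fps_shift d (snd p - snd q)"
    have radd: "ereal r \<le> fps_conv_radius (a - b)" if "a \<in> Y \<union> Y'" "b \<in> Y \<union> Y'" for a b
    proof -
      have "ereal r \<le> min (fps_conv_radius a) (fps_conv_radius b)"
        using r1(2)[OF that(1)] r1(2)[OF that(2)]
        by (auto simp: r_def min_def le_less intro: less_trans[of _ "ereal r1"] le_less_trans[of _ "ereal r1"])
      then show ?thesis using fps_conv_radius_diff[of a b] by (rule order_trans)
    qed
    have ev: "eval_fps a t - eval_fps b t = t ^ d * eval_fps (fps_shift d (a - b)) t"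
      if ab: "a \<in> Y \<union> Y'" "b \<in> Y \<union> Y'" and d: "d = subdegree (a - b)" and t: "cmod t < r" for a b t
    proof -
      have "eval_fps (fps_shift d (a - b)) t = (if t = 0 then fps_nth (a - b) d else eval_fps (a - b) t / t ^ d)"
        by (rule eval_fps_shift) (use d radd[OF ab] t in \<open>auto intro: less_le_trans[of _ "ereal r"]\<close>)
      moreover have "eval_fps (a - b) t = eval_fps a t - eval_fps b t"
        by (rule eval_fps_diff) (use rad ab t in auto)
      moreover have "eval_fps (a - b) 0 = 0 ^ d * fps_nth (a - b) d"
      proof (cases "d = 0")
        case False
        then have "fps_nth (a - b) 0 = 0" using d by (intro nth_less_subdegree_zero) simp
        then show ?thesis using False by (simp add: eval_fps_at_0)
      qed (simp add: eval_fps_at_0)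
      ultimately show ?thesis by auto
    qed
    define Q where "Q t = (1 - u) * eval_fps X t + u * eval_fps X' t" for t
    have X0: "eval_fps X 0 = c p q" "eval_fps X' 0 = c' p q"
      by (simp_all add: X_def X'_def eval_fps_at_0 c_def c'_def d_def)
    have "u \<notin> {u. (1 - u) * c p q + u * c' p q = 0}"
    proof
      assume "u \<in> {u. (1 - u) * c p q + u * c' p q = 0}"
      then have "u \<in> B" unfolding B_def using pq False by (intro UN_I[of p] UN_I[of q]) auto
      then show False using u by simp
    qed
    then have "Q 0 \<noteq> 0" by (simp add: Q_def X0)
    have "ereal 0 < fps_conv_radius X" "ereal 0 < fps_conv_radius X'"
      using less_le_trans[of "ereal 0" "ereal r", OF _ radd[of "fst p" "fst q"]]
        less_le_trans[of "ereal 0" "ereal r", OF _ radd[of "snd p" "snd q"]] inY[OF pq(1)] inY[OF pq(2)] r(1)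
      by (simp_all add: X_def X'_def)
    then have contX: "isCont (eval_fps X) 0" "isCont (eval_fps X') 0"
      by (metis continuous_eval_fps norm_zero)+
    then have "isCont Q 0" unfolding Q_def by (intro isCont_add isCont_mult continuous_const)
    then have "isCont (\<lambda>t. (eval_fps X' t - eval_fps X t) / Q t) 0"
      using contX \<open>Q 0 \<noteq> 0\<close> by (intro isCont_divide isCont_diff)
    then have lim: "((\<lambda>t. cmod ((eval_fps X' t - eval_fps X t) / Q t)) \<longlongrightarrow> cmod ((eval_fps X' 0 - eval_fps X 0) / Q 0)) (nhds 0)"
      by (intro tendsto_norm) (simp add: continuous_within tendsto_nhds_iff)
    define K where "K = cmod ((eval_fps X' 0 - eval_fps X 0) / Q 0) + 1"
    have "eventually (\<lambda>t. cmod ((eval_fps X' t - eval_fps X t) / Q t) < K) (nhds 0)"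
      using order_tendstoD(2)[OF lim, of K] by (simp add: K_def)
    moreover have "(Q \<longlongrightarrow> Q 0) (nhds 0)" using \<open>isCont Q 0\<close> by (simp add: continuous_within tendsto_nhds_iff)
    then have "eventually (\<lambda>t. Q t \<noteq> 0) (nhds 0)" using \<open>Q 0 \<noteq> 0\<close> by (rule tendsto_imp_eventually_ne)
    moreover have "eventually (\<lambda>t. t \<in> ball 0 r) (nhds (0::complex))"
      using r by (intro eventually_nhds_in_open) auto
    ultimately have "eventually (\<lambda>t. cmod (E p q t) \<le> K * cmod (y u p t - y u q t)) (nhds 0)"
    proof eventually_elim
      case (elim t)
      have t: "cmod t < r" using elim by simp
      have e1: "eval_fps (fst p) t - eval_fps (fst q) t = t ^ d * eval_fps X t"
        unfolding X_def by (rule ev) (use inY pq d_def t in auto)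
      have e2: "eval_fps (snd p) t - eval_fps (snd q) t = t ^ d * eval_fps X' t"
        unfolding X'_def by (rule ev) (use inY pq d' t in auto)
      have "E p q t = (eval_fps (snd p) t - eval_fps (snd q) t) - (eval_fps (fst p) t - eval_fps (fst q) t)"
        by (simp add: E_def)
      then have E: "E p q t = t ^ d * (eval_fps X' t - eval_fps X t)"
        by (simp add: e1 e2 algebra_simps)
      have "y u p t - y u q t = (1 - u) * (eval_fps (fst p) t - eval_fps (fst q) t)
          + u * (eval_fps (snd p) t - eval_fps (snd q) t)" by (simp add: y_def algebra_simps)
      then have yQ: "y u p t - y u q t = t ^ d * Q t" by (simp add: e1 e2 Q_def algebra_simps)
      have "cmod (eval_fps X' t - eval_fps X t) \<le> K * cmod (Q t)"
        using elim by (simp add: norm_divide field_simps)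
      then have "cmod (t ^ d) * cmod (eval_fps X' t - eval_fps X t) \<le> cmod (t ^ d) * (K * cmod (Q t))"
        by (rule mult_left_mono) simp
      then show ?case by (simp add: E yQ norm_mult mult_ac)
    qed
    then show ?thesis by (intro exI[of _ K]) (simp add: K_def)
  qed
  have local: "\<exists>\<epsilon>>0. \<forall>v. dist u v < \<epsilon> \<longrightarrow> germ_equiv (C u) (C v)" if u: "u \<notin> B" for u
  proof -
    have "\<forall>z\<in>R \<times> R. \<exists>K\<ge>0. eventually (\<lambda>t. cmod (E (fst z) (snd z) t) \<le> K * cmod (y u (fst z) t - y u (snd z) t)) (nhds 0)"
    proof
      fix z assume "z \<in> R \<times> R"
      then show "\<exists>K\<ge>0. eventually (\<lambda>t. cmod (E (fst z) (snd z) t) \<le> K * cmod (y u (fst z) t - y u (snd z) t)) (nhds 0)"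
        by (intro bound u) (simp_all add: mem_Times_iff)
    qed
    from bchoice[OF this] obtain k where k0: "\<forall>z\<in>R \<times> R. 0 \<le> k z \<and>
        eventually (\<lambda>t. cmod (E (fst z) (snd z) t) \<le> k z * cmod (y u (fst z) t - y u (snd z) t)) (nhds 0)" ..
    have k: "k z \<ge> 0"
      "eventually (\<lambda>t. cmod (E (fst z) (snd z) t) \<le> k z * cmod (y u (fst z) t - y u (snd z) t)) (nhds 0)"
      if "z \<in> R \<times> R" for z
      using bspec[OF k0 that] by (rule conjunct1, rule conjunct2)
    define K where "K = sum k (R \<times> R)"
    have kK: "k z \<le> K" if "z \<in> R \<times> R" for z
      unfolding K_def using that k finR by (intro member_le_sum) auto
    have K0: "K \<ge> 0" unfolding K_def using k by (intro sum_nonneg) auto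
    have "eventually (\<lambda>t. \<forall>z\<in>R \<times> R. cmod (E (fst z) (snd z) t) \<le> k z * cmod (y u (fst z) t - y u (snd z) t)) (nhds 0)"
      by (rule eventually_ball_finite) (use finR k(2) in \<open>blast+\<close>)
    then obtain \<rho> where \<rho>: "\<rho> > 0" "\<And>t z. cmod t < \<rho> \<Longrightarrow> z \<in> R \<times> R \<Longrightarrow>
        cmod (E (fst z) (snd z) t) \<le> k z * cmod (y u (fst z) t - y u (snd z) t)"
      unfolding eventually_nhds_metric dist_0_norm by (metis dist_0_norm dist_commute)
    define r' where "r' = min r \<rho>"
    show ?thesis
    \<comment> \<open>Within this distance the displacement has Lipschitz constant at most
      \<open>K / (4 * (K + 1))\<close>, hence at most 1/4; adding 1 keeps the denominator positive
      when \<open>K = 0\<close>.\<close>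
    proof (intro exI[of _ "1 / (4 * (K + 1))"] conjI allI impI)
      show "0 < 1 / (4 * (K + 1))" using K0 by simp
      fix v assume v: "dist u v < 1 / (4 * (K + 1))"
      show "germ_equiv (C u) (C v)"
      proof (rule germ_equiv_Lipschitz_displacement[OF finR neR L])
        show "r' > 0" using r \<rho> by (simp add: r'_def)
        show "continuous_on (ball 0 r') (y u p)" "continuous_on (ball 0 r') (y v p)" if "p \<in> R" for p
          by (rule continuous_on_subset[OF ycont[OF that]], simp add: r'_def subset_ball)+
        show "cmod (y v p t - y u p t - (y v q t - y u q t)) \<le> 1/4 * cmod (y u p t - y u q t)"
          if t: "cmod t < r'" and pq: "p \<in> R" "q \<in> R" for t p q
        proof -
          have "y v p t - y u p t - (y v q t - y u q t) = (v - u) * E p q t"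
            by (simp add: y_def E_def algebra_simps)
          then have "cmod (y v p t - y u p t - (y v q t - y u q t)) = cmod (v - u) * cmod (E p q t)"
            by (simp add: norm_mult)
          also have "\<dots> \<le> 1 / (4 * (K + 1)) * (K * cmod (y u p t - y u q t))"
          proof (rule mult_mono)
            show "cmod (v - u) \<le> 1 / (4 * (K + 1))" using v by (simp add: dist_norm norm_minus_commute)
            have "cmod (E p q t) \<le> k (p, q) * cmod (y u p t - y u q t)"
              using \<rho>(2)[of t "(p, q)"] t pq by (simp add: r'_def)
            also have "\<dots> \<le> K * cmod (y u p t - y u q t)" using kK[of "(p, q)"] pq by (intro mult_right_mono) auto
            finally show "cmod (E p q t) \<le> K * cmod (y u p t - y u q t)" .
          qed (use K0 in auto)
          also have "\<dots> = (K / (K + 1)) * (1/4 * cmod (y u p t - y u q t))" using K0 by (simp add: field_simps)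
          also have "\<dots> \<le> 1 * (1/4 * cmod (y u p t - y u q t))" using K0 by (intro mult_right_mono) auto
          finally show ?thesis by simp
        qed
      qed (use inv C yzero in \<open>auto simp: r'_def\<close>)
    qed
  qed
  have "germ_equiv (C 0) (C 1)"
  proof (rule connected_equivalence_relation[OF conn, of 0 1 "\<lambda>u v. germ_equiv (C u) (C v)"])
    have "\<not> (\<exists>p\<in>R. \<exists>q\<in>R - {p}. c p q = 0)" "\<not> (\<exists>p\<in>R. \<exists>q\<in>R - {p}. c' p q = 0)"
      using cc by blast+
    then show "0 \<in> UNIV - B" "1 \<in> UNIV - B" by (simp_all add: B_def)
    show "\<exists>T. openin (top_of_set (UNIV - B)) T \<and> u \<in> T \<and> (\<forall>v\<in>T. germ_equiv (C u) (C v))" if uB: "u \<in> UNIV - B" for u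
    proof -
      obtain \<epsilon> where "\<epsilon> > 0" "\<And>v. dist u v < \<epsilon> \<Longrightarrow> germ_equiv (C u) (C v)" using local[of u] uB by blast
      then show ?thesis using uB
        by (intro exI[of _ "(UNIV - B) \<inter> ball u \<epsilon>"]) (auto intro: openin_open_Int)
    qed
  qed (use germ_equiv_sym germ_equiv_trans in blast)+
  moreover have nb: "open (ball (0::complex) (r ^ L) \<times> (UNIV :: complex set))" "(0, 0) \<in> ball (0::complex) (r ^ L) \<times> (UNIV :: complex set)"
    using r by (auto intro: open_Times)
  have sm: "\<exists>t. x = t ^ L \<and> cmod t < r" if "x \<in> ball 0 (r ^ L)" for x :: complex
  proof -
    obtain t where t: "t ^ L = x" using complex_root_exists[OF L] by blast
    then have "cmod t ^ L < r ^ L" using that by (auto simp: norm_power)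
    then show ?thesis using t r by (auto simp: power_less_imp_less_base)
  qed
  have "germ_equiv S (C 0)"
  proof (rule germ_equiv_local[OF nb])
    have "(x, v) \<in> S \<longleftrightarrow> (x, v) \<in> C 0" if x: "x \<in> ball 0 (r ^ L)" for x v
    proof -
      obtain t where t: "x = t ^ L" "cmod t < r" using sm[OF x] by blast
      show ?thesis unfolding t(1) using C[OF t(2), of v 0] S[of t v] t(2) r fY by (auto simp: y_def)
    qed
    then show "ball 0 (r ^ L) \<times> UNIV \<inter> S = ball 0 (r ^ L) \<times> UNIV \<inter> C 0" by auto
  qed
  moreover have "germ_equiv (C 1) T"
  proof (rule germ_equiv_local[OF nb])
    have "(x, v) \<in> T \<longleftrightarrow> (x, v) \<in> C 1" if x: "x \<in> ball 0 (r ^ L)" for x v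
    proof -
      obtain t where t: "x = t ^ L" "cmod t < r" using sm[OF x] by blast
      show ?thesis unfolding t(1) using C[OF t(2), of v 1] T[of t v] t(2) r fY by (auto simp: y_def)
    qed
    then show "ball 0 (r ^ L) \<times> UNIV \<inter> C 1 = ball 0 (r ^ L) \<times> UNIV \<inter> T" by auto
  qed
  ultimately show ?thesis using germ_equiv_trans by blast
qed

section \<open>Puiseux roots of the polar\<close>

lemma fps_rot_add: "fps_rot w (x + y) = fps_rot w x + fps_rot w y"
  by (simp add: fps_eq_iff distrib_left)

lemma fps_rot_mult: "fps_rot w (x * y) = fps_rot w x * fps_rot w y"
proof (rule fps_ext)
  fix n
  show "fps_nth (fps_rot w (x * y)) n = fps_nth (fps_rot w x * fps_rot w y) n"
    unfolding fps_nth_rot fps_mult_nth sum_distrib_left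
  proof (rule sum.cong)
    fix i assume "i \<in> {0..n}"
    then have "w ^ n = w ^ i * w ^ (n - i)" by (simp flip: power_add)
    then show "w ^ n * (fps_nth x i * fps_nth y (n - i)) = w ^ i * fps_nth x i * (w ^ (n - i) * fps_nth y (n - i))"
      by (simp only: mult_ac)
  qed simp
qed

lemma fps_rot_0 [simp]: "fps_rot w 0 = 0"
  by (simp add: fps_eq_iff)

lemma fps_rot_1 [simp]: "fps_rot w 1 = 1"
  by (simp add: fps_eq_iff)

lemma fps_rot_power: "fps_rot w (x ^ n) = fps_rot w x ^ n"
  by (induction n) (simp_all add: fps_rot_mult)

lemma fps_rot_sum: "fps_rot w (\<Sum>i\<in>I. f i) = (\<Sum>i\<in>I. fps_rot w (f i))"
  by (induction I rule: infinite_finite_induct) (simp_all add: fps_rot_add)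

lemma fps_rot_compose_X_power:
  assumes "w ^ M = 1"
  shows "fps_rot w (f oo fps_X ^ M) = f oo fps_X ^ M"
proof (rule fps_ext)
  fix n
  show "fps_nth (fps_rot w (f oo fps_X ^ M)) n = fps_nth (f oo fps_X ^ M) n"
    using assms by (auto simp: fps_nth_compose_X_power elim!: dvdE) (simp add: power_mult)
qed

lemma fps_rot_poly_root:
  assumes coeffs: "\<And>k. fps_rot w (coeff P k) = coeff P k" and root: "poly P y = 0"
  shows "poly P (fps_rot w y) = 0"
proof -
  have "poly P (fps_rot w y) = (\<Sum>i\<le>degree P. fps_rot w (coeff P i) * fps_rot w y ^ i)"
    by (simp add: poly_altdef coeffs)
  also have "\<dots> = fps_rot w (poly P y)"
    by (simp add: poly_altdef fps_rot_sum fps_rot_mult fps_rot_power)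
  finally show ?thesis using root by simp
qed

text \<open>The difference of the two monic polynomials has degree below \<open>n\<close> but
  vanishes at \<open>n\<close> distinct points.\<close>

lemma monic_eq_prod_distinct_roots:
  fixes P :: "'a::idom poly"
  assumes "degree P = n" "lead_coeff P = 1" "inj_on y {..<n}" "\<And>i. i < n \<Longrightarrow> poly P (y i) = 0"
  shows "P = (\<Prod>i<n. [:- y i, 1:])"
proof (rule ccontr)
  assume ne: "P \<noteq> (\<Prod>i<n. [:- y i, 1:])"
  define Q where "Q = (\<Prod>i<n. [:- y i, 1:])"
  have Q: "degree Q = n" "coeff Q n = 1" using degree_prod_linear[of "{..<n}" y] by (simp_all add: Q_def)
  have "P - Q \<noteq> 0" using ne by (simp add: Q_def)
  have "degree (P - Q) \<le> n" using assms(1) Q by (intro degree_diff_le) auto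
  moreover have "degree (P - Q) \<noteq> n"
  proof
    assume "degree (P - Q) = n"
    then have "lead_coeff (P - Q) = 0" using assms(1,2) Q by simp
    then show False using \<open>P - Q \<noteq> 0\<close> by (metis leading_coeff_0_iff)
  qed
  ultimately have "degree (P - Q) < n" by simp
  moreover have "n \<le> card {x. poly (P - Q) x = 0}"
  proof -
    have "y ` {..<n} \<subseteq> {x. poly (P - Q) x = 0}" using assms(4) by (auto simp: Q_def poly_prod)
    then have "card (y ` {..<n}) \<le> card {x. poly (P - Q) x = 0}"
      using poly_roots_finite[OF \<open>P - Q \<noteq> 0\<close>] by (intro card_mono)
    then show ?thesis using card_image[OF assms(3)] by simp
  qed
  moreover have "card {x. poly (P - Q) x = 0} \<le> degree (P - Q)"
    using \<open>P - Q \<noteq> 0\<close> by (rule card_poly_roots_bound)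
  ultimately show False by simp
qed

text \<open>Every term of an elementary symmetric function of positive degree contains at least one
  of the \<open>a i\<close>.\<close>

lemma recip_fps_low_order:
  fixes a :: "'i \<Rightarrow> complex fps"
  assumes "finite I" "\<And>i k. i \<in> I \<Longrightarrow> k < v \<Longrightarrow> fps_nth (a i) k = 0" "j > 0" "k < v"
  shows "fps_nth (fps_nth (recip_fps a I) j) k = 0"
  using assms
proof (induction I arbitrary: j k rule: finite_induct)
  case empty
  then show ?case by (simp add: recip_fps_def)
next
  case (insert i I)
  have "recip_fps a (insert i I) = recip_fps a I - fps_const (a i) * (fps_X * recip_fps a I)"
    using insert by (simp add: recip_fps_def algebra_simps)
  then have "fps_nth (recip_fps a (insert i I)) j = fps_nth (recip_fps a I) j - a i * fps_nth (recip_fps a I) (j - 1)"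
    using insert.prems by simp
  moreover have "fps_nth (a i * fps_nth (recip_fps a I) (j - 1)) k = 0"
    unfolding fps_mult_nth using insert.prems by (intro sum.neutral) auto
  ultimately show ?case using insert by simp
qed

section \<open>The Weierstrass polynomial of the branch\<close>

definition branch_fps :: "nat \<Rightarrow> nat \<Rightarrow> (nat \<Rightarrow> complex) \<Rightarrow> complex fps" where
  "branch_fps v1 N z = fps_X ^ v1 + (\<Sum>j<N. fps_const (z j) * fps_X ^ (v1 + 1 + j))"

text \<open>The roots are the conjugates of the branch under the \<open>v0\<close>-th roots of
  unity, which makes the product the candidate for the Weierstrass equation over
  \<open>x = t ^ v0\<close>.\<close>

definition branch_poly :: "nat \<Rightarrow> nat \<Rightarrow> nat \<Rightarrow> (nat \<Rightarrow> complex) \<Rightarrow> complex fps poly" where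
  "branch_poly v0 v1 N z = (\<Prod>k<v0. [:- fps_rot (cis (2 * pi / v0) ^ k) (branch_fps v1 N z), 1:])"

text \<open>Reads a series in \<open>t\<close> as a series in \<open>x = t ^ v0\<close>. Being
  explicit and defined for every \<open>z\<close>, it makes the polynomial dependence on
  \<open>z\<close> visible.\<close>

definition branch_coeff :: "nat \<Rightarrow> nat \<Rightarrow> nat \<Rightarrow> (nat \<Rightarrow> complex) \<Rightarrow> nat \<Rightarrow> complex fps" where
  "branch_coeff v0 v1 N z k = Abs_fps (\<lambda>j. fps_nth (coeff (branch_poly v0 v1 N z) k) (v0 * j))"

lemma byp_has_fps_expansion: "byp v1 N z has_fps_expansion branch_fps v1 N z"
  unfolding byp_def[abs_def] branch_fps_def by (intro fps_expansion_intros)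

lemma byp_rot_invariant:
  assumes "fps_rot w (branch_fps v1 N z) = branch_fps v1 N z"
  shows "byp v1 N z (w * t) = byp v1 N z t"
proof -
  define p where "p = monom 1 v1 + (\<Sum>j<N. monom (z j) (v1 + 1 + j))"
  have "branch_fps v1 N z = fps_of_poly p"
    by (simp add: branch_fps_def p_def fps_of_poly_add fps_of_poly_sum fps_of_poly_monom)
  moreover have "poly p t = byp v1 N z t" for t
    by (simp add: p_def byp_def poly_monom poly_sum)
  ultimately have "eval_fps (branch_fps v1 N z) t = byp v1 N z t" for t by simp
  then show ?thesis using eval_fps_rot[of w "branch_fps v1 N z" t] assms by metis
qed

text \<open>If both coordinates are invariant under multiplication of \<open>t\<close> by \<eta>,
  then so is every function pulled back to the branch, and hence its leading term
  \<open>t ^ i\<close>.\<close>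

lemma value_semigroup_rot:
  assumes \<eta>: "\<eta> ^ v0 = 1" and inv: "\<And>t. Y (\<eta> * t) = Y t" and i: "i \<in> value_semigroup (bx v0) Y"
  shows "\<eta> ^ i = 1"
proof -
  obtain F u where u: "u analytic_on {0}" "u 0 \<noteq> 0" "eventually (\<lambda>t. F (bx v0 t, Y t) = t ^ i * u t) (nhds 0)"
    using i unfolding value_semigroup_def ord0_def by blast
  have tend: "((\<lambda>t. \<eta> * t) \<longlongrightarrow> 0) (nhds 0)"
  proof -
    have "isCont (\<lambda>t. \<eta> * t) 0" by (intro continuous_intros)
    then show ?thesis by (simp add: continuous_within tendsto_nhds_iff)
  qed
  have ev2: "eventually (\<lambda>t. F (bx v0 (\<eta> * t), Y (\<eta> * t)) = (\<eta> * t) ^ i * u (\<eta> * t)) (nhds 0)"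
    using eventually_compose_filterlim[OF u(3) tend] .
  have cont: "isCont u 0" using u(1) by (rule analytic_at_imp_isCont)
  have "eventually (\<lambda>t. t ^ i * u t = (\<eta> * t) ^ i * u (\<eta> * t)) (nhds 0)"
    using u(3) ev2 by eventually_elim (simp add: inv bx_def power_mult_distrib \<eta>)
  then have "eventually (\<lambda>t. t ^ i * u t = (\<eta> * t) ^ i * u (\<eta> * t)) (at 0)"
    by (simp add: eventually_nhds_conv_at)
  then have "eventually (\<lambda>t. u t = \<eta> ^ i * u (\<eta> * t)) (at 0)"
    using eventually_neq_at_within[of 0 0 UNIV]
    by eventually_elim (auto simp: power_mult_distrib)
  then have lim: "((\<lambda>t. \<eta> ^ i * u (\<eta> * t)) \<longlongrightarrow> u 0) (at 0)"
    by (rule Lim_transform_eventually[OF isContD[OF cont]])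
  have "isCont (\<lambda>t. \<eta> ^ i * u (\<eta> * t)) 0"
    using cont by (intro continuous_intros isCont_o2[of 0 "\<lambda>t. \<eta> * t" u]) auto
  from isContD[OF this] have "((\<lambda>t. \<eta> ^ i * u (\<eta> * t)) \<longlongrightarrow> \<eta> ^ i * u 0) (at 0)" by (simp only: mult_zero_right)
  with lim have "u 0 = \<eta> ^ i * u 0" by (rule tendsto_unique[OF trivial_limit_at])
  then show ?thesis using u(2) by simp
qed

text \<open>Coinciding conjugates make the parametrisation invariant under some root of unity
  \<eta>. A cofinite set of values contains some \<open>i\<close> together with
  \<open>Suc i\<close>, and \<open>\<eta> ^ i = \<eta> ^ Suc i = 1\<close> forces
  \<open>\<eta> = 1\<close>.\<close>

lemma branch_conjugates_distinct:
  assumes v0: "v0 > 0" and cof: "finite (UNIV - value_semigroup (bx v0) (byp v1 N z))"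
  shows "inj_on (\<lambda>k. fps_rot (cis (2 * pi / v0) ^ k) (branch_fps v1 N z)) {..<v0}"
proof -
  let ?\<omega> = "cis (2 * pi / v0)"
  have \<omega>: "?\<omega> ^ v0 = 1" "?\<omega> \<noteq> 0" using v0 by (simp_all add: Complex.DeMoivre)
  have lt: False if kl: "k < l" "l < v0" and eq: "fps_rot (?\<omega> ^ k) (branch_fps v1 N z) = fps_rot (?\<omega> ^ l) (branch_fps v1 N z)" for k l
  proof -
    define \<eta> where "\<eta> = ?\<omega> ^ (l - k)"
    have "fps_rot (?\<omega> ^ k) (fps_rot \<eta> (branch_fps v1 N z)) = fps_rot (?\<omega> ^ k) (branch_fps v1 N z)"
      using eq kl by (simp add: fps_rot_rot \<eta>_def flip: power_add)
    then have rot: "fps_rot \<eta> (branch_fps v1 N z) = branch_fps v1 N z"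
      using \<omega> by (simp add: fps_rot_eq_iff)
    have \<eta>: "\<eta> ^ v0 = 1" using \<omega> by (metis \<eta>_def mult.commute power_mult power_one)
    obtain i where i: "i \<in> value_semigroup (bx v0) (byp v1 N z)" "Suc i \<in> value_semigroup (bx v0) (byp v1 N z)"
    proof -
      obtain b where b: "\<forall>x\<in>UNIV - value_semigroup (bx v0) (byp v1 N z). x < b"
        using finite_nat_set_iff_bounded cof by blast
      then have "b \<in> value_semigroup (bx v0) (byp v1 N z)" "Suc b \<in> value_semigroup (bx v0) (byp v1 N z)"
        by (metis DiffI UNIV_I less_irrefl, metis DiffI UNIV_I Suc_lessD less_irrefl)
      then show ?thesis using that by blast
    qed
    have "\<eta> ^ i = 1" "\<eta> ^ Suc i = 1"
      using value_semigroup_rot[where Y = "byp v1 N z", OF \<eta> byp_rot_invariant[OF rot]] i by blast+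
    then have "\<eta> = 1" by simp
    then have eq: "cis (2 * pi * real (l - k) / real v0) = cis (2 * pi * real 0 / real v0)"
      by (simp add: \<eta>_def Complex.DeMoivre mult_ac)
    have inj: "inj_on (\<lambda>k. cis (2 * pi * real k / real v0)) {..<v0}"
      using Complex.bij_betw_roots_unity[OF v0] by (simp add: bij_betw_def)
    have "l - k = 0" by (rule inj_onD[OF inj eq]) (use kl v0 in auto)
    then show False using kl by simp
  qed
  show ?thesis
  proof (rule inj_onI)
    fix k l assume "k \<in> {..<v0}" "l \<in> {..<v0}" "fps_rot (?\<omega> ^ k) (branch_fps v1 N z) = fps_rot (?\<omega> ^ l) (branch_fps v1 N z)"
    then show "k = l" using lt[of k l] lt[of l k] by (cases k l rule: linorder_cases) auto
  qed
qed

text \<open>The equation vanishes on the branch and, having coefficients in \<open>t ^ v0\<close>,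
  on all its conjugates. These are \<open>v0\<close> distinct roots of a monic polynomial of degree
  \<open>v0\<close>, so the coefficients of \<open>f\<close> are determined by
  \<open>z\<close>.\<close>

lemma weierstrass_eq_expansions:
  assumes v0: "v0 > 0" and cof: "finite (UNIV - value_semigroup (bx v0) (byp v1 N z))"
    and f: "weierstrass_eq v0 (bx v0) (byp v1 N z) f"
  obtains a where "\<And>k. k \<le> v0 \<Longrightarrow> a k has_fps_expansion branch_coeff v0 v1 N z k"
    "a v0 = (\<lambda>_. 1)" "f = (\<lambda>(x, y). \<Sum>k\<le>v0. a k x * y ^ k)"
proof -
  obtain a' where a': "\<And>k. k < v0 \<Longrightarrow> a' k analytic_on {0}" "f = (\<lambda>(x, y). y ^ v0 + (\<Sum>k<v0. a' k x * y ^ k))"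
    "eventually (\<lambda>t. f (bx v0 t, byp v1 N z t) = 0) (nhds 0)"
    using f unfolding weierstrass_eq_def by blast
  define a where "a k = (if k = v0 then (\<lambda>x. 1) else a' k)" for k
  define A where "A k = (if k = v0 then 1 else fps_expansion (a' k) 0)" for k
  have aA: "a k has_fps_expansion A k" if "k \<le> v0" for k
    using that a'(1) analytic_at_imp_has_fps_expansion_0[of "a' k"] by (auto simp: a_def A_def)
  have "{..v0} = insert v0 {..<v0}" by auto
  then have fa: "f = (\<lambda>(x, y). \<Sum>k\<le>v0. a k x * y ^ k)"
    unfolding a'(2) by (auto simp: fun_eq_iff a_def)
  define G where "G = (\<Sum>k\<le>v0. monom (A k oo fps_X ^ v0) k)"
  have cG: "coeff G k = (if k \<le> v0 then A k oo fps_X ^ v0 else 0)" for k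
    by (simp add: G_def coeff_sum coeff_monom)
  have dG: "degree G = v0" "lead_coeff G = 1"
  proof -
    have "degree G \<le> v0" by (rule degree_le) (simp add: cG)
    moreover have "v0 \<le> degree G" by (rule le_degree) (simp add: cG A_def)
    ultimately show "degree G = v0" by simp
    then show "lead_coeff G = 1" by (simp add: cG A_def)
  qed
  let ?Y = "branch_fps v1 N z"
  have "(\<lambda>t. \<Sum>k\<le>v0. (a k \<circ> (\<lambda>t. t ^ v0)) t * byp v1 N z t ^ k) has_fps_expansion
      (\<Sum>k\<le>v0. (A k oo fps_X ^ v0) * ?Y ^ k)"
    using v0 aA
    by (intro has_fps_expansion_sum has_fps_expansion_mult has_fps_expansion_power byp_has_fps_expansion
        has_fps_expansion_compose has_fps_expansion_fps_X_power) auto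
  moreover have "eventually (\<lambda>t. (\<Sum>k\<le>v0. (a k \<circ> (\<lambda>t. t ^ v0)) t * byp v1 N z t ^ k) = 0) (nhds 0)"
    using a'(3) unfolding fa by (simp add: bx_def)
  then have "(\<lambda>t. \<Sum>k\<le>v0. (a k \<circ> (\<lambda>t. t ^ v0)) t * byp v1 N z t ^ k) has_fps_expansion 0"
    by (simp add: has_fps_expansion_0_iff)
  ultimately have "(\<Sum>k\<le>v0. (A k oo fps_X ^ v0) * ?Y ^ k) = 0" using fps_expansion_unique_complex by blast
  then have root: "poly G ?Y = 0" by (simp add: poly_altdef dG cG)
  let ?\<omega> = "cis (2 * pi / v0)"
  have \<omega>: "?\<omega> ^ v0 = 1" using v0 by (simp add: Complex.DeMoivre)
  have Geq: "G = branch_poly v0 v1 N z"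
    unfolding branch_poly_def
  proof (rule monic_eq_prod_distinct_roots[OF dG branch_conjugates_distinct[OF v0 cof]])
    fix k
    have "(?\<omega> ^ k) ^ v0 = 1" using \<omega> by (metis mult.commute power_mult power_one)
    then show "poly G (fps_rot (?\<omega> ^ k) ?Y) = 0"
      by (intro fps_rot_poly_root root) (auto simp: cG fps_rot_compose_X_power)
  qed
  then have "A k = branch_coeff v0 v1 N z k" if "k \<le> v0" for k
    using that v0 by (auto simp: branch_coeff_def fps_eq_iff cG fps_nth_compose_X_power simp flip: Geq)
  then have "a k has_fps_expansion branch_coeff v0 v1 N z k" if "k \<le> v0" for k
    using aA[OF that] that by simp
  then show ?thesis by (rule that) (simp_all add: fa a_def)
qed

text \<open>Every term of a lower coefficient has order at least \<open>v1\<close> in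
  \<open>t\<close>, hence order above 1 in \<open>x\<close> as \<open>v1 > v0\<close>. Vanishing at
  exponent 1 ensures that the derivative in \<open>x\<close> adds nothing to a polar at
  \<open>x = 0\<close>.\<close>

lemma branch_coeff_low:
  assumes "v0 > 0" "v1 > v0" "k < v0"
  shows "fps_nth (branch_coeff v0 v1 N z k) 0 = 0" "fps_nth (branch_coeff v0 v1 N z k) 1 = 0"
proof -
  have "fps_nth (branch_fps v1 N z) j = 0" if "j < v1" for j
    using that by (auto simp: branch_fps_def fps_sum_nth intro!: sum.neutral)
  then have "fps_nth (coeff (branch_poly v0 v1 N z) k) j = 0" if "j < v1" for j
    unfolding branch_poly_def using assms that
    by (subst coeff_prod_linear_rev) (auto intro!: recip_fps_low_order[of "{..<v0}" v1])
  then show "fps_nth (branch_coeff v0 v1 N z k) 0 = 0" "fps_nth (branch_coeff v0 v1 N z k) 1 = 0"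
    using assms by (simp_all add: branch_coeff_def)
qed

lemma branch_coeff_top: "v0 > 0 \<Longrightarrow> branch_coeff v0 v1 N z v0 = 1"
  using degree_prod_linear(2)[of "{..<v0}" "\<lambda>k. fps_rot (cis (2 * pi / v0) ^ k) (branch_fps v1 N z)"]
  by (auto simp: branch_coeff_def branch_poly_def fps_eq_iff)

text \<open>Only ring operations are applied to the coefficients of the branch; the roots of unity
  enter as constants.\<close>

lemma param_fps_branch_coeff: "param_fps N (\<lambda>s. branch_coeff v0 v1 N (fst s) k)"
proof -
  have Y: "param_fun N (\<lambda>s. fps_nth (branch_fps v1 N (fst s)) i)" for i
    unfolding branch_fps_def fps_add_nth fps_sum_nth fps_mult_left_const_nth
    by (intro param_fun_add param_fun_sum param_fun_mult param_fun_const param_fun_poly_fun[OF poly_fun_var, of _ N]) auto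
  have "param_fps N (\<lambda>s. coeff (\<Prod>k\<in>K. [:- fps_rot (w k) (branch_fps v1 N (fst s)), 1:]) j)" for K :: "nat set" and w j
  proof (induction K arbitrary: j rule: infinite_finite_induct)
    case (insert i K)
    have rot: "param_fps N (\<lambda>s. - fps_rot (w i) (branch_fps v1 N (fst s)))"
      by (intro param_fps_uminus) (auto simp: param_fps_def intro!: param_fun_mult param_fun_const Y)
    define P where "P s = (\<Prod>k\<in>K. [:- fps_rot (w k) (branch_fps v1 N (fst s)), 1:])" for s :: "(nat \<Rightarrow> complex) \<times> complex"
    have "param_fps N (\<lambda>s. coeff ([:- fps_rot (w i) (branch_fps v1 N (fst s)), 1:] * P s) j)"
    proof (cases j)
      case 0
      then have "coeff ([:- fps_rot (w i) (branch_fps v1 N (fst s)), 1:] * P s) j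
         = - fps_rot (w i) (branch_fps v1 N (fst s)) * coeff (P s) 0" for s by simp
      then show ?thesis using param_fps_mult[OF rot insert.IH[of 0]] by (simp only: P_def)
    next
      case (Suc k)
      then have "coeff ([:- fps_rot (w i) (branch_fps v1 N (fst s)), 1:] * P s) j
         = - fps_rot (w i) (branch_fps v1 N (fst s)) * coeff (P s) j + coeff (P s) k" for s by simp
      then show ?thesis using param_fps_add[OF param_fps_mult[OF rot insert.IH[of j]] insert.IH[of k]] by (simp only: P_def)
    qed
    then show ?case unfolding prod.insert[OF insert.hyps] P_def .
  qed (auto simp: param_fps_const)
  then show ?thesis by (auto simp: param_fps_def branch_coeff_def branch_poly_def)
qed

text \<open>The polar in the direction of slope \<open>l\<close> is \<open>\<Sum>k<v0. polar_coeff k * y ^ k\<close>; multiplying the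
  roots by the leading coefficient makes the polynomial monic without leaving the polynomial functions
  of the parameters.\<close>

definition polar_coeff :: "nat \<Rightarrow> nat \<Rightarrow> nat \<Rightarrow> (nat \<Rightarrow> complex) \<times> complex \<Rightarrow> nat \<Rightarrow> complex fps" where
  "polar_coeff v0 v1 N s k = of_nat (Suc k) * branch_coeff v0 v1 N (fst s) (Suc k)
     + fps_const (snd s) * fps_deriv (branch_coeff v0 v1 N (fst s) k)"

definition polar_monic :: "nat \<Rightarrow> nat \<Rightarrow> nat \<Rightarrow> (nat \<Rightarrow> complex) \<times> complex \<Rightarrow> nat \<Rightarrow> complex fps" where
  "polar_monic v0 v1 N s j = (if j = 0 then 1 else if j < v0 then
     polar_coeff v0 v1 N s (v0 - 1 - j) * polar_coeff v0 v1 N s (v0 - 1) ^ (j - 1) else 0)"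

lemma param_fps_polar_monic: "param_fps N (\<lambda>s. polar_monic v0 v1 N s j)"
proof -
  have "param_fps N (\<lambda>s. fps_const (snd s))"
    unfolding param_fps_def
  proof
    show "param_fun N (\<lambda>s. fps_nth (fps_const (snd s)) i)" for i
      using param_fun_slope[of N] param_fun_const[of N 0] by (cases i) simp_all
  qed
  then have "param_fps N (\<lambda>s. polar_coeff v0 v1 N s k)" for k
    unfolding polar_coeff_def
    by (intro param_fps_add param_fps_mult param_fps_const param_fps_branch_coeff param_fps_deriv)
  then show ?thesis unfolding polar_monic_def
    by (cases "j = 0"; cases "j < v0") (auto intro!: param_fps_const param_fps_mult param_fps_power)
qed

lemma has_fps_expansion_eventually_eq:
  "f has_fps_expansion F \<Longrightarrow> g has_fps_expansion F \<Longrightarrow> eventually (\<lambda>z. f z = g z) (nhds 0)"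
  unfolding has_fps_expansion_def by (auto elim: eventually_elim2)

lemma coeff_prod_linear_insert:
  fixes h :: "'i \<Rightarrow> 'a::comm_ring_1"
  assumes "finite I" "i \<notin> I"
  shows "coeff (\<Prod>j\<in>insert i I. [:- h j, 1:]) k
    = (case k of 0 \<Rightarrow> 0 | Suc l \<Rightarrow> coeff (\<Prod>i\<in>I. [:- h i, 1:]) l) - h i * coeff (\<Prod>i\<in>I. [:- h i, 1:]) k"
  using assms by (cases k) simp_all

lemma has_fps_expansion_coeff_prod_linear:
  fixes g :: "'i \<Rightarrow> complex \<Rightarrow> complex"
  assumes "\<And>i. i \<in> I \<Longrightarrow> g i has_fps_expansion y i"
  shows "(\<lambda>t. coeff (\<Prod>i\<in>I. [:- g i t, 1:]) k) has_fps_expansion coeff (\<Prod>i\<in>I. [:- y i, 1:]) k"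
  using assms
proof (induction I arbitrary: k rule: infinite_finite_induct)
  case (insert i I)
  have IH: "(\<lambda>t. coeff (\<Prod>i\<in>I. [:- g i t, 1:]) k) has_fps_expansion coeff (\<Prod>i\<in>I. [:- y i, 1:]) k" for k
    using insert by blast
  then have "(\<lambda>t. (case k of 0 \<Rightarrow> 0 | Suc l \<Rightarrow> coeff (\<Prod>i\<in>I. [:- g i t, 1:]) l)) has_fps_expansion
      (case k of 0 \<Rightarrow> 0 | Suc l \<Rightarrow> coeff (\<Prod>i\<in>I. [:- y i, 1:]) l)"
    by (cases k) simp_all
  then show ?case unfolding coeff_prod_linear_insert[OF insert.hyps]
    by (intro has_fps_expansion_diff has_fps_expansion_mult IH insert.prems) simp_all
qed (auto simp: has_fps_expansion_const[of "1::complex", simplified])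

text \<open>The series \<open>y\<close> are roots of the monic version, whose symmetric functions
  are polynomial in the parameters. Multiplied by the inverse \<open>v\<close> of the leading
  coefficient they become the roots of the polar. As \<open>v\<close> is a unit and a series in
  \<open>t ^ L\<close>, it changes neither contacts nor the action of rotation.\<close>

theorem polar_puiseux_roots:
  assumes v0: "v0 \<ge> 2" and v1: "v1 > v0" and L: "L > 0"
    and puis: "\<And>G. degree G = v0 - 1 \<Longrightarrow> lead_coeff G = 1 \<Longrightarrow> conv_coeffs G \<Longrightarrow> splits_at L G"
    and cof: "finite (UNIV - value_semigroup (bx v0) (byp v1 N z))"
    and f: "weierstrass_eq v0 (bx v0) (byp v1 N z) f" and b: "b \<noteq> 0"
  obtains y :: "nat \<Rightarrow> complex fps" and v :: "complex fps" and r where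
    "\<And>j. fps_nth (recip_fps y {..<v0 - 1}) j = polar_monic v0 v1 N (z, a / b) j oo fps_X ^ L"
    "fps_nth v 0 \<noteq> 0"
    "\<And>x. x \<in> (*) v ` y ` {..<v0 - 1} \<Longrightarrow> fps_conv_radius x > 0"
    "\<And>x. x \<in> (*) v ` y ` {..<v0 - 1} \<Longrightarrow> fps_nth x 0 = 0"
    "fps_rot (cis (2 * pi / L)) ` (*) v ` y ` {..<v0 - 1} \<subseteq> (*) v ` y ` {..<v0 - 1}"
    "r > 0"
    "\<And>t u. cmod t < r \<Longrightarrow> polar f a b (t ^ L, u) = 0 \<longleftrightarrow> (\<exists>x\<in>(*) v ` y ` {..<v0 - 1}. u = eval_fps x t)"
proof -
  define m where "m = v0 - 1"
  have m: "v0 = Suc m" "m > 0" using v0 by (auto simp: m_def)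
  define s where "s = (z, a / b)"
  define C where "C = polar_coeff v0 v1 N s"
  define E where "E = polar_monic v0 v1 N s"
  have v0pos: "v0 > 0" using v0 by simp
  obtain q where q: "\<And>k. k \<le> v0 \<Longrightarrow> q k has_fps_expansion branch_coeff v0 v1 N z k"
    "q v0 = (\<lambda>_. 1)" "f = (\<lambda>(x, y). \<Sum>k\<le>v0. q k x * y ^ k)"
    using weierstrass_eq_expansions[OF v0pos cof f] by blast
  define B where "B k x = of_nat (Suc k) * q (Suc k) x + a / b * deriv (q k) x" for k x
  have BC: "B k has_fps_expansion C k" if "k \<le> m" for k
    unfolding B_def[abs_def] C_def polar_coeff_def s_def fst_conv snd_conv fps_of_nat[symmetric]
    using that m by (intro has_fps_expansion_add has_fps_expansion_cmult_left has_fps_expansion_deriv q) auto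
  have Ej: "E j = C (m - j) * C m ^ (j - 1)" if "0 < j" "j \<le> m" for j
    using m that by (auto simp: E_def C_def polar_monic_def)
  have Ebig: "E j = 0" if "j > m" for j
    using m that by (auto simp: E_def polar_monic_def)
  define e where "e j x = (if j = 0 then 1 else B (m - j) x * B m x ^ (j - 1))" for j x
  have eE: "e j has_fps_expansion E j" if "j \<le> m" for j
  proof (cases "j = 0")
    case True
    then show ?thesis by (simp add: e_def[abs_def] E_def polar_monic_def)
  next
    case False
    have "(\<lambda>x. B (m - j) x * B m x ^ (j - 1)) has_fps_expansion C (m - j) * C m ^ (j - 1)"
      by (intro has_fps_expansion_mult has_fps_expansion_power BC) auto
    then show ?thesis using False Ej[of j] that by (simp add: e_def[abs_def])
  qed
  \<comment> \<open>For every slope the lower coefficients vanish at 0 while the leading one takes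
    the value \<open>v0\<close> there, so all \<open>m\<close> roots of the polar pass through the
    origin.\<close>
  have C0: "fps_nth (C k) 0 = 0" if "k < m" for k
    using branch_coeff_low[OF v0pos v1, of "Suc k" N z] branch_coeff_low[OF v0pos v1, of k N z] that m
    by (simp add: C_def polar_coeff_def s_def flip: fps_of_nat)
  have Cm: "fps_nth (C m) 0 \<noteq> 0"
    using branch_coeff_low[OF v0pos v1, of m N z] branch_coeff_top[OF v0pos, of v1 N z] m
    by (simp add: C_def polar_coeff_def s_def flip: fps_of_nat) (metis of_nat_Suc of_nat_neq_0)
  \<comment> \<open>\<open>E\<close> is indexed like \<open>recip_fps\<close>, so position
    \<open>k\<close> takes \<open>E (m - k)\<close>. The roots of \<open>G\<close> are those of the
    polar multiplied by its leading coefficient.\<close>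
  define G where "G = (\<Sum>k\<le>m. monom (E (m - k)) k)"
  have cG: "coeff G k = (if k \<le> m then E (m - k) else 0)" for k by (simp add: G_def coeff_sum coeff_monom)
  have E00: "E 0 = 1" by (simp add: E_def polar_monic_def)
  have dG: "degree G = m" "lead_coeff G = 1"
  proof -
    have "degree G \<le> m" by (rule degree_le) (simp add: cG)
    moreover have "m \<le> degree G" by (rule le_degree) (simp add: cG E00)
    ultimately show "degree G = m" by simp
    then show "lead_coeff G = 1" by (simp add: cG E00)
  qed
  have convG: "conv_coeffs G"
    using eE by (auto simp: conv_coeffs_def cG has_fps_expansion_def)
  obtain ys where ys: "\<forall>y\<in>set ys. fps_conv_radius y > 0" "map_poly (\<lambda>f. f oo fps_X ^ L) G = (\<Prod>y\<leftarrow>ys. [:- y, 1:])"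
    using puis[OF _ dG(2) convG] dG(1) unfolding splits_at_def m_def by blast
  define H where "H = map_poly (\<lambda>f. f oo fps_X ^ L) G"
  have cH: "coeff H k = (if k \<le> m then E (m - k) oo fps_X ^ L else 0)" for k
    by (simp add: H_def coeff_map_poly cG)
  have len: "length ys = m"
  proof -
    have "degree H = m"
    proof (rule antisym)
      show "degree H \<le> m" by (rule degree_le) (simp add: cH)
      show "m \<le> degree H" by (rule le_degree) (simp add: cH E00)
    qed
    then show ?thesis using ys(2) by (simp add: H_def degree_prod_list_linear)
  qed
  define y where "y = (!) ys"
  have yc: "fps_conv_radius (y i) > 0" if "i < m" for i using ys(1) that len by (simp add: y_def)
  have H: "H = (\<Prod>i<m. [:- y i, 1:])"
    unfolding H_def ys(2) by (subst prod.list_conv_set_nth) (simp add: y_def len atLeast0LessThan)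
  have rec: "fps_nth (recip_fps y {..<m}) j = E j oo fps_X ^ L" for j
  proof (cases "j \<le> m")
    case True
    then have "fps_nth (recip_fps y {..<m}) j = coeff H (m - j)"
      using coeff_prod_linear[of "{..<m}" y] by (simp add: H)
    then show ?thesis using True by (simp add: cH)
  next
    case False
    then show ?thesis using coeff_prod_linear[of "{..<m}" y] Ebig[of j] by simp
  qed
  have root: "poly H x = 0 \<longleftrightarrow> x \<in> y ` {..<m}" for x
    unfolding H poly_prod by (auto simp: image_iff)
  define cL where "cL = C m oo fps_X ^ L"
  define v where "v = inverse cL"
  have cL0: "fps_nth cL 0 \<noteq> 0" using Cm by (simp add: cL_def)
  have vc: "v * cL = 1" using cL0 by (simp add: v_def inverse_mult_eq_1)
  have v0nz: "fps_nth v 0 \<noteq> 0" using cL0 by (simp add: v_def)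
  have BmL: "(\<lambda>t. B m (t ^ L)) has_fps_expansion cL"
    using has_fps_expansion_compose[OF BC[OF order_refl] has_fps_expansion_fps_X_power[of L]] L
    by (simp add: cL_def o_def fps_X_power_nth)
  have vy: "(\<lambda>t. inverse (B m (t ^ L)) * eval_fps (y i) t) has_fps_expansion v * y i" if "i < m" for i
    unfolding v_def using yc[OF that] cL0
    by (intro has_fps_expansion_mult has_fps_expansion_inverse BmL) (simp_all add: has_fps_expansion_def)
  have vyc: "fps_conv_radius (v * y i) > 0" if "i < m" for i using vy[OF that] by (simp add: has_fps_expansion_def)
  \<comment> \<open>At \<open>t = 0\<close> the monic equation reduces to the vanishing of an
    \<open>m\<close>-th power.\<close>
  have y0: "fps_nth (y i) 0 = 0" if "i < m" for i
  proof -
    have "poly H (y i) = 0" using root that by blast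
    then have "(\<Sum>k\<le>m. (E (m - k) oo fps_X ^ L) * y i ^ k) = 0"
      unfolding poly_altdef using degree_prod_linear(1)[of "{..<m}" y] by (simp add: H[symmetric] cH)
    then have "fps_nth (\<Sum>k\<le>m. (E (m - k) oo fps_X ^ L) * y i ^ k) 0 = 0" by simp
    moreover have "fps_nth (g ^ k) 0 = fps_nth g 0 ^ k" for g :: "complex fps" and k
      by (induction k) (simp_all add: fps_mult_nth_0)
    ultimately have "(\<Sum>k\<le>m. fps_nth (E (m - k)) 0 * fps_nth (y i) 0 ^ k) = 0"
      by (simp add: fps_sum_nth fps_mult_nth_0)
    moreover have "fps_nth (E (m - k)) 0 = (if k = m then 1 else 0)" if "k \<le> m" for k
      using that C0[of k] Ej[of "m - k"] E00 by (auto simp: fps_mult_nth_0)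
    then have "(\<Sum>k\<le>m. fps_nth (E (m - k)) 0 * fps_nth (y i) 0 ^ k) = (\<Sum>k\<le>m. if k = m then fps_nth (y i) 0 ^ m else 0)"
      by (intro sum.cong) auto
    ultimately show ?thesis by simp
  qed
  define w where "w = cis (2 * pi / L)"
  have wL: "w ^ L = 1" using L by (simp add: w_def Complex.DeMoivre)
  have rotv: "fps_rot w v = v"
  proof -
    have "fps_rot w v * cL = 1"
      using arg_cong[OF vc, of "fps_rot w"] fps_rot_compose_X_power[OF wL, of "C m"]
      by (simp add: fps_rot_mult cL_def)
    moreover have "cL \<noteq> 0" using cL0 by auto
    ultimately show ?thesis using vc by (metis mult_cancel_right)
  qed
  have inv: "fps_rot w ` (*) v ` y ` {..<m} \<subseteq> (*) v ` y ` {..<m}"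
  proof
    fix x assume "x \<in> fps_rot w ` (*) v ` y ` {..<m}"
    then obtain i where i: "i < m" "x = fps_rot w (v * y i)" by auto
    have "poly H (fps_rot w (y i)) = 0"
      using root[of "y i"] i(1) by (intro fps_rot_poly_root) (auto simp: cH fps_rot_compose_X_power[OF wL])
    then have "fps_rot w (y i) \<in> y ` {..<m}" using root by blast
    then show "x \<in> (*) v ` y ` {..<m}" unfolding i(2) fps_rot_mult rotv by blast
  qed
  have tend: "((\<lambda>t::complex. t ^ L) \<longlongrightarrow> 0) (nhds 0)"
  proof -
    have "isCont (\<lambda>t::complex. t ^ L) 0" by (intro continuous_intros)
    then show ?thesis using L by (simp add: continuous_within tendsto_nhds_iff power_0_left)
  qed
  have ev1: "eventually (\<lambda>t. \<forall>k\<in>{..m}. coeff (\<Prod>i<m. [:- eval_fps (y i) t, 1:]) k = e (m - k) (t ^ L)) (nhds 0)"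
  proof (rule eventually_ball_finite)
    show "\<forall>k\<in>{..m}. eventually (\<lambda>t. coeff (\<Prod>i<m. [:- eval_fps (y i) t, 1:]) k = e (m - k) (t ^ L)) (nhds 0)"
    proof
      fix k assume k: "k \<in> {..m}"
      have "(\<lambda>t. e (m - k) (t ^ L)) has_fps_expansion (E (m - k) oo fps_X ^ L)"
        using has_fps_expansion_compose[OF eE[of "m - k"] has_fps_expansion_fps_X_power[of L]] L
        by (simp add: o_def fps_X_power_nth)
      then have 1: "(\<lambda>t. e (m - k) (t ^ L)) has_fps_expansion coeff (\<Prod>i<m. [:- y i, 1:]) k"
        using k by (simp add: H[symmetric] cH)
      have "(\<lambda>t. coeff (\<Prod>i<m. [:- eval_fps (y i) t, 1:]) k) has_fps_expansion coeff (\<Prod>i<m. [:- y i, 1:]) k"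
        by (rule has_fps_expansion_coeff_prod_linear) (use yc in \<open>auto simp: has_fps_expansion_def\<close>)
      then show "eventually (\<lambda>t. coeff (\<Prod>i<m. [:- eval_fps (y i) t, 1:]) k = e (m - k) (t ^ L)) (nhds 0)"
        using 1 by (rule has_fps_expansion_eventually_eq)
    qed
  qed simp
  have ev2: "eventually (\<lambda>t. B m (t ^ L) \<noteq> 0) (nhds 0)"
  proof -
    have "isCont (\<lambda>t. B m (t ^ L)) 0"
      by (rule analytic_at_imp_isCont) (rule has_fps_expansion_imp_analytic_0[OF BmL])
    then have "((\<lambda>t. B m (t ^ L)) \<longlongrightarrow> B m (0 ^ L)) (nhds 0)"
      by (simp add: continuous_within tendsto_nhds_iff)
    moreover have "B m (0 ^ L) \<noteq> 0" using has_fps_expansion_imp_0_eq_fps_nth_0[OF BmL] cL0 by simp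
    ultimately show ?thesis by (rule tendsto_imp_eventually_ne)
  qed
  have ev3: "eventually (\<lambda>t. \<forall>i\<in>{..<m}. eval_fps (v * y i) t = inverse (B m (t ^ L)) * eval_fps (y i) t) (nhds 0)"
    by (rule eventually_ball_finite) (use vy in \<open>auto simp: has_fps_expansion_def\<close>)
  \<comment> \<open>Only \<open>x\<close> has to be small: for fixed \<open>x\<close> the polar is a
    polynomial in \<open>u\<close>, so the formula holds for all \<open>u\<close> at once.\<close>
  have ev4': "eventually (\<lambda>x. \<forall>u. polar f a b (x, u) = b * (\<Sum>k\<le>m. B k x * u ^ k)) (nhds 0)"
  proof -
    have "eventually (\<lambda>x. \<forall>k\<in>{..v0}. q k field_differentiable at x) (nhds 0)"
    proof (rule eventually_ball_finite)
      show "\<forall>k\<in>{..v0}. eventually (\<lambda>x. q k field_differentiable at x) (nhds 0)"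
      proof
        fix k assume "k \<in> {..v0}"
        then have "q k analytic_on {0}" using has_fps_expansion_imp_analytic_0[OF q(1)] by simp
        then obtain S where S: "open S" "0 \<in> S" "q k holomorphic_on S" by (auto simp: analytic_at)
        then show "eventually (\<lambda>x. q k field_differentiable at x) (nhds 0)"
          using eventually_nhds_in_open[OF S(1,2)] by (auto elim!: eventually_mono intro: holomorphic_on_imp_differentiable_at)
      qed
    qed simp
    then show ?thesis
    proof eventually_elim
      case (elim x)
      show ?case
      proof
        fix u
        have d: "(q k has_field_derivative deriv (q k) x) (at x)" if "k \<le> v0" for k
          using elim that by (simp add: DERIV_deriv_iff_field_differentiable)
        have "((\<lambda>s. \<Sum>k\<le>v0. q k s * u ^ k) has_field_derivative (\<Sum>k\<le>v0. deriv (q k) x * u ^ k)) (at x)"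
          using d by (intro DERIV_sum DERIV_cmult_right) auto
        then have 1: "deriv (\<lambda>s. f (s, u)) x = (\<Sum>k\<le>v0. deriv (q k) x * u ^ k)"
          unfolding q(3) by (simp add: DERIV_imp_deriv)
        have "((\<lambda>s. \<Sum>k\<le>v0. q k x * s ^ k) has_field_derivative (\<Sum>k\<le>v0. q k x * (of_nat k * u ^ (k - 1)))) (at u)"
          by (intro DERIV_sum DERIV_cmult) (auto intro!: derivative_eq_intros)
        then have 2: "deriv (\<lambda>s. f (x, s)) u = (\<Sum>k\<le>v0. q k x * (of_nat k * u ^ (k - 1)))"
          unfolding q(3) by (simp add: DERIV_imp_deriv)
        have 3: "(\<Sum>k\<le>v0. deriv (q k) x * u ^ k) = (\<Sum>k\<le>m. deriv (q k) x * u ^ k)"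
          unfolding m(1) using q(2) m(1) by simp
        have 4: "(\<Sum>k\<le>v0. q k x * (of_nat k * u ^ (k - 1))) = (\<Sum>k\<le>m. q (Suc k) x * (of_nat (Suc k) * u ^ k))"
          unfolding m(1) by (subst sum.atMost_Suc_shift) simp
        have "(\<Sum>k\<le>m. b * (B k x * u ^ k)) = (\<Sum>k\<le>m. a * (deriv (q k) x * u ^ k) + b * (q (Suc k) x * (of_nat (Suc k) * u ^ k)))"
          using b by (intro sum.cong) (auto simp: B_def field_simps)
        also have "\<dots> = a * (\<Sum>k\<le>m. deriv (q k) x * u ^ k) + b * (\<Sum>k\<le>m. q (Suc k) x * (of_nat (Suc k) * u ^ k))"
          by (simp only: sum.distrib sum_distrib_left)
        also have "\<dots> = polar f a b (x, u)" unfolding polar_def by (simp only: prod.case 1 2 3 4)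
        finally show "polar f a b (x, u) = b * (\<Sum>k\<le>m. B k x * u ^ k)" by (simp only: sum_distrib_left)
      qed
    qed
  qed
  have ev4: "eventually (\<lambda>t. \<forall>u. polar f a b (t ^ L, u) = b * (\<Sum>k\<le>m. B k (t ^ L) * u ^ k)) (nhds 0)"
    using eventually_compose_filterlim[OF ev4' tend] .
  have "eventually (\<lambda>t. \<forall>u. polar f a b (t ^ L, u) = 0 \<longleftrightarrow> (\<exists>x\<in>(*) v ` y ` {..<m}. u = eval_fps x t)) (nhds 0)"
    using ev1 ev2 ev3 ev4
  proof eventually_elim
    case (elim t)
    show ?case
    proof
      fix u
      define x where "x = t ^ L"
      \<comment> \<open>In the rescaled unknown \<open>W\<close> the polar becomes the monic
        polynomial, up to the nonzero factor \<open>B m x ^ (m - 1)\<close> and the constant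
        \<open>b\<close>.\<close>
      define W where "W = B m x * u"
      have "(\<Prod>i<m. W - eval_fps (y i) t) = poly (\<Prod>i<m. [:- eval_fps (y i) t, 1:]) W"
        by (simp add: poly_prod)
      also have "\<dots> = (\<Sum>k\<le>m. e (m - k) x * W ^ k)"
        unfolding poly_altdef using degree_prod_linear(1)[of "{..<m}" "\<lambda>i. eval_fps (y i) t"] elim(1)
        by (simp add: x_def)
      also have "\<dots> = (\<Sum>k\<le>m. B m x ^ (m - 1) * (B k x * u ^ k))"
      proof (rule sum.cong)
        fix k assume "k \<in> {..m}"
        then have k: "k \<le> m" by simp
        show "e (m - k) x * W ^ k = B m x ^ (m - 1) * (B k x * u ^ k)"
        proof (cases "k = m")
          case True
          have "B m x ^ m = B m x ^ (m - 1) * B m x" using m(2) by (metis Suc_diff_1 power_Suc2)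
          then show ?thesis using True by (simp add: e_def W_def power_mult_distrib)
        next
          case False
          then have "B m x ^ (m - 1) = B m x ^ (m - k - 1) * B m x ^ k" using k by (simp flip: power_add)
          then show ?thesis using False k by (simp add: e_def W_def power_mult_distrib)
        qed
      qed simp
      also have "\<dots> = B m x ^ (m - 1) * (\<Sum>k\<le>m. B k x * u ^ k)" by (simp add: sum_distrib_left)
      finally have prod: "(\<Prod>i<m. W - eval_fps (y i) t) = B m x ^ (m - 1) * (\<Sum>k\<le>m. B k x * u ^ k)" .
      have nz: "B m x \<noteq> 0" using elim(2) by (simp add: x_def)
      have "polar f a b (t ^ L, u) = 0 \<longleftrightarrow> (\<Sum>k\<le>m. B k x * u ^ k) = 0" using elim(4) b by (simp add: x_def)
      also have "\<dots> \<longleftrightarrow> (\<Prod>i<m. W - eval_fps (y i) t) = 0" unfolding prod using nz by simp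
      also have "\<dots> \<longleftrightarrow> (\<exists>i<m. W = eval_fps (y i) t)" by auto
      also have "\<dots> \<longleftrightarrow> (\<exists>i<m. u = eval_fps (v * y i) t)"
      proof -
        have "W = eval_fps (y i) t \<longleftrightarrow> u = eval_fps (v * y i) t" if "i < m" for i
        proof -
          have e: "eval_fps (v * y i) t = inverse (B m x) * eval_fps (y i) t" using elim(3) that by (simp add: x_def)
          show ?thesis unfolding e W_def using nz by (auto simp: field_simps)
        qed
        then show ?thesis by blast
      qed
      also have "\<dots> \<longleftrightarrow> (\<exists>x\<in>(*) v ` y ` {..<m}. u = eval_fps x t)" by auto
      finally show "polar f a b (t ^ L, u) = 0 \<longleftrightarrow> (\<exists>x\<in>(*) v ` y ` {..<m}. u = eval_fps x t)" .
    qed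
  qed
  then obtain r where r: "r > 0" "\<And>t u. cmod t < r \<Longrightarrow> polar f a b (t ^ L, u) = 0 \<longleftrightarrow> (\<exists>x\<in>(*) v ` y ` {..<m}. u = eval_fps x t)"
    unfolding eventually_nhds_metric by (auto simp: dist_norm)
  show ?thesis
  proof (rule that[of y v r])
    show "fps_nth (recip_fps y {..<v0 - 1}) j = polar_monic v0 v1 N (z, a / b) j oo fps_X ^ L" for j
      using rec[of j] by (simp add: m_def E_def s_def)
    show "fps_conv_radius x > 0" "fps_nth x 0 = 0" if "x \<in> (*) v ` y ` {..<v0 - 1}" for x
      using that vyc y0 by (auto simp: m_def fps_mult_nth_0)
  qed (use v0nz inv r in \<open>simp_all add: m_def w_def\<close>)
qed

section \<open>Generic constancy\<close>

lemma contact_equiv_unit_mult: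
  assumes "fps_nth v 0 \<noteq> 0"
  shows "contact_equiv 1 X ((*) v ` X)"
proof -
  have v: "v \<noteq> 0" "subdegree v = 0" using assms by auto
  have "contact_iso 1 X ((*) v ` X) ((\<lambda>x. (x, v * x)) ` X)"
  proof (rule contact_isoI)
    fix x x' y y' assume "(x, x') \<in> (\<lambda>x. (x, v * x)) ` X" "(y, y') \<in> (\<lambda>x. (x, v * x)) ` X" "x \<noteq> y"
    then have "x' - y' = v * (x - y)" "x - y \<noteq> 0" by (auto simp: algebra_simps)
    then show "subdegree (x - y) = subdegree (x' - y')" using v by simp
  qed (use v in \<open>auto simp: Domain_fst Range_snd image_image\<close>)
  then show ?thesis by (auto simp: contact_equiv_def)
qed

lemma same_order_compose:
  assumes "M > 0" "same_order f g"
  shows "same_order (f oo fps_X ^ M) (g oo fps_X ^ M)"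
proof -
  have "h oo fps_X ^ M = 0 \<longleftrightarrow> h = 0" for h :: "complex fps"
    using assms(1) by (simp add: fps_compose_eq_0_iff fps_X_power_nth)
  then show ?thesis using assms unfolding same_order_def
    by (cases "f = 0") (auto simp: subdegree_compose_X_power)
qed

lemma newton_psum_compose:
  assumes "M > 0"
  shows "newton_psum (\<lambda>j. e j oo fps_X ^ M) m k = (newton_psum e m k :: complex fps) oo fps_X ^ M"
proof (induction k rule: less_induct)
  case (less k)
  have nat: "of_nat n oo h = (of_nat n :: complex fps)" for n and h :: "complex fps"
    by (simp flip: fps_of_nat)
  show ?case
  proof (cases k)
    case 0
    then show ?thesis by (simp add: nat)
  next
    case (Suc n)
    have "(\<Sum>i\<in>{1..n}. (e i oo fps_X ^ M) * newton_psum (\<lambda>j. e j oo fps_X ^ M) m (Suc n - i))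
       = (\<Sum>i\<in>{1..n}. e i * newton_psum e m (Suc n - i)) oo fps_X ^ M"
      unfolding fps_compose_sum_distrib
      by (rule sum.cong) (use less.IH Suc assms in \<open>auto simp: fps_compose_X_power_mult\<close>)
    then show ?thesis unfolding Suc newton_psum.simps
      using assms by (simp only: fps_compose_sub_distrib fps_compose_uminus fps_compose_X_power_mult nat)
  qed
qed

section \<open>First generators of the semigroup\<close>

lemma conv2_power_fst: "conv2 (\<lambda>(x, y). x ^ k)"
  unfolding conv2_def
proof (intro exI[of _ "\<lambda>(m, n). if (m, n) = (k, 0) then 1 else 0"] exI[of _ "1::real"] conjI allI impI)
  fix x y :: complex
  have "((\<lambda>(m, n). (case (m, n) of (m, n) \<Rightarrow> if (m, n) = (k, 0) then 1 else 0) * x ^ m * y ^ n) has_sum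
      (\<Sum>(m, n)\<in>{(k, 0)}. (case (m, n) of (m, n) \<Rightarrow> if (m, n) = (k, 0) then 1 else 0) * x ^ m * y ^ n)) UNIV"
    by (rule has_sum_finite_neutralI[of "{(k, 0)}"]) (auto split: if_splits)
  then show "((\<lambda>(m, n). (case (m, n) of (m, n) \<Rightarrow> if (m, n) = (k, 0) then 1 else 0) * x ^ m * y ^ n) has_sum
      (case (x, y) of (x, y) \<Rightarrow> x ^ k)) UNIV"
    by simp
qed simp

lemma power_in_value_semigroup: "v0 * k \<in> value_semigroup (bx v0) Y"
proof -
  have "ord0 (\<lambda>t. (case (bx v0 t, Y t) of (x, y) \<Rightarrow> x ^ k)) (v0 * k)"
    unfolding ord0_def by (intro exI[of _ "\<lambda>_. 1"]) (auto simp: bx_def power_mult)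
  then show ?thesis unfolding value_semigroup_def using conv2_power_fst by blast
qed

text \<open>With \<open>v0 = 1\<close> every natural number would be the value of a power of
  \<open>x\<close>. Cofiniteness supplies an element of the form \<open>v0 * c + 1\<close>, not
  divisible by \<open>v0\<close>, so the least element defining \<open>sg_v1\<close> exists.\<close>

lemma semigroup_generators:
  assumes z: "z \<in> eq_class_set \<Gamma>" and cofinite: "finite (UNIV - \<Gamma>)" and singular: "\<Gamma> \<noteq> UNIV"
  shows "sg_v0 \<Gamma> \<ge> 2" "sg_v1 \<Gamma> > sg_v0 \<Gamma>"
proof -
  obtain c where c: "\<forall>x\<in>UNIV - \<Gamma>. x < c" using finite_nat_set_iff_bounded cofinite by blast
  then have big: "n \<in> \<Gamma>" if "n \<ge> c" for n using that by (metis DiffI UNIV_I not_le)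
  have "Suc c \<in> \<Gamma> \<and> Suc c > 0" using big by simp
  then have v0: "sg_v0 \<Gamma> \<in> \<Gamma> \<and> sg_v0 \<Gamma> > 0" unfolding sg_v0_def by (rule LeastI)
  have "sg_v0 \<Gamma> \<noteq> 1"
  proof
    assume "sg_v0 \<Gamma> = 1"
    then have "k \<in> \<Gamma>" for k
      using z power_in_value_semigroup[of 1 k "byp (sg_v1 \<Gamma>) (sg_dim \<Gamma>) z"] by (auto simp: eq_class_set_def)
    then show False using singular by blast
  qed
  then show v02: "sg_v0 \<Gamma> \<ge> 2" using v0 by linarith
  have "sg_v0 \<Gamma> * c + 1 \<ge> c" using v0 by (metis One_nat_def Suc_leI add.commute le_add2 mult_le_mono1 nat_mult_1 trans_le_add1)
  moreover have "\<not> sg_v0 \<Gamma> dvd sg_v0 \<Gamma> * c + 1"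
    using v02 by (metis dvd_add_right_iff dvd_triv_left nat_dvd_1_iff_1 numeral_One numeral_le_iff semiring_norm(69))
  ultimately have "sg_v0 \<Gamma> * c + 1 \<in> \<Gamma> \<and> \<not> sg_v0 \<Gamma> dvd sg_v0 \<Gamma> * c + 1" using big by blast
  then have v1: "sg_v1 \<Gamma> \<in> \<Gamma> \<and> \<not> sg_v0 \<Gamma> dvd sg_v1 \<Gamma>" unfolding sg_v1_def by (rule LeastI)
  then have "sg_v1 \<Gamma> > 0" by (metis dvd_0_right gr0I)
  then have "sg_v0 \<Gamma> \<le> sg_v1 \<Gamma>" using v1 unfolding sg_v0_def by (intro Least_le) simp
  moreover have "sg_v1 \<Gamma> \<noteq> sg_v0 \<Gamma>" using v1 by (metis dvd_refl)
  ultimately show "sg_v1 \<Gamma> > sg_v0 \<Gamma>" by linarith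
qed

text \<open>Excluding the direction \<open>(1, 0)\<close> leaves \<open>b \<noteq> 0\<close>, so
  every other direction has a slope; the slope \<open>l\<close> stands for the direction
  \<open>(l, 1)\<close>.\<close>

lemma general_dirI:
  assumes "finite D" "\<And>a b. b \<noteq> 0 \<Longrightarrow> a / b \<notin> D \<Longrightarrow> P a b"
  shows "general_dir P"
  unfolding general_dir_def
proof (intro exI[of _ "insert (1, 0) ((\<lambda>l. (l, 1)) ` D)"] conjI allI impI)
  fix a b :: complex
  assume h: "(a, b) \<noteq> (0, 0) \<and> (\<forall>(c, d)\<in>insert (1, 0) ((\<lambda>l. (l, 1)) ` D). a * d - b * c \<noteq> 0)"
  then have b: "b \<noteq> 0" by auto
  moreover have "a / b \<notin> D"
  proof
    assume "a / b \<in> D"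
    then have "a * 1 - b * (a / b) \<noteq> 0" using h by blast
    then show False using b by simp
  qed
  ultimately show "P a b" by (rule assms(2))
qed (use assms(1) in auto)

lemma zopen_dense_complement:
  assumes "zirreducible N Z" "zclosed N F" "\<not> Z \<subseteq> F"
  shows "zopen_in N Z (Z - F)" "zdense_in N Z (Z - F)"
proof -
  show "zopen_in N Z (Z - F)" unfolding zopen_in_def using assms(2) by blast
  have "Z \<subseteq> G" if G: "zclosed N G" "Z - F \<subseteq> G" for G
  proof -
    have "Z \<subseteq> F \<union> G" using G(2) by blast
    then show ?thesis using assms G(1) unfolding zirreducible_def by blast
  qed
  then show "zdense_in N Z (Z - F)" unfolding zdense_in_def by blast
qed

theorem mainTheorem1:
  fixes \<Gamma> \<Lambda> :: "nat set" and Z :: "(nat \<Rightarrow> complex) set"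
  assumes branch: "\<exists>X Y. is_branch_param X Y \<and> value_semigroup X Y = \<Gamma>"
    and cofinite: "finite (UNIV - \<Gamma>)"
    and singular: "\<Gamma> \<noteq> UNIV"
    and comp: "zirreducible_component (sg_dim \<Gamma>) (eq_class_set_kahler \<Gamma> \<Lambda>) Z"
  shows "\<exists>U. U \<subseteq> Z \<and> zopen_in (sg_dim \<Gamma>) Z U \<and> zdense_in (sg_dim \<Gamma>) Z U \<and>
     (\<forall>p\<in>U. \<forall>q\<in>U. \<forall>f g.
        weierstrass_eq (sg_v0 \<Gamma>) (bx (sg_v0 \<Gamma>)) (byp (sg_v1 \<Gamma>) (sg_dim \<Gamma>) p) f \<longrightarrow>
        weierstrass_eq (sg_v0 \<Gamma>) (bx (sg_v0 \<Gamma>)) (byp (sg_v1 \<Gamma>) (sg_dim \<Gamma>) q) g \<longrightarrow>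
        same_general_polar_class f g)"
proof -
  define v0 v1 N where "v0 = sg_v0 \<Gamma>" and "v1 = sg_v1 \<Gamma>" and "N = sg_dim \<Gamma>"
  define m where "m = v0 - 1"
  define \<Phi> where "\<Phi> r = {..<r} \<rightarrow>\<^sub>E {..<m}" for r :: nat
  define weq where "weq z f \<longleftrightarrow> weierstrass_eq v0 (bx v0) (byp v1 N z) f" for z f
  have Z: "zirreducible N Z" and ZE: "Z \<subseteq> eq_class_set \<Gamma>"
    using comp by (auto simp: zirreducible_component_def eq_class_set_kahler_def N_def)
  obtain z where "z \<in> Z" using Z by (auto simp: zirreducible_def)
  then have v01: "v0 \<ge> 2" "v1 > v0"
    using semigroup_generators[OF _ cofinite singular] ZE by (auto simp: v0_def v1_def)
  have m: "m > 0" using v01 by (simp add: m_def)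
  have cof: "finite (UNIV - value_semigroup (bx v0) (byp v1 N z))" if "z \<in> Z" for z
  proof -
    have "z \<in> eq_class_set \<Gamma>" using ZE that by blast
    then have "value_semigroup (bx v0) (byp v1 N z) = \<Gamma>"
      unfolding eq_class_set_def v0_def v1_def N_def by simp
    then show ?thesis using cofinite by simp
  qed
  from puiseux[of m] obtain L where L0: "L > 0 \<and> (\<forall>G. degree G = m \<longrightarrow> lead_coeff G = 1 \<longrightarrow> conv_coeffs G \<longrightarrow>
      (\<forall>M>0. L dvd M \<longrightarrow> splits_at M G))" ..
  have L: "L > 0" "\<And>G. degree G = m \<Longrightarrow> lead_coeff G = 1 \<Longrightarrow> conv_coeffs G \<Longrightarrow> splits_at L G"
    using L0 by simp_all
  have roots: "\<exists>y v \<rho>. (\<forall>j. fps_nth (recip_fps y {..<m}) j = polar_monic v0 v1 N (z, a / b) j oo fps_X ^ L) \<and>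
      fps_nth v 0 \<noteq> 0 \<and> (\<forall>x\<in>(*) v ` y ` {..<m}. fps_conv_radius x > 0) \<and>
      (\<forall>x\<in>(*) v ` y ` {..<m}. fps_nth x 0 = 0) \<and>
      fps_rot (cis (2 * pi / L)) ` (*) v ` y ` {..<m} \<subseteq> (*) v ` y ` {..<m} \<and> \<rho> > 0 \<and>
      (\<forall>t u. cmod t < \<rho> \<longrightarrow> (polar f a b (t ^ L, u) = 0 \<longleftrightarrow> (\<exists>x\<in>(*) v ` y ` {..<m}. u = eval_fps x t)))"
    if z: "z \<in> Z" "weq z f" and b: "b \<noteq> 0" for z f a b
  proof -
    have sp: "splits_at L G" if "degree G = v0 - 1" "lead_coeff G = 1" "conv_coeffs G" for G
      using L(2) that by (simp add: m_def)
    show ?thesis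
    proof (rule polar_puiseux_roots[OF v01 L(1) sp cof[OF z(1)] z(2)[unfolded weq_def] b, of a], goal_cases)
      case (4 y v r)
      then show ?case unfolding m_def
        by (intro exI[of _ y] exI[of _ v] exI[of _ r] conjI ballI allI impI)
    qed
  qed
  have "\<forall>c. \<exists>xs :: (int \<times> (nat \<Rightarrow> nat)) list. \<forall>m (y :: nat \<Rightarrow> complex fps).
     contact_sum (fst c) (fst (snd c)) (snd (snd c)) m y = (\<Sum>x\<leftarrow>xs. of_int (fst x) * (\<Prod>i<fst c. \<Sum>j<m. y j ^ snd x i))"
    using contact_sum_power_sums by blast
  from choice[OF this] obtain xs' :: "nat \<times> (nat \<Rightarrow> nat) \<times> nat \<Rightarrow> (int \<times> (nat \<Rightarrow> nat)) list" where xs':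
    "\<forall>c m (y :: nat \<Rightarrow> complex fps).
      contact_sum (fst c) (fst (snd c)) (snd (snd c)) m y = (\<Sum>x\<leftarrow>xs' c. of_int (fst x) * (\<Prod>i<fst c. \<Sum>j<m. y j ^ snd x i))" ..
  \<comment> \<open>The same coefficient lists serve all root configurations, so each contact sum is
    one series \<open>T r w l s\<close> in \<open>x\<close>, polynomial in the parameter
    \<open>s\<close>, followed by the substitution of \<open>t ^ L\<close>.\<close>
  define T where "T r w l s = (\<Sum>x\<leftarrow>xs' (r, w, l). of_int (fst x) * (\<Prod>i<r. newton_psum (polar_monic v0 v1 N s) m (snd x i)))"
    for r w l s
  have T: "contact_sum r w l m y = T r w l s oo fps_X ^ L"
    if "\<And>j. fps_nth (recip_fps y {..<m}) j = polar_monic v0 v1 N s j oo fps_X ^ L" for r w l s y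
  proof -
    have "fps_nth (recip_fps y {..<m}) = (\<lambda>j. polar_monic v0 v1 N s j oo fps_X ^ L)" using that by blast
    then have ps: "(\<Sum>j<m. y j ^ k) = newton_psum (polar_monic v0 v1 N s) m k oo fps_X ^ L" for k
      using power_sum_eq_newton_psum[of "{..<m}" y k] newton_psum_compose[OF L(1)] by simp
    have prod: "(\<Prod>i<r. h i oo fps_X ^ L) = (\<Prod>i<r. h i) oo fps_X ^ L" for h :: "nat \<Rightarrow> complex fps" and r
      by (induction r) (simp_all add: fps_compose_X_power_mult[OF L(1)])
    have int: "of_int c = (of_int c :: complex fps) oo fps_X ^ L" for c
      by (simp flip: fps_of_int)
    have sum: "(\<Sum>x\<leftarrow>xs. h x oo fps_X ^ L) = (\<Sum>x\<leftarrow>xs. h x) oo fps_X ^ L" for h :: "int \<times> (nat \<Rightarrow> nat) \<Rightarrow> complex fps" and xs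
      by (induction xs) (simp_all add: fps_compose_add_distrib)
    have "contact_sum r w l m y = (\<Sum>x\<leftarrow>xs' (r, w, l). of_int (fst x) * (\<Prod>i<r. \<Sum>j<m. y j ^ snd x i))"
      using spec[OF xs', of "(r, w, l)"] by simp
    also have "\<dots> = (\<Sum>x\<leftarrow>xs' (r, w, l). (of_int (fst x) * (\<Prod>i<r. newton_psum (polar_monic v0 v1 N s) m (snd x i))) oo fps_X ^ L)"
      unfolding ps prod fps_compose_X_power_mult[OF L(1)] by (simp flip: int)
    finally show ?thesis unfolding T_def sum .
  qed
  have par: "param_fps N (T r w l)" for r w l
    unfolding T_def[abs_def]
    by (intro param_fps_sum_list param_fps_mult param_fps_prod param_fps_const param_fps_newton_psum param_fps_polar_monic)
  have "\<forall>c. \<exists>zd. generic_on N Z (\<lambda>s. (T (fst c) (fst (snd c)) (snd (snd c)) s = 0 \<longleftrightarrow> fst zd)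
      \<and> subdegree (T (fst c) (fst (snd c)) (snd (snd c)) s) = snd zd)"
  proof
    fix c :: "nat \<times> (nat \<Rightarrow> nat) \<times> nat"
    obtain zero d where "generic_on N Z (\<lambda>s. (T (fst c) (fst (snd c)) (snd (snd c)) s = 0 \<longleftrightarrow> zero)
        \<and> subdegree (T (fst c) (fst (snd c)) (snd (snd c)) s) = d)"
      using generic_order[OF Z par] by blast
    then show "\<exists>zd. generic_on N Z (\<lambda>s. (T (fst c) (fst (snd c)) (snd (snd c)) s = 0 \<longleftrightarrow> fst zd)
        \<and> subdegree (T (fst c) (fst (snd c)) (snd (snd c)) s) = snd zd)"
      by (intro exI[of _ "(zero, d)"]) simp
  qed
  from choice[OF this] obtain zd where zd: "\<forall>c. generic_on N Z (\<lambda>s. (T (fst c) (fst (snd c)) (snd (snd c)) s = 0 \<longleftrightarrow> fst (zd c))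
      \<and> subdegree (T (fst c) (fst (snd c)) (snd (snd c)) s) = snd (zd c))" ..
  define ok where "ok r w l s \<longleftrightarrow> (T r w l s = 0 \<longleftrightarrow> fst (zd (r, w, l))) \<and> subdegree (T r w l s) = snd (zd (r, w, l))"
    for r w l s
  have gen: "generic_on N Z (ok r w l)" for r w l
    using spec[OF zd, of "(r, w, l)"] by (simp add: ok_def[abs_def])
  have same: "same_order (contact_sum r w l m y) (contact_sum r w l m y')"
    if "\<And>j. fps_nth (recip_fps y {..<m}) j = polar_monic v0 v1 N s j oo fps_X ^ L"
      "\<And>j. fps_nth (recip_fps y' {..<m}) j = polar_monic v0 v1 N s' j oo fps_X ^ L"
      "ok r w l s" "ok r w l s'" for y y' s s' r w l
    unfolding T[OF that(1)] T[OF that(2)]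
    using that(3,4) by (intro same_order_compose L) (auto simp: ok_def same_order_def)
  have finPhi: "finite (\<Phi> r)" for r by (simp add: \<Phi>_def finite_PiE)
  \<comment> \<open>First round of conditions: finitely many sums with weights 1, enough to fix the
    number of distinct roots and their total contact.\<close>
  define K where "K = Sigma {..m} (\<lambda>r. {1..card (\<Phi> r)})"
  define Q1 where "Q1 s \<longleftrightarrow> (\<forall>c\<in>K. ok (fst c) (\<lambda>_. 1) (snd c) s)" for s
  have genQ1: "generic_on N Z Q1"
    unfolding Q1_def[abs_def] by (rule generic_on_ball[OF Z]) (auto simp: K_def gen)
  then obtain F1 where F1: "zclosed N F1" "\<not> Z \<subseteq> F1" "\<And>z. z \<in> Z - F1 \<Longrightarrow> finite {l. \<not> Q1 (z, l)}"
    unfolding generic_on_def by blast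
  have "\<exists>F. zclosed N F \<and> \<not> Z \<subseteq> F \<and> (\<forall>p\<in>Z - F. \<forall>q\<in>Z - F. \<forall>f g. weq p f \<longrightarrow> weq q g \<longrightarrow> same_general_polar_class f g)"
  proof (cases "\<exists>z\<in>Z - F1. \<exists>f. weq z f")
    \<comment> \<open>No point outside \<open>F1\<close> has an equation, so there is nothing to
      compare and \<open>F1\<close> itself serves.\<close>
    case False
    then show ?thesis using F1 by blast
  next
    case True
    then obtain z0 f0 where z0: "z0 \<in> Z - F1" "weq z0 f0" by blast
    \<comment> \<open>Any generic sample will do, since the root count and total contact agree at
      all parameters satisfying \<open>Q1\<close>.\<close>
    obtain l0 where l0: "Q1 (z0, l0)"
      using ex_new_if_finite[OF infinite_UNIV_char_0 F1(3)[OF z0(1)]] by blast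
    have "\<exists>y0. \<forall>j. fps_nth (recip_fps y0 {..<m}) j = polar_monic v0 v1 N (z0, l0 / 1) j oo fps_X ^ L"
      using roots[OF DiffD1[OF z0(1)] z0(2) one_neq_zero, of l0] by (elim exE conjE) (rule exI)
    then obtain y0 where y0: "\<And>j. fps_nth (recip_fps y0 {..<m}) j = polar_monic v0 v1 N (z0, l0) j oo fps_X ^ L"
      by auto
    define r where "r = card (y0 ` {..<m})"
    \<comment> \<open>\<open>B\<close> exceeds the total contact at the sample, hence at every
      parameter satisfying \<open>Q1\<close>; the second round uses it as the base of the
      weights.\<close>
    define B where "B = Suc (min_order (\<lambda>\<phi>. contact_prod r (\<lambda>_. 1) (\<lambda>i. y0 (\<phi> i))) (\<Phi> r))"
    define Q2 where "Q2 s \<longleftrightarrow> (\<forall>l\<in>{1..card (\<Phi> r)}. ok r (\<lambda>k. B ^ k) l s)" for s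
    have "generic_on N Z Q2" unfolding Q2_def[abs_def] by (rule generic_on_ball[OF Z]) (auto simp: gen)
    then have "generic_on N Z (\<lambda>s. Q1 s \<and> Q2 s)" by (rule generic_on_conj[OF Z genQ1])
    then obtain F where F: "zclosed N F" "\<not> Z \<subseteq> F" "\<And>z. z \<in> Z - F \<Longrightarrow> finite {l. \<not> (Q1 (z, l) \<and> Q2 (z, l))}"
      unfolding generic_on_def by blast
    have one: "same_order (contact_sum r (\<lambda>_. 1) l m y) (contact_sum r (\<lambda>_. 1) l m y')"
      if "\<And>j. fps_nth (recip_fps y {..<m}) j = polar_monic v0 v1 N s j oo fps_X ^ L" "Q1 s"
        "\<And>j. fps_nth (recip_fps y' {..<m}) j = polar_monic v0 v1 N s' j oo fps_X ^ L" "Q1 s'"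
        "r \<le> m" "l \<in> {1..card ({..<r} \<rightarrow>\<^sub>E {..<m})}" for y y' s s' r l
    proof (rule same[OF that(1,3)])
      have "(r, l) \<in> K" using that(5,6) by (simp add: K_def \<Phi>_def)
      then show "ok r (\<lambda>_. 1) l s" "ok r (\<lambda>_. 1) l s'" using that(2,4) by (auto simp: Q1_def)
    qed
    have "top_equiv (polar f a b) (polar g a' b')"
      if p: "p \<in> Z" "weq p f" and q: "q \<in> Z" "weq q g" and b: "b \<noteq> 0" "Q1 (p, a / b)" "Q2 (p, a / b)"
        and b': "b' \<noteq> 0" "Q1 (q, a' / b')" "Q2 (q, a' / b')" for p q f g a b a' b'
    proof -
      obtain y v \<rho> where Y: "\<forall>j. fps_nth (recip_fps y {..<m}) j = polar_monic v0 v1 N (p, a / b) j oo fps_X ^ L"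
        "fps_nth v 0 \<noteq> 0" "\<forall>x\<in>(*) v ` y ` {..<m}. fps_conv_radius x > 0" "\<forall>x\<in>(*) v ` y ` {..<m}. fps_nth x 0 = 0"
        "fps_rot (cis (2 * pi / L)) ` (*) v ` y ` {..<m} \<subseteq> (*) v ` y ` {..<m}" "\<rho> > 0"
        "\<forall>t u. cmod t < \<rho> \<longrightarrow> (polar f a b (t ^ L, u) = 0 \<longleftrightarrow> (\<exists>x\<in>(*) v ` y ` {..<m}. u = eval_fps x t))"
        using roots[OF p b(1), of a] by (elim exE conjE) (rule that)
      note y = Y[rule_format]
      obtain y' v' \<rho>' where Y': "\<forall>j. fps_nth (recip_fps y' {..<m}) j = polar_monic v0 v1 N (q, a' / b') j oo fps_X ^ L"
        "fps_nth v' 0 \<noteq> 0" "\<forall>x\<in>(*) v' ` y' ` {..<m}. fps_conv_radius x > 0" "\<forall>x\<in>(*) v' ` y' ` {..<m}. fps_nth x 0 = 0"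
        "fps_rot (cis (2 * pi / L)) ` (*) v' ` y' ` {..<m} \<subseteq> (*) v' ` y' ` {..<m}" "\<rho>' > 0"
        "\<forall>t u. cmod t < \<rho>' \<longrightarrow> (polar g a' b' (t ^ L, u) = 0 \<longleftrightarrow> (\<exists>x\<in>(*) v' ` y' ` {..<m}. u = eval_fps x t))"
        using roots[OF q b'(1), of a'] by (elim exE conjE) (rule that)
      note y' = Y'[rule_format]
      have cnt: "card (y ` {..<m}) = r"
        "min_order (\<lambda>\<phi>. contact_prod r (\<lambda>_. 1) (\<lambda>i. y (\<phi> i))) (\<Phi> r) < B"
        using contact_count_by_sums[OF one[OF y0 l0 y(1) b(2)] r_def] by (simp_all add: B_def \<Phi>_def)
      have "contact_equiv 1 (y ` {..<m}) (y' ` {..<m})"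
      proof (rule contact_equiv_by_sums[OF one[OF y(1) b(2) y'(1) b'(2)]])
        show "r = card (y ` {..<m})" using cnt by simp
        show "min_order (\<lambda>\<phi>. contact_prod r (\<lambda>_. 1) (\<lambda>i. y (\<phi> i))) ({..<r} \<rightarrow>\<^sub>E {..<m}) < B"
          using cnt by (simp add: \<Phi>_def)
        show "same_order (contact_sum r ((^) B) l m y) (contact_sum r ((^) B) l m y')"
          if "l \<in> {1..card ({..<r} \<rightarrow>\<^sub>E {..<m})}" for l
          using same[OF y(1) y'(1)] b(3) b'(3) that by (auto simp: Q2_def \<Phi>_def)
      qed
      \<comment> \<open>The contacts were compared for roots of the monic versions; the unit factors
        carry the matching over to the roots of the polars.\<close>
      then have ce: "contact_equiv 1 ((*) v ` y ` {..<m}) ((*) v' ` y' ` {..<m})"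
        using contact_equiv_sym[OF contact_equiv_unit_mult[OF y(2)]] contact_equiv_unit_mult[OF y'(2)]
          contact_equiv_trans by blast
      have wL: "cis (2 * pi / L) ^ L = 1" using L(1) by (simp add: Complex.DeMoivre)
      have "contact_equiv (cis (2 * pi / L)) ((*) v ` y ` {..<m}) ((*) v' ` y' ` {..<m})"
        by (rule contact_equiv_equivariant[OF _ ce y(5) y'(5) wL L(1)]) simp
      then have "germ_equiv {p. polar f a b p = 0} {p. polar g a' b' p = 0}"
      proof (rule germ_equiv_contact[rotated 3, where ?r0.0 = "min \<rho> \<rho>'"])
        show "(t ^ L, u) \<in> {p. polar f a b p = 0} \<longleftrightarrow> (\<exists>x\<in>(*) v ` y ` {..<m}. u = eval_fps x t)"
          if "cmod t < min \<rho> \<rho>'" for t u using y(7)[of t u] that by simp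
        show "(t ^ L, u) \<in> {p. polar g a' b' p = 0} \<longleftrightarrow> (\<exists>x\<in>(*) v' ` y' ` {..<m}. u = eval_fps x t)"
          if "cmod t < min \<rho> \<rho>'" for t u using y'(7)[of t u] that by simp
        show "(*) v ` y ` {..<m} \<noteq> {}" using m by auto
        show "fps_conv_radius x > 0" if "x \<in> (*) v ` y ` {..<m} \<union> (*) v' ` y' ` {..<m}" for x
          using that y(3) y'(3) by blast
        show "fps_nth x 0 = 0" if "x \<in> (*) v ` y ` {..<m} \<union> (*) v' ` y' ` {..<m}" for x
          using that y(4) y'(4) by blast
      qed (use y(6) y'(6) L(1) in simp_all)
      then show ?thesis by (simp add: top_equiv_iff_germ_equiv)
    qed
    \<comment> \<open>The directions for \<open>f\<close> and \<open>g\<close> vary independently,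
      each avoiding the finite exceptional set of its own curve.\<close>
    then have "same_general_polar_class f g" if "p \<in> Z - F" "q \<in> Z - F" "weq p f" "weq q g" for p q f g
      unfolding same_general_polar_class_def using that
      by (intro general_dirI[OF F(3)[of p]] general_dirI[OF F(3)[of q]]) auto
    then show ?thesis using F(1,2) by blast
  qed
  then obtain F where F: "zclosed N F" "\<not> Z \<subseteq> F"
    "\<forall>p\<in>Z - F. \<forall>q\<in>Z - F. \<forall>f g. weq p f \<longrightarrow> weq q g \<longrightarrow> same_general_polar_class f g" by blast
  show ?thesis
    using zopen_dense_complement[OF Z F(1,2)] F(3)
    by (intro exI[of _ "Z - F"]) (auto simp: weq_def v0_def v1_def N_def)
qed

end
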